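(* Let $(M,\mathcal{D})$ be an exact contact manifold with $\mathcal{D}=\ker\eta$ and local Darboux coordinates $(q^i,p_i,s)$. Let a smooth contact Hamiltonian be separable into a sum of smooth functions $$\mathcal{H}(q^i,p_i,s)=\sum_{j=1}^N\phi_j(q^i,p_i,s)$$ such that each of the contact Hamiltonian vector fields $X_{\phi_j}$ is exactly integrable. Then $$S_2(\tau)=e^{\frac{\tau}{2}X_{\phi_1}}\,e^{\frac{\tau}{2}X_{\phi_2}}\cdots e^{\frac{\tau}{2}X_{\phi_{N-1}}}\,e^{\tau X_{\phi_N}}\,e^{\frac{\tau}{2}X_{\phi_{N-1}}}\cdots e^{\frac{\tau}{2}X_{\phi_2}}\,e^{\frac{\tau}{2}X_{\phi_1}}$$ is a second order contact integrator for the flow of $X_{\mathcal{H}}$.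
   Context: An exact contact manifold is a $(2n+1)$-dimensional manifold $M$ with a hyperplane distribution $\mathcal{D}=\ker\eta$, where $\eta$ is a global $1$-form with $\eta\wedge(\mathrm{d}\eta)^n\neq0$ everywhere. Darboux coordinates are local coordinates with $\eta=\mathrm{d}s-\sum_i p_i\,\mathrm{d}q^i$. For a function $\mathcal{H}$ on $M$, the contact Hamiltonian vector field $X_{\mathcal{H}}$ is determined by $\mathcal{L}_{X_{\mathcal{H}}}\eta=\rho\,\eta$ for some function $\rho$ and $\iota_{X_{\mathcal{H}}}\eta=-\mathcal{H}$; in Darboux coordinates $$X_{\mathcal{H}}=\sum_i\frac{\partial\mathcal{H}}{\partial p_i}\frac{\partial}{\partial q^i}-\sum_i\Big(\frac{\partial\mathcal{H}}{\partial q^i}+p_i\frac{\partial\mathcal{H}}{\partial s}\Big)\frac{\partial}{\partial p_i}+\Big(\sum_i p_i\frac{\partial\mathcal{H}}{\partial p_i}-\mathcal{H}\Big)\frac{\partial}{\partial s}.$$ For a vector field $Y$, $e^{tY}$ denotes its time-$t$ flow map (defined where the flow exists), and products denote composition of maps. A vector field $Y$ is exactly integrable if the solution $x(t)=e^{tY}x_0$ of $\dot x=Y(x)$, $x(0)=x_0$, can be written explicitly in closed form (this matters only for implementability). A one-parameter family of maps $S(\tau)$ is an integrator of order $k$ for $\dot x=X(x)$ if, in local coordinates and for each $x$, $S(\tau)(x)-e^{\tau X}(x)=\mathcal{O}(\tau^{k+1})$ as $\tau\to0$. It is a contact integrator if it preserves the contact structure, i.e. each map $S(\tau)$ satisfies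 $S(\tau)^*\eta=\rho_\tau\,\eta$ with $\rho_\tau$ a nowhere vanishing function. *)

theory Defs
  imports "HOL-Analysis.Analysis" "HOL-Library.Landau_Symbols"
begin

section \<open>Smooth maps between open subsets of normed spaces\<close>

text \<open>
  \<open>Ck_on k f S\<close> is meant for open \<open>S\<close>. In finite dimension, requiring every directional
  derivative to be \<open>C\<^sup>k\<close> is the same as requiring the total derivative to be \<open>C\<^sup>k\<close>.
\<close>

primrec Ck_on ::
  "nat \<Rightarrow> ('a::real_normed_vector \<Rightarrow> 'b::real_normed_vector) \<Rightarrow> 'a set \<Rightarrow> bool" where
  "Ck_on 0 f S \<longleftrightarrow> continuous_on S f"
| "Ck_on (Suc k) f S \<longleftrightarrow>
     (\<forall>x\<in>S. f differentiable (at x)) \<and> (\<forall>v. Ck_on k (\<lambda>x. frechet_derivative f (at x) v) S)"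

definition smooth_on ::
  "('a::real_normed_vector \<Rightarrow> 'b::real_normed_vector) \<Rightarrow> 'a set \<Rightarrow> bool" where
  "smooth_on f S \<longleftrightarrow> (\<forall>k. Ck_on k f S)"


section \<open>Smooth manifolds\<close>

text \<open>
  A chart is a pair \<open>(U, x)\<close> of an open set and a coordinate map, whose values outside \<open>U\<close>
  are irrelevant. The manifold given by an atlas \<open>A\<close> is the union of its chart domains; being
  Hausdorff and second countable is imposed on the type of points.
\<close>

type_synonym ('m, 'e) chart = "'m set \<times> ('m \<Rightarrow> 'e)"

definition chart_dom :: "('m, 'e) chart \<Rightarrow> 'm set" where
  "chart_dom c = fst c"

definition coord :: "('m, 'e) chart \<Rightarrow> 'm \<Rightarrow> 'e" where
  "coord c = snd c"

definition chart_img :: "('m, 'e) chart \<Rightarrow> 'e set" where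
  "chart_img c = coord c ` chart_dom c"

definition chart_inv :: "('m, 'e) chart \<Rightarrow> 'e \<Rightarrow> 'm" where
  "chart_inv c = inv_into (chart_dom c) (coord c)"

definition is_chart :: "('m::topological_space, 'e::euclidean_space) chart \<Rightarrow> bool" where
  "is_chart c \<longleftrightarrow> open (chart_dom c) \<and> open (chart_img c) \<and>
     homeomorphism (chart_dom c) (chart_img c) (coord c) (chart_inv c)"

definition transition :: "('m, 'e) chart \<Rightarrow> ('m, 'e) chart \<Rightarrow> 'e \<Rightarrow> 'e" where
  "transition c d = coord d \<circ> chart_inv c"

definition overlap :: "('m, 'e) chart \<Rightarrow> ('m, 'e) chart \<Rightarrow> 'e set" where
  "overlap c d = coord c ` (chart_dom c \<inter> chart_dom d)"

definition smooth_atlas :: "('m::topological_space, 'e::euclidean_space) chart set \<Rightarrow> bool" where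
  "smooth_atlas A \<longleftrightarrow>
     (\<forall>c\<in>A. is_chart c) \<and> (\<forall>c\<in>A. \<forall>d\<in>A. smooth_on (transition c d) (overlap c d))"

definition manifold :: "('m, 'e) chart set \<Rightarrow> 'm set" where
  "manifold A = (\<Union>c\<in>A. chart_dom c)"

definition smooth_function ::
  "('m, 'e::euclidean_space) chart set \<Rightarrow> ('m \<Rightarrow> real) \<Rightarrow> bool" where
  "smooth_function A f \<longleftrightarrow> (\<forall>c\<in>A. smooth_on (f \<circ> chart_inv c) (chart_img c))"

text \<open>
  Tensor fields are given by their components in each chart of the atlas, subject to the usual
  transformation law: \<open>X c u\<close> is the coordinate vector of the field at the point with coordinates
  \<open>u\<close> in the chart \<open>c\<close>, and \<open>\<eta> c u v\<close> is the form at that point applied to the tangent vector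
  with coordinate vector \<open>v\<close>.
\<close>

type_synonym ('m, 'e) vfield = "('m, 'e) chart \<Rightarrow> 'e \<Rightarrow> 'e"

type_synonym ('m, 'e) form1 = "('m, 'e) chart \<Rightarrow> 'e \<Rightarrow> 'e \<Rightarrow> real"

definition vector_field ::
  "('m, 'e::euclidean_space) chart set \<Rightarrow> ('m, 'e) vfield \<Rightarrow> bool" where
  "vector_field A X \<longleftrightarrow>
     (\<forall>c\<in>A. smooth_on (X c) (chart_img c)) \<and>
     (\<forall>c\<in>A. \<forall>d\<in>A. \<forall>u\<in>overlap c d.
        X d (transition c d u) = frechet_derivative (transition c d) (at u) (X c u))"

definition one_form ::
  "('m, 'e::euclidean_space) chart set \<Rightarrow> ('m, 'e) form1 \<Rightarrow> bool" where
  "one_form A \<eta> \<longleftrightarrow>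
     (\<forall>c\<in>A. (\<forall>u\<in>chart_img c. linear (\<eta> c u)) \<and>
             (\<forall>v. smooth_on (\<lambda>u. \<eta> c u v) (chart_img c))) \<and>
     (\<forall>c\<in>A. \<forall>d\<in>A. \<forall>u\<in>overlap c d. \<forall>v.
        \<eta> d (transition c d u) (frechet_derivative (transition c d) (at u) v) = \<eta> c u v)"


section \<open>Exact contact manifolds and contact Hamiltonian vector fields\<close>

text \<open>Here \<open>\<alpha>\<close> is the coordinate expression of a 1-form, and \<open>Y\<close> that of a vector field.\<close>

definition ext_deriv ::
  "('e::euclidean_space \<Rightarrow> 'e \<Rightarrow> real) \<Rightarrow> 'e \<Rightarrow> 'e \<Rightarrow> 'e \<Rightarrow> real" where
  "ext_deriv \<alpha> u v w =
     frechet_derivative (\<lambda>y. \<alpha> y w) (at u) v - frechet_derivative (\<lambda>y. \<alpha> y v) (at u) w"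

text \<open>
  The value of the \<open>(2n+1)\<close>-form \<open>\<alpha> \<and> (d\<alpha>)\<^sup>n\<close> on the vectors \<open>v 0, \<dots>, v (2n)\<close>. For forms
  \<open>\<alpha>\<^sub>i\<close> of degree \<open>k\<^sub>i\<close>, the product \<open>\<alpha>\<^sub>1 \<and> \<dots> \<and> \<alpha>\<^sub>r\<close> is the alternating sum of the
  tensor product over all permutations of the arguments, divided by \<open>k\<^sub>1! \<cdots> k\<^sub>r!\<close>, which here
  is \<open>2\<^sup>n\<close>.
\<close>

definition contact_volume ::
  "nat \<Rightarrow> ('e::euclidean_space \<Rightarrow> 'e \<Rightarrow> real) \<Rightarrow> 'e \<Rightarrow> (nat \<Rightarrow> 'e) \<Rightarrow> real" where
  "contact_volume n \<alpha> u v =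
     (\<Sum>\<sigma> | \<sigma> permutes {..2 * n}.
        of_int (sign \<sigma>) * \<alpha> u (v (\<sigma> 0)) *
        (\<Prod>i<n. ext_deriv \<alpha> u (v (\<sigma> (2 * i + 1))) (v (\<sigma> (2 * i + 2))))) / 2 ^ n"

definition exact_contact_manifold ::
  "nat \<Rightarrow> ('m::{t2_space, second_countable_topology}, 'e::euclidean_space) chart set \<Rightarrow>
     ('m, 'e) form1 \<Rightarrow> bool" where
  "exact_contact_manifold n A \<eta> \<longleftrightarrow>
     DIM('e) = 2 * n + 1 \<and> smooth_atlas A \<and> one_form A \<eta> \<and>
     (\<forall>c\<in>A. \<forall>u\<in>chart_img c. \<exists>v. contact_volume n (\<eta> c) u v \<noteq> 0)"

text \<open>
  In index notation the next formula is
  \<open>(\<L>\<^sub>Y \<alpha>)\<^sub>i = Y\<^sup>j \<partial>\<^sub>j \<alpha>\<^sub>i + \<alpha>\<^sub>j \<partial>\<^sub>i Y\<^sup>j\<close>.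
\<close>

definition lie_deriv ::
  "('e::euclidean_space \<Rightarrow> 'e) \<Rightarrow> ('e \<Rightarrow> 'e \<Rightarrow> real) \<Rightarrow> 'e \<Rightarrow> 'e \<Rightarrow> real" where
  "lie_deriv Y \<alpha> u v =
     frechet_derivative (\<lambda>y. \<alpha> y v) (at u) (Y u) + \<alpha> u (frechet_derivative Y (at u) v)"

text \<open>\<open>X\<close> is the contact Hamiltonian vector field \<open>X\<^sub>H\<close>; these conditions determine it.\<close>

definition contact_hamiltonian_field ::
  "('m, 'e::euclidean_space) chart set \<Rightarrow> ('m, 'e) form1 \<Rightarrow> ('m \<Rightarrow> real) \<Rightarrow>
     ('m, 'e) vfield \<Rightarrow> bool" where
  "contact_hamiltonian_field A \<eta> H X \<longleftrightarrow>
     vector_field A X \<and>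
     (\<forall>c\<in>A. \<forall>u\<in>chart_img c. \<eta> c u (X c u) = - H (chart_inv c u)) \<and>
     (\<exists>\<rho>. \<forall>c\<in>A. \<forall>u\<in>chart_img c. \<forall>v.
        lie_deriv (X c) (\<eta> c) u v = \<rho> (chart_inv c u) * \<eta> c u v)"


section \<open>Flows\<close>

text \<open>
  The explicit continuity of \<open>\<gamma>\<close> is needed because coordinate maps take arbitrary values outside
  their chart domains.
\<close>

definition integral_curve ::
  "('m::topological_space, 'e::euclidean_space) chart set \<Rightarrow> ('m, 'e) vfield \<Rightarrow>
     real set \<Rightarrow> (real \<Rightarrow> 'm) \<Rightarrow> bool" where
  "integral_curve A X I \<gamma> \<longleftrightarrow>
     continuous_on I \<gamma> \<and> \<gamma> ` I \<subseteq> manifold A \<and>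
     (\<forall>t\<in>I. \<forall>c\<in>A. \<gamma> t \<in> chart_dom c \<longrightarrow>
        ((\<lambda>s. coord c (\<gamma> s)) has_vector_derivative X c (coord c (\<gamma> t))) (at t within I))"

definition flows_to ::
  "('m::topological_space, 'e::euclidean_space) chart set \<Rightarrow> ('m, 'e) vfield \<Rightarrow>
     real \<Rightarrow> 'm \<Rightarrow> 'm \<Rightarrow> bool" where
  "flows_to A X t x y \<longleftrightarrow>
     (\<exists>\<gamma>. integral_curve A X (closed_segment 0 t) \<gamma> \<and> \<gamma> 0 = x \<and> \<gamma> t = y)"

text \<open>The map \<open>e\<^sup>t\<^sup>X\<close>, a partial map since \<open>X\<close> need not be complete.\<close>

definition flow ::
  "('m::topological_space, 'e::euclidean_space) chart set \<Rightarrow> ('m, 'e) vfield \<Rightarrow>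
     real \<Rightarrow> 'm \<rightharpoonup> 'm" where
  "flow A X t x = (if \<exists>y. flows_to A X t x y then Some (THE y. flows_to A X t x y) else None)"

text \<open>
  Which expressions count as closed-form ones is left open, so that this is relative to an arbitrary
  class \<open>closed_form\<close> of families of partial maps.
\<close>

definition exactly_integrable ::
  "((real \<Rightarrow> 'm \<rightharpoonup> 'm) \<Rightarrow> bool) \<Rightarrow>
     ('m::topological_space, 'e::euclidean_space) chart set \<Rightarrow> ('m, 'e) vfield \<Rightarrow> bool" where
  "exactly_integrable closed_form A X \<longleftrightarrow> closed_form (flow A X)"


section \<open>Contact integrators\<close>

definition integrator_of_order ::
  "nat \<Rightarrow> ('m::topological_space, 'e::euclidean_space) chart set \<Rightarrow> ('m, 'e) vfield \<Rightarrow>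
     (real \<Rightarrow> 'm \<rightharpoonup> 'm) \<Rightarrow> bool" where
  "integrator_of_order k A X S \<longleftrightarrow>
     (\<forall>c\<in>A. \<forall>x\<in>chart_dom c.
        (\<forall>\<^sub>F \<tau> in at 0. \<exists>y\<in>chart_dom c. \<exists>z\<in>chart_dom c.
           S \<tau> x = Some y \<and> flow A X \<tau> x = Some z) \<and>
        (\<lambda>\<tau>. norm (coord c (the (S \<tau> x)) - coord c (the (flow A X \<tau> x))))
          \<in> O[at 0](\<lambda>\<tau>. \<tau> ^ (k + 1)))"

text \<open>\<open>f\<^sup>* \<eta> = \<rho> \<eta>\<close> on the domain of the partial map \<open>f\<close>, with \<open>\<rho>\<close> nowhere zero there.\<close>

definition contact_map ::
  "('m::topological_space, 'e::euclidean_space) chart set \<Rightarrow> ('m, 'e) form1 \<Rightarrow>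
     ('m \<rightharpoonup> 'm) \<Rightarrow> bool" where
  "contact_map A \<eta> f \<longleftrightarrow>
     open (dom f) \<and> dom f \<subseteq> manifold A \<and> ran f \<subseteq> manifold A \<and>
     continuous_on (dom f) (\<lambda>x. the (f x)) \<and>
     (\<exists>\<rho>. \<forall>x\<in>dom f. \<rho> x \<noteq> 0 \<and>
        (\<forall>c\<in>A. \<forall>d\<in>A. x \<in> chart_dom c \<longrightarrow> the (f x) \<in> chart_dom d \<longrightarrow>
           (\<exists>D. ((\<lambda>u. coord d (the (f (chart_inv c u)))) has_derivative D) (at (coord c x)) \<and>
                (\<forall>v. \<eta> d (coord d (the (f x))) (D v) = \<rho> x * \<eta> c (coord c x) v))))"

definition contact_integrator_of_order ::
  "nat \<Rightarrow> ('m::topological_space, 'e::euclidean_space) chart set \<Rightarrow> ('m, 'e) form1 \<Rightarrow>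
     ('m, 'e) vfield \<Rightarrow> (real \<Rightarrow> 'm \<rightharpoonup> 'm) \<Rightarrow> bool" where
  "contact_integrator_of_order k A \<eta> X S \<longleftrightarrow>
     integrator_of_order k A X S \<and> (\<forall>\<tau>. contact_map A \<eta> (S \<tau>))"

text \<open>The fields are \<open>X 1, \<dots>, X N\<close>; the list is composed as written, rightmost map first.\<close>

definition S2 ::
  "('m::topological_space, 'e::euclidean_space) chart set \<Rightarrow> (nat \<Rightarrow> ('m, 'e) vfield) \<Rightarrow>
     nat \<Rightarrow> real \<Rightarrow> 'm \<rightharpoonup> 'm" where
  "S2 A X N \<tau> =
     foldr (\<circ>\<^sub>m)
       (map (\<lambda>j. flow A (X j) (\<tau> / 2)) [1..<N] @ [flow A (X N) \<tau>] @
        map (\<lambda>j. flow A (X j) (\<tau> / 2)) (rev [1..<N]))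
       Some"

end

theory Submission
  imports Defs
begin

text \<open>
  There are two things to show: each \<open>S\<^sub>2(\<tau>)\<close> is a contact map, and it agrees with the flow of
  \<open>X\<^sub>H\<close> up to \<open>O(\<tau>\<^sup>3)\<close>.

  Let \<open>X\<close> be a contact Hamiltonian field, so that \<open>\<L>\<^sub>X \<eta> = \<rho> \<eta>\<close>. Along an integral curve, \<open>\<eta>\<close>
  evaluated on a tangent vector that is carried along by the flow solves the scalar equation
  \<open>g' = \<rho> g\<close>. So its value at the end is the value at the beginning times an exponential, which is
  the same for all tangent vectors (\<open>\<Phi>_conformal\<close>). This presupposes that the flow exists on an open
  set and is differentiable there. Within a chart and for short times, both come from Picard
  iteration, applied to the equation and to its variational equation, and from a Gronwall estimate
  (locale \<open>short_flow\<close>). For long times, an integral curve is compact, and the flow map is near its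
  starting point a composition of short-time flow maps (\<open>contact_map_flow\<close>). As compositions of
  contact maps are contact maps (\<open>contact_map_comp\<close>), the first claim follows.

  For the order, a family of maps is described by what it does to curves
  \<open>x + \<tau> a + \<tau>\<^sup>2 b + O(\<tau>\<^sup>3)\<close>: it turns \<open>a\<close> into \<open>a + F\<close> and \<open>b\<close> into \<open>b + L a + G\<close>. The flow of a field
  has as \<open>F\<close> the value of the field at \<open>x\<close>, as \<open>L\<close> its derivative, and \<open>G = 1/2 L F\<close>
  (\<open>jet_map_flow\<close>). In a composition \<open>F\<close> and \<open>L\<close> are added, and the relation \<open>G = 1/2 L F\<close> survives
  if a family is placed between two equal half steps (\<open>jet_map_sandwich\<close>). Hence \<open>S\<^sub>2(\<tau>)\<close> has, modulo
  \<open>O(\<tau>\<^sup>3)\<close>, the expansion of the flow of the sum of the fields \<open>X j\<close>.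

  That sum is \<open>X\<^sub>H\<close>, as a contact Hamiltonian field is determined by its Hamiltonian: the
  difference \<open>Y\<close> of two such fields lies in the kernel of \<open>\<eta>\<close> and satisfies \<open>d\<eta>(Y, \<cdot>) = \<rho> \<eta>\<close>, so
  that \<open>\<iota>\<^sub>Y (\<eta> \<and> (d\<eta>)\<^sup>n) = 0\<close> and therefore \<open>Y = 0\<close> (\<open>contact_hamiltonian_field_sum\<close>).
\<close>


section \<open>The kernel of a nondegenerate contact form at a point\<close>

text \<open>This is \<open>2\<^sup>n\<close> times the value of \<open>a \<and> w\<^sup>n\<close> on \<open>v 0, \<dots>, v (2n)\<close>, for a covector \<open>a\<close> and a
  bilinear form \<open>w\<close>, so that the linear algebra at a point is free of derivatives.\<close>

definition alt_sum ::
  "nat \<Rightarrow> ('e::euclidean_space \<Rightarrow> real) \<Rightarrow> ('e \<Rightarrow> 'e \<Rightarrow> real) \<Rightarrow> (nat \<Rightarrow> 'e) \<Rightarrow> real" where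
  "alt_sum n a w v =
     (\<Sum>\<sigma> | \<sigma> permutes {..2 * n}.
        of_int (sign \<sigma>) * a (v (\<sigma> 0)) * (\<Prod>i<n. w (v (\<sigma> (2 * i + 1))) (v (\<sigma> (2 * i + 2)))))"

lemma contact_volume_alt_sum: "contact_volume n \<alpha> u v = alt_sum n (\<alpha> u) (ext_deriv \<alpha> u) v / 2 ^ n"
  by (simp add: contact_volume_def alt_sum_def)

lemma sum_permutations_cancel:
  fixes g :: "(nat \<Rightarrow> nat) \<Rightarrow> real"
  assumes "\<And>\<sigma>. \<sigma> permutes S \<Longrightarrow> h \<sigma> permutes S"
    and "\<And>\<sigma>. \<sigma> permutes S \<Longrightarrow> h (h \<sigma>) = \<sigma>"
    and "\<And>\<sigma>. \<sigma> permutes S \<Longrightarrow> g (h \<sigma>) = - g \<sigma>"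
  shows "(\<Sum>\<sigma> | \<sigma> permutes S. g \<sigma>) = 0"
proof -
  have "bij_betw h {\<sigma>. \<sigma> permutes S} {\<sigma>. \<sigma> permutes S}"
    by (rule bij_betw_byWitness[where f' = h]) (use assms in auto)
  then have "(\<Sum>\<sigma> | \<sigma> permutes S. g (h \<sigma>)) = (\<Sum>\<sigma> | \<sigma> permutes S. g \<sigma>)"
    by (rule sum.reindex_bij_betw)
  moreover have "(\<Sum>\<sigma> | \<sigma> permutes S. g (h \<sigma>)) = - (\<Sum>\<sigma> | \<sigma> permutes S. g \<sigma>)"
    by (simp add: assms(3) sum_negf)
  ultimately show ?thesis by simp
qed

lemma alt_sum_eq_zero_if_repeated:
  assumes "j \<le> 2 * n" "k \<le> 2 * n" "j \<noteq> k" "v j = v k"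
  shows "alt_sum n a w v = 0"
  unfolding alt_sum_def
proof (rule sum_permutations_cancel[where h = "\<lambda>\<sigma>. Transposition.transpose j k \<circ> \<sigma>"])
  have vt: "v (Transposition.transpose j k i) = v i" for i
    using assms(4) by (simp add: Transposition.transpose_def)
  fix \<sigma> :: "nat \<Rightarrow> nat" assume \<sigma>: "\<sigma> permutes {..2 * n}"
  have tr: "Transposition.transpose j k permutes {..2 * n}"
    using assms by (intro permutes_swap_id) auto
  show "Transposition.transpose j k \<circ> \<sigma> permutes {..2 * n}"
    using permutes_compose[OF \<sigma> tr] .
  show "Transposition.transpose j k \<circ> (Transposition.transpose j k \<circ> \<sigma>) = \<sigma>"
    by (simp add: fun_eq_iff)
  have "sign (Transposition.transpose j k \<circ> \<sigma>) = - sign \<sigma>"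
    using sign_compose[of "Transposition.transpose j k" \<sigma>] \<sigma> tr assms(3)
    by (simp add: sign_swap_id permutes_imp_permutation[of "{..2*n}"])
  then show "of_int (sign (Transposition.transpose j k \<circ> \<sigma>)) * a (v ((Transposition.transpose j k \<circ> \<sigma>) 0)) *
      (\<Prod>i<n. w (v ((Transposition.transpose j k \<circ> \<sigma>) (2 * i + 1))) (v ((Transposition.transpose j k \<circ> \<sigma>) (2 * i + 2)))) =
    - (of_int (sign \<sigma>) * a (v (\<sigma> 0)) * (\<Prod>i<n. w (v (\<sigma> (2 * i + 1))) (v (\<sigma> (2 * i + 2)))))"
    by (simp add: vt)
qed

text \<open>The slots \<open>2i + 1\<close> and \<open>2i + 2\<close> are the arguments of one and the same factor \<open>w\<close>. Slot \<open>0\<close>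
  is the argument of \<open>a\<close> and, because \<open>0 - 1 = 0\<close>, its own partner.\<close>

definition partner :: "nat \<Rightarrow> nat" where
  "partner m = (if odd m then m + 1 else m - 1)"

text \<open>This is \<open>\<iota>\<^sub>Y (a \<and> w\<^sup>n) = 0\<close>, whose reason is \<open>a \<and> a = 0\<close>. In the term of \<open>\<sigma>\<close> the vector \<open>v k\<close> is
  the argument of \<open>a\<close>, and the term is zero, or it is an argument of a factor \<open>w\<close>, which then is
  \<open>\<plusminus> \<rho> a\<close> of the vector in the partner slot. In the latter case, exchanging the partner slot with
  slot \<open>0\<close> changes the sign of \<open>\<sigma>\<close> and nothing else, so that the terms cancel in pairs.\<close>

lemma alt_sum_eq_zero_if_kernel:
  assumes k: "k \<le> 2 * n" and a0: "a (v k) = 0"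
    and wY: "\<And>x. w (v k) x = \<rho> * a x" and anti: "\<And>x y. w x y = - w y x"
  shows "alt_sum n a w v = 0"
  unfolding alt_sum_def
proof (rule sum_permutations_cancel[where h = "\<lambda>\<sigma>. \<sigma> \<circ> Transposition.transpose 0 (partner (inv \<sigma> k))"])
  fix \<sigma> :: "nat \<Rightarrow> nat" assume \<sigma>: "\<sigma> permutes {..2 * n}"
  define m where "m = inv \<sigma> k"
  define q where "q = partner m"
  define \<sigma>' where "\<sigma>' = \<sigma> \<circ> Transposition.transpose 0 q"
  have \<sigma>m: "\<sigma> m = k"
    unfolding m_def using permutes_inverses(1)[OF \<sigma>] by simp
  have m: "m \<le> 2 * n"
    using permutes_in_image[OF permutes_inv[OF \<sigma>], of k] k by (simp add: m_def)
  have q: "q \<le> 2 * n"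
    using m unfolding q_def partner_def by presburger
  have qm: "m \<noteq> 0 \<Longrightarrow> q \<noteq> m \<and> q \<noteq> 0" "m = 0 \<Longrightarrow> q = 0"
    by (auto simp: q_def partner_def)
  have tr: "Transposition.transpose 0 q permutes {..2 * n}"
    using q by (intro permutes_swap_id) auto
  show p': "\<sigma> \<circ> Transposition.transpose 0 (partner (inv \<sigma> k)) permutes {..2 * n}"
    using permutes_compose[OF tr \<sigma>] by (simp add: q_def m_def)
  have p'': "\<sigma>' permutes {..2 * n}"
    using p' by (simp add: \<sigma>'_def q_def m_def)
  have "\<sigma>' m = k"
    using qm \<sigma>m by (cases "m = 0") (auto simp: \<sigma>'_def Transposition.transpose_def)
  then have "inv \<sigma>' k = m"
    using permutes_inverses(2)[OF p''] by metis
  then have "\<sigma>' \<circ> Transposition.transpose 0 (partner (inv \<sigma>' k)) = \<sigma>"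
    unfolding q_def[symmetric] by (simp add: \<sigma>'_def fun_eq_iff q_def)
  then show "(\<sigma> \<circ> Transposition.transpose 0 (partner (inv \<sigma> k))) \<circ>
      Transposition.transpose 0 (partner (inv (\<sigma> \<circ> Transposition.transpose 0 (partner (inv \<sigma> k))) k)) = \<sigma>"
    by (simp add: \<sigma>'_def q_def m_def)
  let ?g = "\<lambda>\<sigma>. of_int (sign \<sigma>) * a (v (\<sigma> 0)) *
      (\<Prod>i<n. w (v (\<sigma> (2 * i + 1))) (v (\<sigma> (2 * i + 2))))"
  have "?g \<sigma>' = - ?g \<sigma>"
  proof (cases "m = 0")
    case True
    then have "\<sigma>' = \<sigma>"
      using qm by (simp add: \<sigma>'_def fun_eq_iff)
    then show ?thesis
      using True \<sigma>m a0 by simp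
  next
    case False
    have "sign \<sigma>' = - sign \<sigma>"
      unfolding \<sigma>'_def using sign_compose[of \<sigma> "Transposition.transpose 0 q"] \<sigma> tr qm False
      by (simp add: sign_swap_id permutes_imp_permutation[of "{..2*n}"])
    note sgn = this
    define i where "i = (m - 1) div 2"
    have i: "i < n"
      using m False by (auto simp: i_def)
    have mi: "m = 2 * i + 1 \<and> q = 2 * i + 2 \<or> m = 2 * i + 2 \<and> q = 2 * i + 1"
      using False by (auto simp: i_def q_def partner_def elim!: oddE evenE)
    have rest: "(\<Prod>j\<in>{..<n} - {i}. w (v (\<sigma>' (2 * j + 1))) (v (\<sigma>' (2 * j + 2)))) =
        (\<Prod>j\<in>{..<n} - {i}. w (v (\<sigma> (2 * j + 1))) (v (\<sigma> (2 * j + 2))))"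
    proof (rule prod.cong[OF refl])
      fix j assume "j \<in> {..<n} - {i}"
      then have "j \<noteq> i" by simp
      then have "2 * j + 1 \<noteq> q" "2 * j + 2 \<noteq> q"
        using mi by presburger+
      then show "w (v (\<sigma>' (2 * j + 1))) (v (\<sigma>' (2 * j + 2))) =
          w (v (\<sigma> (2 * j + 1))) (v (\<sigma> (2 * j + 2)))"
        by (simp add: \<sigma>'_def Transposition.transpose_def)
    qed
    have wY': "w x (v k) = - \<rho> * a x" for x
      by (simp only: anti[of x "v k"] wY mult_minus_left)
    have s0: "\<sigma>' 0 = \<sigma> q" and sq: "\<sigma>' q = \<sigma> 0" and sm: "\<sigma>' m = k"
      using \<open>\<sigma>' m = k\<close> by (auto simp: \<sigma>'_def)
    have "a (v (\<sigma>' 0)) * w (v (\<sigma>' (2 * i + 1))) (v (\<sigma>' (2 * i + 2))) =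
        a (v (\<sigma> 0)) * w (v (\<sigma> (2 * i + 1))) (v (\<sigma> (2 * i + 2)))"
      using mi
    proof (elim disjE conjE)
      assume "m = 2 * i + 1" "q = 2 * i + 2"
      then show ?thesis
        unfolding \<open>m = 2 * i + 1\<close>[symmetric] \<open>q = 2 * i + 2\<close>[symmetric] s0 sq sm \<sigma>m wY
        by (simp only: mult.left_commute mult.commute)
    next
      assume "m = 2 * i + 2" "q = 2 * i + 1"
      then show ?thesis
        unfolding \<open>m = 2 * i + 2\<close>[symmetric] \<open>q = 2 * i + 1\<close>[symmetric] s0 sq sm \<sigma>m wY'
        by (simp only: mult.left_commute mult.commute)
    qed
    note swap = this
    have "(\<Prod>j<n. w (v (s (2 * j + 1))) (v (s (2 * j + 2)))) =
        w (v (s (2 * i + 1))) (v (s (2 * i + 2))) *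
        (\<Prod>j\<in>{..<n} - {i}. w (v (s (2 * j + 1))) (v (s (2 * j + 2))))" for s
      using i by (intro prod.remove) auto
    note split = this
    have reassoc: "x * y * (z * t) = x * (y * z) * t" for x y z t :: real
      by (simp only: mult.assoc)
    show ?thesis
      unfolding split[of \<sigma>] split[of \<sigma>'] reassoc rest swap sgn by (simp only: of_int_minus mult_minus_left)
  qed
  then show "?g (\<sigma> \<circ> Transposition.transpose 0 (partner (inv \<sigma> k))) = - ?g \<sigma>"
    unfolding \<sigma>'_def q_def m_def .
qed

lemma linear_mult_const:
  fixes f :: "'a::real_vector \<Rightarrow> real"
  shows "linear f \<Longrightarrow> linear (\<lambda>x. c * f x * d)"
  by (auto simp: linear_iff algebra_simps)

text \<open>Each term has the vector \<open>v k\<close> in exactly one place, as the argument of \<open>a\<close> or of one factor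
  \<open>w\<close>.\<close>

lemma linear_alt_sum_slot:
  assumes k: "k \<le> 2 * n" and a: "linear a"
    and w: "\<And>x. linear (w x)" and anti: "\<And>x y. w x y = - w y x"
  shows "linear (\<lambda>y. alt_sum n a w (v(k := y)))"
  unfolding alt_sum_def
proof (rule linear_compose_sum, rule ballI)
  have w': "linear (\<lambda>x. w x y)" for y
    using w[of y] by (subst anti) (rule linear_compose_neg)
  fix \<sigma> :: "nat \<Rightarrow> nat" assume "\<sigma> \<in> {\<sigma>. \<sigma> permutes {..2 * n}}"
  then have \<sigma>: "\<sigma> permutes {..2 * n}" by simp
  define m where "m = inv \<sigma> k"
  have \<sigma>m: "\<sigma> l = k \<longleftrightarrow> l = m" for l
    unfolding m_def using permutes_inverses[OF \<sigma>] by auto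
  have m: "m \<le> 2 * n"
    using permutes_in_image[OF permutes_inv[OF \<sigma>], of k] k by (simp add: m_def)
  have v: "(v(k := y)) (\<sigma> l) = (if l = m then y else v (\<sigma> l))" for y l
    using \<sigma>m by simp
  show "linear (\<lambda>y. of_int (sign \<sigma>) * a ((v(k := y)) (\<sigma> 0)) *
      (\<Prod>i<n. w ((v(k := y)) (\<sigma> (2 * i + 1))) ((v(k := y)) (\<sigma> (2 * i + 2)))))"
  proof (cases "m = 0")
    case True
    then show ?thesis
      unfolding v by (simp add: linear_mult_const[OF a])
  next
    case False
    define i where "i = (m - 1) div 2"
    have i: "i < n"
      using m False by (auto simp: i_def)
    have mi: "m = 2 * i + 1 \<or> m = 2 * i + 2"
      using False by (auto simp: i_def elim!: oddE evenE)
    have rest: "(\<Prod>j\<in>{..<n} - {i}. w ((v(k := y)) (\<sigma> (2 * j + 1))) ((v(k := y)) (\<sigma> (2 * j + 2)))) =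
        (\<Prod>j\<in>{..<n} - {i}. w (v (\<sigma> (2 * j + 1))) (v (\<sigma> (2 * j + 2))))" for y
    proof (rule prod.cong[OF refl])
      fix j assume "j \<in> {..<n} - {i}"
      then have "j \<noteq> i" by simp
      then have "2 * j + 1 \<noteq> m" "2 * j + 2 \<noteq> m"
        using mi by presburger+
      then show "w ((v(k := y)) (\<sigma> (2 * j + 1))) ((v(k := y)) (\<sigma> (2 * j + 2))) =
          w (v (\<sigma> (2 * j + 1))) (v (\<sigma> (2 * j + 2)))"
        unfolding v by simp
    qed
    have split: "(\<Prod>j<n. w ((v(k := y)) (\<sigma> (2 * j + 1))) ((v(k := y)) (\<sigma> (2 * j + 2)))) =
        w ((v(k := y)) (\<sigma> (2 * i + 1))) ((v(k := y)) (\<sigma> (2 * i + 2))) *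
        (\<Prod>j\<in>{..<n} - {i}. w (v (\<sigma> (2 * j + 1))) (v (\<sigma> (2 * j + 2))))" for y
      unfolding rest[of y, symmetric] using i by (intro prod.remove) auto
    have "linear (\<lambda>y. w ((v(k := y)) (\<sigma> (2 * i + 1))) ((v(k := y)) (\<sigma> (2 * i + 2))))"
      using mi unfolding v by (elim disjE) (simp_all add: w w')
    from linear_mult_const[OF this, of "of_int (sign \<sigma>) * a (v (\<sigma> 0))"
        "\<Prod>j\<in>{..<n} - {i}. w (v (\<sigma> (2 * j + 1))) (v (\<sigma> (2 * j + 2)))"]
    show ?thesis
      using False unfolding split unfolding mult.assoc[symmetric] v by simp
  qed
qed

text \<open>The vectors \<open>v k\<close> form a basis, since the alternating sum does not vanish on them. Replacing
  \<open>v k\<close> by \<open>Y\<close> multiplies the sum by the \<open>k\<close>-th coordinate of \<open>Y\<close>, but also makes it zero. So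
  all coordinates of \<open>Y\<close> vanish.\<close>

lemma nondegenerate_kernel:
  fixes a :: "'e::euclidean_space \<Rightarrow> real"
  assumes dim: "DIM('e) = 2 * n + 1" and a: "linear a"
    and w: "\<And>x. linear (w x)" and anti: "\<And>x y. w x y = - w y x"
    and vol: "alt_sum n a w v \<noteq> 0"
    and Y: "a Y = 0" "\<And>x. w Y x = \<rho> * a x"
  shows "Y = 0"
proof -
  define L where "L k = (\<lambda>y. alt_sum n a w (v(k := y)))" for k
  have lin: "linear (L k)" if "k \<le> 2 * n" for k
    unfolding L_def using that a w anti by (rule linear_alt_sum_slot)
  have Lk: "L k (v k) = alt_sum n a w v" for k
    by (simp add: L_def)
  have Lj: "L k (v j) = 0" if "j \<le> 2 * n" "k \<le> 2 * n" "j \<noteq> k" for j k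
    unfolding L_def by (rule alt_sum_eq_zero_if_repeated[of j n k]) (use that in auto)
  have LY: "L k Y = 0" if "k \<le> 2 * n" for k
    unfolding L_def
  proof (rule alt_sum_eq_zero_if_kernel[OF that _ _ anti])
    show "a ((v(k := Y)) k) = 0" and "w ((v(k := Y)) k) x = \<rho> * a x" for x
      by (simp_all add: Y)
  qed
  have inj: "inj_on v {..2 * n}"
  proof (rule inj_onI, rule ccontr)
    fix j k assume jk: "j \<in> {..2 * n}" "k \<in> {..2 * n}" "v j = v k" "j \<noteq> k"
    have "alt_sum n a w v = 0"
      by (rule alt_sum_eq_zero_if_repeated[of j n k]) (use jk in auto)
    then show False
      using vol by simp
  qed
  have ind: "independent (v ` {..2 * n})"
  proof
    assume "dependent (v ` {..2 * n})"
    then obtain k where k: "k \<le> 2 * n" "v k \<in> span (v ` {..2 * n} - {v k})"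
      by (auto simp: dependent_def)
    have "L k (v k) = 0"
      by (rule linear_eq_0_on_span[OF lin[OF k(1)] _ k(2)]) (use Lj k in auto)
    then show False
      using vol Lk by simp
  qed
  have "card (v ` {..2 * n}) = dim (UNIV :: 'e set)"
    using inj dim by (simp add: card_image)
  then have "span (v ` {..2 * n}) = UNIV"
    using ind card_ge_dim_independent[of "v ` {..2*n}" UNIV] by auto
  then have "Y \<in> span (v ` {..2 * n})" by simp
  then obtain c where "Y = (\<Sum>x\<in>v ` {..2 * n}. c x *\<^sub>R x)"
    by (auto simp: span_finite)
  then have Yc: "Y = (\<Sum>j\<le>2 * n. c (v j) *\<^sub>R v j)"
    by (simp add: sum.reindex[OF inj])
  have "c (v k) = 0" if k: "k \<le> 2 * n" for k
  proof -
    have "0 = L k Y" using LY k by simp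
    also have "\<dots> = (\<Sum>j\<le>2 * n. c (v j) * L k (v j))"
      unfolding Yc using lin[OF k] by (simp add: linear_sum linear_cmul)
    also have "\<dots> = (\<Sum>j\<le>2 * n. if j = k then c (v k) * alt_sum n a w v else 0)"
      by (rule sum.cong) (use Lk Lj k in auto)
    also have "\<dots> = c (v k) * alt_sum n a w v"
      using k by simp
    finally show ?thesis using vol by simp
  qed
  then show ?thesis
    unfolding Yc by simp
qed


section \<open>Bounds for fields with two continuous derivatives\<close>

lemma norm_linear_le_sum_Basis:
  fixes L :: "'a::euclidean_space \<Rightarrow> 'b::real_normed_vector"
  assumes L: "linear L" and M: "\<And>b. b \<in> Basis \<Longrightarrow> norm (L b) \<le> M b"
  shows "norm (L v) \<le> (\<Sum>b\<in>Basis. M b) * norm v"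
proof -
  have "L v = (\<Sum>b\<in>Basis. (v \<bullet> b) *\<^sub>R L b)"
    using L by (subst euclidean_representation[of v, symmetric]) (simp add: linear_sum linear_cmul)
  also have "norm \<dots> \<le> (\<Sum>b\<in>Basis. M b * norm v)"
  proof (rule sum_norm_le)
    fix b :: 'a assume b: "b \<in> Basis"
    have "norm ((v \<bullet> b) *\<^sub>R L b) = norm (L b) * \<bar>v \<bullet> b\<bar>" by simp
    also have "\<dots> \<le> M b * norm v"
      using b M[OF b] by (intro mult_mono) (auto simp: Basis_le_norm intro: order_trans[OF norm_ge_zero])
    finally show "norm ((v \<bullet> b) *\<^sub>R L b) \<le> M b * norm v" .
  qed
  finally show ?thesis by (simp add: sum_distrib_right)
qed

text \<open>In finite dimension it suffices to know the continuity of a family of linear maps in each fixed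
  direction, which is the form in which \<open>Ck_on\<close> provides it.\<close>

lemma continuous_on_linear_family:
  fixes L :: "'c::topological_space \<Rightarrow> 'a::euclidean_space \<Rightarrow> 'b::real_normed_vector"
  assumes "\<And>x. x \<in> S \<Longrightarrow> linear (L x)"
    and "\<And>b. b \<in> Basis \<Longrightarrow> continuous_on S (\<lambda>x. L x b)" and "continuous_on S g"
  shows "continuous_on S (\<lambda>x. L x (g x))"
proof -
  have "continuous_on S (\<lambda>x. \<Sum>b\<in>Basis. (g x \<bullet> b) *\<^sub>R L x b)"
    by (intro continuous_intros assms)
  moreover have "(\<Sum>b\<in>Basis. (g x \<bullet> b) *\<^sub>R L x b) = L x (g x)" if "x \<in> S" for x
  proof -
    have "L x (g x) = L x (\<Sum>b\<in>Basis. (g x \<bullet> b) *\<^sub>R b)"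
      by (simp add: euclidean_representation)
    also have "\<dots> = (\<Sum>b\<in>Basis. (g x \<bullet> b) *\<^sub>R L x b)"
      using assms(1)[OF that] by (simp add: linear_sum linear_cmul)
    finally show ?thesis ..
  qed
  ultimately show ?thesis
    by (simp cong: continuous_on_cong)
qed

abbreviation Dat :: "('a::real_normed_vector \<Rightarrow> 'b::real_normed_vector) \<Rightarrow> 'a \<Rightarrow> 'a \<Rightarrow> 'b" where
  "Dat f x \<equiv> frechet_derivative f (at x)"

lemma has_derivative_Dat: "f differentiable (at x) \<Longrightarrow> (f has_derivative Dat f x) (at x)"
  by (simp add: frechet_derivative_works)

lemma linear_Dat: "f differentiable (at x) \<Longrightarrow> linear (Dat f x)"
  by (rule linear_frechet_derivative)

lemma Dat_bounded_on_compact: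
  fixes g :: "'a::euclidean_space \<Rightarrow> 'b::real_normed_vector"
  assumes "compact S" "\<And>x. x \<in> S \<Longrightarrow> g differentiable (at x)"
    and "\<And>v. continuous_on S (\<lambda>x. Dat g x v)"
  obtains K where "0 \<le> K" "\<And>x v. x \<in> S \<Longrightarrow> norm (Dat g x v) \<le> K * norm v"
proof -
  have "\<exists>M\<ge>0. \<forall>x\<in>S. norm (Dat g x b) \<le> M" for b
  proof -
    have "bounded ((\<lambda>x. Dat g x b) ` S)"
      using assms compact_continuous_image compact_imp_bounded by blast
    then obtain M where "\<forall>y\<in>(\<lambda>x. Dat g x b) ` S. norm y \<le> M"
      by (auto simp: bounded_iff)
    then show ?thesis
      by (intro exI[of _ "max 0 M"]) (auto simp: le_max_iff_disj)
  qed
  then obtain M where M: "\<And>b. 0 \<le> M b" "\<And>b x. x \<in> S \<Longrightarrow> norm (Dat g x b) \<le> M b"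
    by metis
  show thesis
  proof (rule that)
    show "0 \<le> (\<Sum>b\<in>Basis. M b)"
      by (intro sum_nonneg M)
    show "norm (Dat g x v) \<le> (\<Sum>b\<in>Basis. M b) * norm v" if "x \<in> S" for x v
      using that assms M by (intro norm_linear_le_sum_Basis linear_Dat)
  qed
qed

lemma lipschitz_of_Dat_bound:
  fixes g :: "'a::euclidean_space \<Rightarrow> 'b::real_normed_vector"
  assumes "convex S" "\<And>x. x \<in> S \<Longrightarrow> g differentiable (at x)"
    and "\<And>x v. x \<in> S \<Longrightarrow> norm (Dat g x v) \<le> K * norm v" and "x \<in> S" "y \<in> S"
  shows "norm (g x - g y) \<le> K * norm (x - y)"
proof (rule differentiable_bound[OF assms(1)])
  show "(g has_derivative Dat g x) (at x within S)" if "x \<in> S" for x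
    using assms(2)[OF that] by (rule has_derivative_at_withinI[OF has_derivative_Dat])
  show "onorm (Dat g x) \<le> K" if "x \<in> S" for x
    by (rule onorm_le) (rule assms(3)[OF that])
qed (fact assms)+

text \<open>A single constant serves as bound for the field and for its derivative and as Lipschitz constant of
  the derivative. On a convex set it is also a Lipschitz constant of the field.\<close>

definition C11_on :: "('a::euclidean_space \<Rightarrow> 'a) \<Rightarrow> 'a set \<Rightarrow> real \<Rightarrow> bool" where
  "C11_on f B K \<longleftrightarrow>
     (\<forall>x\<in>B. f differentiable (at x) \<and> norm (f x) \<le> K \<and> (\<forall>v. norm (Dat f x v) \<le> K * norm v)) \<and>
     (\<forall>x\<in>B. \<forall>y\<in>B. \<forall>v. norm (Dat f x v - Dat f y v) \<le> K * norm (x - y) * norm v)"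

text \<open>The first and second derivatives are continuous, hence bounded on a compact ball, and a bound for
  the second derivative is a Lipschitz constant for the first.\<close>

lemma C11_on_cball_exists:
  fixes f :: "'a::euclidean_space \<Rightarrow> 'a"
  assumes "Ck_on 2 f W" "open W" "x0 \<in> W"
  obtains r K where "0 < r" "0 < K" "cball x0 r \<subseteq> W" "C11_on f (cball x0 r) K"
proof -
  obtain r where r: "0 < r" "cball x0 r \<subseteq> W"
    using assms open_contains_cball by blast
  let ?B = "cball x0 r"
  have C: "\<And>x. x \<in> W \<Longrightarrow> f differentiable (at x)"
    "\<And>v x. x \<in> W \<Longrightarrow> (\<lambda>x. Dat f x v) differentiable (at x)"
    "\<And>v w. continuous_on W (\<lambda>x. Dat (\<lambda>x. Dat f x v) x w)"
    using assms(1) by (auto simp: numeral_2_eq_2)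
  have cD: "continuous_on W (\<lambda>x. Dat f x v)" for v
    using C(2) assms(2) by (auto simp: continuous_on_eq_continuous_at intro: differentiable_imp_continuous_within)
  have cf: "continuous_on W f"
    using C(1) assms(2) by (auto simp: continuous_on_eq_continuous_at intro: differentiable_imp_continuous_within)
  have "bounded (f ` ?B)"
    by (intro compact_imp_bounded compact_continuous_image continuous_on_subset[OF cf] r compact_cball)
  then obtain K0 where K0: "\<And>x. x \<in> ?B \<Longrightarrow> norm (f x) \<le> K0"
    unfolding bounded_iff by blast
  obtain K1 where K1: "0 \<le> K1" "\<And>x v. x \<in> ?B \<Longrightarrow> norm (Dat f x v) \<le> K1 * norm v"
  proof (rule Dat_bounded_on_compact[of ?B f])
    show "continuous_on ?B (\<lambda>x. Dat f x v)" for v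
      using cD continuous_on_subset r by blast
  qed (use C r in auto)
  have "\<exists>K\<ge>0. \<forall>x\<in>?B. \<forall>y\<in>?B. norm (Dat f x b - Dat f y b) \<le> K * norm (x - y)" for b
  proof -
    obtain K where K: "0 \<le> K" "\<And>x v. x \<in> ?B \<Longrightarrow> norm (Dat (\<lambda>x. Dat f x b) x v) \<le> K * norm v"
    proof (rule Dat_bounded_on_compact[of ?B "\<lambda>x. Dat f x b"])
      show "continuous_on ?B (\<lambda>x. Dat (\<lambda>x. Dat f x b) x v)" for v
        using C(3) continuous_on_subset r by blast
    qed (use C r in auto)
    have "norm (Dat f x b - Dat f y b) \<le> K * norm (x - y)" if "x \<in> ?B" "y \<in> ?B" for x y
      by (rule lipschitz_of_Dat_bound[of ?B "\<lambda>x. Dat f x b"]) (use C r K that in auto)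
    then show ?thesis using K by blast
  qed
  then obtain L where L: "\<And>b. 0 \<le> L b"
    "\<And>b x y. x \<in> ?B \<Longrightarrow> y \<in> ?B \<Longrightarrow> norm (Dat f x b - Dat f y b) \<le> L b * norm (x - y)"
    by metis
  define K2 where "K2 = (\<Sum>b\<in>Basis. L b)"
  have K2: "0 \<le> K2" unfolding K2_def by (intro sum_nonneg L)
  have L2: "norm (Dat f x v - Dat f y v) \<le> K2 * norm (x - y) * norm v" if "x \<in> ?B" "y \<in> ?B" for x y v
  proof -
    have "linear (\<lambda>v. Dat f x v - Dat f y v)"
      using C r that by (intro linear_compose_sub linear_Dat) auto
    from norm_linear_le_sum_Basis[OF this, of "\<lambda>b. L b * norm (x - y)" v]
    show ?thesis using L that by (simp add: K2_def sum_distrib_right)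
  qed
  define K where "K = max 1 (max K0 (max K1 K2))"
  have Kge: "K0 \<le> K" "K1 \<le> K" "K2 \<le> K" "0 < K"
    by (auto simp: K_def)
  have "C11_on f ?B K"
    unfolding C11_on_def
  proof (intro conjI ballI allI)
    fix x y v assume x: "x \<in> ?B"
    show "f differentiable (at x)" using C r x by auto
    show "norm (f x) \<le> K" using K0[OF x] Kge by simp
    show "norm (Dat f x v) \<le> K * norm v"
      using K1(2)[OF x, of v] Kge by (meson mult_right_mono norm_ge_zero order_trans)
    assume y: "y \<in> ?B"
    show "norm (Dat f x v - Dat f y v) \<le> K * norm (x - y) * norm v"
      using L2[OF x y, of v] Kge by (meson mult_right_mono norm_ge_zero order_trans)
  qed
  with r Kge show thesis using that by blast
qed

lemma C11_on_lipschitz: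
  assumes "C11_on f B K" "convex B" "x \<in> B" "y \<in> B"
  shows "norm (f x - f y) \<le> K * norm (x - y)"
  using assms by (intro lipschitz_of_Dat_bound[of B f]) (auto simp: C11_on_def)

lemma C11_on_taylor:
  assumes C: "C11_on f B K" "convex B" "x \<in> B" "y \<in> B" and K: "0 \<le> K"
  shows "norm (f y - f x - Dat f x (y - x)) \<le> K * (norm (y - x))\<^sup>2"
proof -
  let ?S = "closed_segment x y"
  have S: "?S \<subseteq> B" using C by (simp add: closed_segment_subset)
  have "norm (f y - f x - Dat f x (y - x)) \<le> norm (y - x) * (K * norm (y - x))"
  proof (rule differentiable_bound_linearization[where S = ?S and f' = "Dat f" and ?x0.0 = x])
    show "x + t *\<^sub>R (y - x) \<in> ?S" if "t \<in> {0..1}" for t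
      using that by (auto simp: in_segment algebra_simps intro!: exI[of _ t])
    show "(f has_derivative Dat f z) (at z within ?S)" if "z \<in> ?S" for z
      by (rule has_derivative_at_withinI[OF has_derivative_Dat]) (use that S C in \<open>auto simp: C11_on_def\<close>)
    show "onorm (Dat f z - Dat f x) \<le> K * norm (y - x)" if z: "z \<in> ?S" for z
    proof (rule onorm_le)
      fix v
      have "norm (Dat f z v - Dat f x v) \<le> K * norm (z - x) * norm v"
        using z S C by (auto simp: C11_on_def)
      also have "norm (z - x) \<le> norm (y - x)"
        using segment_bound(1)[OF z] by (simp add: norm_minus_commute)
      finally show "norm ((Dat f z - Dat f x) v) \<le> K * norm (y - x) * norm v"
        using K by (simp add: mult_left_mono mult_right_mono)
    qed
  qed simp
  then show ?thesis by (simp add: power2_eq_square mult_ac)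
qed


section \<open>Short-time flows in Euclidean space\<close>

lemma norm_diff_le_of_vector_derivative:
  fixes e :: "real \<Rightarrow> 'a::real_normed_vector"
  assumes "convex I" "\<And>t. t \<in> I \<Longrightarrow> (e has_vector_derivative e' t) (at t within I)"
    and "\<And>t. t \<in> I \<Longrightarrow> norm (e' t) \<le> B" and "s \<in> I" "t \<in> I"
  shows "norm (e s - e t) \<le> B * \<bar>s - t\<bar>"
proof -
  have "norm (e s - e t) \<le> B * norm (s - t)"
  proof (rule differentiable_bound[OF assms(1)])
    show "(e has_derivative (\<lambda>h. h *\<^sub>R e' x)) (at x within I)" if "x \<in> I" for x
      using assms(2)[OF that] by (simp add: has_vector_derivative_def)
    show "onorm (\<lambda>h. h *\<^sub>R e' x) \<le> B" if "x \<in> I" for x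
    proof (rule onorm_le)
      fix h :: real
      show "norm (h *\<^sub>R e' x) \<le> B * norm h"
        using mult_right_mono[OF assms(3)[OF that], of "\<bar>h\<bar>"] by (simp add: mult.commute)
    qed
  qed (fact assms)+
  then show ?thesis by simp
qed

lemma continuous_on_of_vector_derivative:
  assumes "\<And>t. t \<in> I \<Longrightarrow> (e has_vector_derivative e' t) (at t within I)"
  shows "continuous_on I e"
  unfolding continuous_on_eq_continuous_within
  by (intro ballI has_vector_derivative_continuous[OF assms])

text \<open>The maximum of \<open>norm (e t)\<close> is at most its initial value, plus \<open>\<bar>b - a\<bar> A\<close>, plus
  \<open>K \<bar>b - a\<bar> \<le> 1/2\<close> times itself. On an interval this short the exponential factor of the general
  inequality can therefore be replaced by \<open>2\<close>.\<close>

lemma gronwall_short: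
  fixes e :: "real \<Rightarrow> 'a::real_normed_vector"
  assumes e: "\<And>t. t \<in> closed_segment a b \<Longrightarrow>
      (e has_vector_derivative e' t) (at t within closed_segment a b)"
    and le: "\<And>t. t \<in> closed_segment a b \<Longrightarrow> norm (e' t) \<le> A + K * norm (e t)"
    and K: "0 \<le> K" "K * \<bar>b - a\<bar> \<le> 1 / 2" and t: "t \<in> closed_segment a b"
  shows "norm (e t) \<le> 2 * (norm (e a) + \<bar>b - a\<bar> * A)"
proof -
  let ?I = "closed_segment a b"
  have "continuous_on ?I e"
    using e by (rule continuous_on_of_vector_derivative)
  then have "continuous_on ?I (\<lambda>t. norm (e t))"
    by (intro continuous_intros)
  then obtain m where m: "m \<in> ?I" "\<And>s. s \<in> ?I \<Longrightarrow> norm (e s) \<le> norm (e m)"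
    using continuous_attains_sup[of ?I "\<lambda>t. norm (e t)"] by auto
  let ?M = "norm (e m)"
  have "norm (e m - e a) \<le> (A + K * ?M) * \<bar>m - a\<bar>"
  proof (rule norm_diff_le_of_vector_derivative[of ?I])
    show "norm (e' s) \<le> A + K * ?M" if "s \<in> ?I" for s
      using le[OF that] mult_left_mono[OF m(2)[OF that] K(1)] by linarith
  qed (use e m in auto)
  also have "\<dots> \<le> (A + K * ?M) * \<bar>b - a\<bar>"
  proof (rule mult_left_mono)
    show "\<bar>m - a\<bar> \<le> \<bar>b - a\<bar>"
      using segment_bound(1)[OF m(1)] by (simp add: abs_minus_commute)
    show "0 \<le> A + K * ?M"
      using le[OF m(1)] norm_ge_zero[of "e' m"] by linarith
  qed
  also have "\<dots> = A * \<bar>b - a\<bar> + (K * \<bar>b - a\<bar>) * ?M" by (simp add: algebra_simps)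
  also have "\<dots> \<le> A * \<bar>b - a\<bar> + ?M / 2"
    using mult_right_mono[OF K(2), of ?M] by simp
  finally have "?M - norm (e a) \<le> A * \<bar>b - a\<bar> + ?M / 2"
    using norm_triangle_ineq2[of "e m" "e a"] by linarith
  then have "?M \<le> 2 * (norm (e a) + \<bar>b - a\<bar> * A)"
    by (simp add: algebra_simps)
  then show ?thesis
    using m(2)[OF t] by linarith
qed

text \<open>The Picard operator contracts by the factor \<open>K h \<le> 1/2\<close> on bounded continuous functions. The
  right-hand side depends on time so that the lemma also covers the variational equation along a
  given solution, and its continuity is required only along curves.\<close>

lemma picard_short:
  fixes F :: "real \<Rightarrow> 'a::euclidean_space \<Rightarrow> 'a"
  assumes h: "0 < h" "0 \<le> K" "K * h \<le> 1 / 2"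
    and lip: "\<And>t x y. t \<in> {- h..h} \<Longrightarrow> norm (F t x - F t y) \<le> K * norm (x - y)"
    and cont: "\<And>g. continuous_on {- h..h} g \<Longrightarrow> continuous_on {- h..h} (\<lambda>t. F t (g t))"
  obtains g where "g 0 = y"
    "\<And>t. t \<in> {- h..h} \<Longrightarrow> (g has_vector_derivative F t (g t)) (at t within {- h..h})"
proof -
  let ?I = "{- h..h}"
  define P where "P g t = y + (integral {- h..t} (\<lambda>s. F s (g s)) - integral {- h..0} (\<lambda>s. F s (g s)))"
    for g t
  have dP: "(P g has_vector_derivative F t (g t)) (at t within ?I)"
    if "continuous_on ?I g" "t \<in> ?I" for g t
  proof -
    have "((\<lambda>t. integral {- h..t} (\<lambda>s. F s (g s))) has_vector_derivative F t (g t)) (at t within ?I)"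
      using cont[OF that(1)] that(2) by (rule integral_has_vector_derivative)
    then show ?thesis
      unfolding P_def by (auto intro!: derivative_eq_intros)
  qed
  have P0: "P g 0 = y" for g
    by (simp add: P_def)
  \<comment> \<open>Functions on the interval are represented by functions on the line that are constant
    on either side of it.\<close>
  define c where "c t = max (- h) (min h t)" for t
  have c: "c t \<in> ?I" for t using h by (auto simp: c_def)
  have c_id: "c t = t" if "t \<in> ?I" for t using that by (auto simp: c_def)
  have c_cont: "continuous_on UNIV c"
    unfolding c_def by (intro continuous_intros)
  define T where "T g = Bcontfun (\<lambda>t. P (apply_bcontfun g) (c t))" for g :: "real \<Rightarrow>\<^sub>C 'a"
  have T: "apply_bcontfun (T g) t = P (apply_bcontfun g) (c t)" for g t
  proof -
    have cP: "continuous_on ?I (P (apply_bcontfun g))"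
      by (rule continuous_on_of_vector_derivative[OF dP]) auto
    have "continuous_on UNIV (\<lambda>t. P (apply_bcontfun g) (c t))"
      by (rule continuous_on_compose2[OF cP c_cont]) (use c in auto)
    moreover have "bounded (range (\<lambda>t. P (apply_bcontfun g) (c t)))"
      using compact_imp_bounded[OF compact_continuous_image[OF cP compact_Icc]]
      by (rule bounded_subset) (use c in auto)
    ultimately have "(\<lambda>t. P (apply_bcontfun g) (c t)) \<in> bcontfun"
      by (simp add: bcontfun_def)
    then show ?thesis
      by (simp add: T_def Bcontfun_inverse)
  qed
  have "dist (T g1) (T g2) \<le> 1 / 2 * dist g1 g2" for g1 g2
  proof (rule dist_bound)
    fix t
    let ?d = "dist g1 g2"
    have ct: "c t \<in> ?I" "0 \<in> ?I" using c h by auto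
    have "norm ((P g1 (c t) - P g2 (c t)) - (P g1 0 - P g2 0)) \<le> (K * ?d) * \<bar>c t - 0\<bar>"
    proof (rule norm_diff_le_of_vector_derivative[where I = ?I])
      fix s assume s: "s \<in> ?I"
      show "((\<lambda>t. P g1 t - P g2 t) has_vector_derivative F s (g1 s) - F s (g2 s)) (at s within ?I)"
        by (intro has_vector_derivative_diff dP s) auto
      have "norm (F s (g1 s) - F s (g2 s)) \<le> K * norm (g1 s - g2 s)"
        using lip[OF s] .
      also have "\<dots> \<le> K * ?d"
        using h(2) dist_bounded[of g1 s g2] by (intro mult_left_mono) (auto simp: dist_norm)
      finally show "norm (F s (g1 s) - F s (g2 s)) \<le> K * ?d" .
    qed (use ct in auto)
    also have "\<dots> \<le> (K * ?d) * h"
      using ct h by (intro mult_left_mono) auto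
    also have "\<dots> = (K * h) * ?d" by simp
    also have "\<dots> \<le> 1 / 2 * ?d"
      using h by (intro mult_right_mono) auto
    finally show "dist (T g1 t) (T g2 t) \<le> 1 / 2 * ?d"
      by (simp add: T dist_norm P0)
  qed
  then have "\<exists>!g. T g = g"
    by (intro banach_fix_type[of "1 / 2"]) auto
  then obtain g where "T g = g" by blast
  then have g: "apply_bcontfun g t = P g t" if "t \<in> ?I" for t
    using T[of g t] c_id[OF that] by simp
  show thesis
  proof (rule that[of "P g"])
    show "P g 0 = y" by (rule P0)
    show "(P g has_vector_derivative F t (P g t)) (at t within ?I)" if "t \<in> ?I" for t
      using dP[of g t] that g[OF that] by auto
  qed
qed

text \<open>The constants of a short-time flow: on the ball of radius \<open>2 r\<close> the field and its
  derivative are bounded and Lipschitz with constant \<open>K\<close>, and \<open>h\<close> is so small that no solution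
  from the ball of radius \<open>r\<close> leaves the larger ball before time \<open>h\<close>.\<close>

locale short_flow =
  fixes f :: "'a::euclidean_space \<Rightarrow> 'a" and x0 :: 'a and r K h :: real
  assumes C11: "C11_on f (cball x0 (2 * r)) K"
    and r: "0 < r" and K: "0 < K" and h: "0 < h" and Kh: "K * h \<le> 1 / 2" "K * h \<le> r"
begin

abbreviation "B \<equiv> cball x0 (2 * r)"
abbreviation "I \<equiv> {- h..h}"

lemma in_B: "y \<in> cball x0 r \<Longrightarrow> y \<in> B"
  using r by auto

lemma f_diff: "x \<in> B \<Longrightarrow> f differentiable (at x)"
  and f_bound: "x \<in> B \<Longrightarrow> norm (f x) \<le> K"
  and Df_bound: "x \<in> B \<Longrightarrow> norm (Dat f x v) \<le> K * norm v"
  and Df_lip: "x \<in> B \<Longrightarrow> y \<in> B \<Longrightarrow> norm (Dat f x v - Dat f y v) \<le> K * norm (x - y) * norm v"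
  using C11 by (auto simp: C11_on_def)

lemma f_lip: "x \<in> B \<Longrightarrow> y \<in> B \<Longrightarrow> norm (f x - f y) \<le> K * norm (x - y)"
  using C11 by (rule C11_on_lipschitz) auto

lemma f_cont: "continuous_on B f"
  unfolding continuous_on_eq_continuous_within
  using continuous_at_imp_continuous_within[OF differentiable_imp_continuous_within[OF f_diff]] by auto

lemma Df_cont: "continuous_on B (\<lambda>x. Dat f x v)"
proof (rule lipschitz_on_continuous_on)
  show "(K * norm v)-lipschitz_on B (\<lambda>x. Dat f x v)"
    using Df_lip K by (intro lipschitz_onI) (auto simp: dist_norm mult_ac)
qed

text \<open>Picard iteration wants a right-hand side that is Lipschitz on the whole space. Composing the field
  with the projection to the nearest point of the ball keeps its Lipschitz constant and its bound
  \<open>K\<close>. A solution of the modified equation moves by at most \<open>K h \<le> r\<close>, so it stays in the ball,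
  where nothing has been modified.\<close>

lemma solution_exists:
  assumes y: "y \<in> cball x0 r"
  shows "\<exists>g. g 0 = y \<and>
    (\<forall>t\<in>I. g t \<in> B \<and> (g has_vector_derivative f (g t)) (at t within I))"
proof -
  define F where "F x = f (closest_point B x)" for x
  have ne: "B \<noteq> {}" using r by auto
  have cp: "closest_point B x \<in> B" for x
    using ne by (intro closest_point_in_set) auto
  have F_lip: "norm (F x - F z) \<le> K * norm (x - z)" for x z
  proof -
    have "norm (F x - F z) \<le> K * norm (closest_point B x - closest_point B z)"
      unfolding F_def by (intro f_lip cp)
    also have "\<dots> \<le> K * norm (x - z)"
      using closest_point_lipschitz[of B x z] ne K by (intro mult_left_mono) (auto simp: dist_norm)
    finally show ?thesis .
  qed
  have F_cont: "continuous_on UNIV F"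
  proof (rule lipschitz_on_continuous_on)
    show "K-lipschitz_on UNIV F"
      using F_lip K by (intro lipschitz_onI) (auto simp: dist_norm)
  qed
  obtain g where g: "g 0 = y"
    "\<And>t. t \<in> I \<Longrightarrow> (g has_vector_derivative F (g t)) (at t within I)"
  proof (rule picard_short[of h K "\<lambda>_. F" y])
    show "continuous_on I (\<lambda>t. F (g t))" if "continuous_on I g" for g
      by (rule continuous_on_compose2[OF F_cont that]) auto
  qed (use h K Kh F_lip in auto)
  have gB: "g t \<in> B" if t: "t \<in> I" for t
  proof -
    have "norm (g t - g 0) \<le> K * \<bar>t - 0\<bar>"
      by (rule norm_diff_le_of_vector_derivative[of I g "\<lambda>t. F (g t)"])
        (use g t h cp f_bound in \<open>auto simp: F_def\<close>)
    also have "\<dots> \<le> K * h" using K t by (intro mult_left_mono) auto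
    finally have "dist (g t) y \<le> r" using Kh g by (simp add: dist_norm)
    then show ?thesis
      using y dist_triangle[of x0 "g t" y] by (auto simp: dist_commute)
  qed
  have "F (g t) = f (g t)" if "t \<in> I" for t
    unfolding F_def using gB[OF that] by (simp add: closest_point_self)
  then show ?thesis
    using g gB by (intro exI[of _ g]) auto
qed

definition \<Phi> :: "'a \<Rightarrow> real \<Rightarrow> 'a" where
  "\<Phi> y = (SOME g. g 0 = y \<and> (\<forall>t\<in>I. g t \<in> B \<and> (g has_vector_derivative f (g t)) (at t within I)))"

lemma
  assumes y: "y \<in> cball x0 r"
  shows \<Phi>_0: "\<Phi> y 0 = y"
    and \<Phi>_in_B: "t \<in> I \<Longrightarrow> \<Phi> y t \<in> B"
    and \<Phi>_deriv: "t \<in> I \<Longrightarrow> (\<Phi> y has_vector_derivative f (\<Phi> y t)) (at t within I)"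
  using someI_ex[OF solution_exists[OF y]] unfolding \<Phi>_def[symmetric] by auto

lemma segment_in_I: "t \<in> I \<Longrightarrow> s \<in> closed_segment 0 t \<Longrightarrow> s \<in> I"
  using h by (auto simp: closed_segment_eq_real_ivl split: if_splits)

lemma time_small:
  assumes "t \<in> I"
  shows "K * \<bar>t - 0\<bar> \<le> 1 / 2"
proof -
  have "K * \<bar>t - 0\<bar> \<le> K * h"
    using assms K by (intro mult_left_mono) auto
  then show ?thesis using Kh(1) by simp
qed

lemma \<Phi>_deriv_segment:
  assumes "y \<in> cball x0 r" "t \<in> I" "s \<in> closed_segment 0 t"
  shows "(\<Phi> y has_vector_derivative f (\<Phi> y s)) (at s within closed_segment 0 t)"
  by (rule has_vector_derivative_within_subset[OF \<Phi>_deriv[OF assms(1) segment_in_I[OF assms(2,3)]]])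
    (auto intro: segment_in_I[OF assms(2)])

lemma \<Phi>_near:
  assumes "y \<in> cball x0 r" "t \<in> I"
  shows "norm (\<Phi> y t - y) \<le> K * \<bar>t\<bar>"
proof -
  have "norm (\<Phi> y t - \<Phi> y 0) \<le> K * \<bar>t - 0\<bar>"
    by (rule norm_diff_le_of_vector_derivative[of I "\<Phi> y" "\<lambda>t. f (\<Phi> y t)"])
      (use assms h \<Phi>_deriv f_bound \<Phi>_in_B in auto)
  then show ?thesis using assms by (simp add: \<Phi>_0)
qed

lemma \<Phi>_lipschitz:
  assumes "y \<in> cball x0 r" "z \<in> cball x0 r" "t \<in> I"
  shows "norm (\<Phi> y t - \<Phi> z t) \<le> 2 * norm (y - z)"
proof -
  have "norm (\<Phi> y t - \<Phi> z t) \<le> 2 * (norm (\<Phi> y 0 - \<Phi> z 0) + \<bar>t - 0\<bar> * 0)"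
  proof (rule gronwall_short[where e = "\<lambda>s. \<Phi> y s - \<Phi> z s" and e' = "\<lambda>s. f (\<Phi> y s) - f (\<Phi> z s)" and b = t])
    show "norm (f (\<Phi> y s) - f (\<Phi> z s)) \<le> 0 + K * norm (\<Phi> y s - \<Phi> z s)"
      if "s \<in> closed_segment 0 t" for s
      using f_lip \<Phi>_in_B assms segment_in_I[OF assms(3) that] by simp
  qed (use assms K time_small in \<open>auto intro!: has_vector_derivative_diff \<Phi>_deriv_segment\<close>)
  then show ?thesis using assms by (simp add: \<Phi>_0)
qed

text \<open>The variational equation \<open>w' = Df (\<Phi> y t) w\<close> is linear with coefficients bounded by \<open>K\<close>, so it has
  solutions on the same time interval as the equation itself.\<close>

lemma variation_exists:
  assumes y: "y \<in> cball x0 r"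
  shows "\<exists>w. w 0 = v \<and> (\<forall>t\<in>I. (w has_vector_derivative Dat f (\<Phi> y t) (w t)) (at t within I))"
proof -
  have cont\<Phi>: "continuous_on I (\<Phi> y)"
    using \<Phi>_deriv[OF y] by (rule continuous_on_of_vector_derivative)
  obtain w where "w 0 = v"
    "\<And>t. t \<in> I \<Longrightarrow> (w has_vector_derivative Dat f (\<Phi> y t) (w t)) (at t within I)"
  proof (rule picard_short[of h K "\<lambda>t. Dat f (\<Phi> y t)" v])
    fix t x z assume t: "t \<in> I"
    have "Dat f (\<Phi> y t) x - Dat f (\<Phi> y t) z = Dat f (\<Phi> y t) (x - z)"
      by (simp add: linear_diff[OF linear_Dat[OF f_diff[OF \<Phi>_in_B[OF y t]]]])
    then show "norm (Dat f (\<Phi> y t) x - Dat f (\<Phi> y t) z) \<le> K * norm (x - z)"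
      using Df_bound[OF \<Phi>_in_B[OF y t]] by simp
  next
    fix g :: "real \<Rightarrow> 'a" assume g: "continuous_on I g"
    show "continuous_on I (\<lambda>t. Dat f (\<Phi> y t) (g t))"
    proof (rule continuous_on_linear_family[OF _ _ g])
      show "linear (Dat f (\<Phi> y t))" if "t \<in> I" for t
        using linear_Dat[OF f_diff[OF \<Phi>_in_B[OF y that]]] .
      show "continuous_on I (\<lambda>t. Dat f (\<Phi> y t) b)" for b
        by (rule continuous_on_compose2[OF Df_cont cont\<Phi>]) (use \<Phi>_in_B[OF y] in auto)
    qed
  qed (use h K Kh in auto)
  then show ?thesis by blast
qed

definition V :: "'a \<Rightarrow> 'a \<Rightarrow> real \<Rightarrow> 'a" where
  "V y v = (SOME w. w 0 = v \<and> (\<forall>t\<in>I. (w has_vector_derivative Dat f (\<Phi> y t) (w t)) (at t within I)))"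

lemma
  assumes y: "y \<in> cball x0 r"
  shows V_0: "V y v 0 = v"
    and V_deriv: "t \<in> I \<Longrightarrow> (V y v has_vector_derivative Dat f (\<Phi> y t) (V y v t)) (at t within I)"
  using someI_ex[OF variation_exists[OF y]] unfolding V_def[symmetric] by auto

lemma V_deriv_segment:
  assumes "y \<in> cball x0 r" "t \<in> I" "s \<in> closed_segment 0 t"
  shows "(V y v has_vector_derivative Dat f (\<Phi> y s) (V y v s)) (at s within closed_segment 0 t)"
  by (rule has_vector_derivative_within_subset[OF V_deriv[OF assms(1) segment_in_I[OF assms(2,3)]]])
    (auto intro: segment_in_I[OF assms(2)])

text \<open>Both sides solve the same linear equation with the same initial value.\<close>

lemma V_combination:
  assumes y: "y \<in> cball x0 r" and t: "t \<in> I"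
  shows "V y (a *\<^sub>R v + b *\<^sub>R w) t = a *\<^sub>R V y v t + b *\<^sub>R V y w t"
proof -
  let ?e = "\<lambda>s. V y (a *\<^sub>R v + b *\<^sub>R w) s - (a *\<^sub>R V y v s + b *\<^sub>R V y w s)"
  have "norm (?e t) \<le> 2 * (norm (?e 0) + \<bar>t - 0\<bar> * 0)"
  proof (rule gronwall_short[where e = ?e and e' = "\<lambda>s. Dat f (\<Phi> y s) (?e s)" and b = t])
    fix s assume s: "s \<in> closed_segment 0 t"
    have B: "\<Phi> y s \<in> B" using \<Phi>_in_B[OF y segment_in_I[OF t s]] .
    note lin = linear_Dat[OF f_diff[OF B]]
    have *: "Dat f (\<Phi> y s) (?e s) = Dat f (\<Phi> y s) (V y (a *\<^sub>R v + b *\<^sub>R w) s) -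
        (a *\<^sub>R Dat f (\<Phi> y s) (V y v s) + b *\<^sub>R Dat f (\<Phi> y s) (V y w s))"
      by (simp add: linear_diff[OF lin] linear_add[OF lin] linear_cmul[OF lin])
    show "(?e has_vector_derivative Dat f (\<Phi> y s) (?e s)) (at s within closed_segment 0 t)"
      unfolding * by (intro has_vector_derivative_diff has_vector_derivative_add
          bounded_linear.has_vector_derivative[OF bounded_linear_scaleR_right] V_deriv_segment y t s)
    show "norm (Dat f (\<Phi> y s) (?e s)) \<le> 0 + K * norm (?e s)"
      using Df_bound[OF B] by simp
  qed (use K time_small[OF t] in auto)
  then show ?thesis by (simp add: V_0[OF y])
qed

text \<open>The error of the linear approximation solves the variational equation up to the Taylor remainder of
  the field, which is quadratic in the distance of two solutions and hence in the distance of their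
  initial points. So \<open>V\<close> will be the derivative of \<open>\<Phi>\<close> with respect to the initial point.\<close>

lemma \<Phi>_linearization:
  assumes y: "y \<in> cball x0 r" and z: "z \<in> cball x0 r" and t: "t \<in> I"
  shows "norm (\<Phi> z t - \<Phi> y t - V y (z - y) t) \<le> 4 * (norm (z - y))\<^sup>2"
proof -
  let ?e = "\<lambda>s. \<Phi> z s - \<Phi> y s - V y (z - y) s"
  let ?A = "4 * K * (norm (z - y))\<^sup>2"
  have "norm (?e t) \<le> 2 * (norm (?e 0) + \<bar>t - 0\<bar> * ?A)"
  proof (rule gronwall_short[where e = ?e and b = t
        and e' = "\<lambda>s. f (\<Phi> z s) - f (\<Phi> y s) - Dat f (\<Phi> y s) (V y (z - y) s)"])
    fix s assume s: "s \<in> closed_segment 0 t"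
    have sI: "s \<in> I" by (rule segment_in_I[OF t s])
    have B: "\<Phi> y s \<in> B" "\<Phi> z s \<in> B"
      using \<Phi>_in_B[OF y sI] \<Phi>_in_B[OF z sI] .
    note lin = linear_Dat[OF f_diff[OF B(1)]]
    show "(?e has_vector_derivative f (\<Phi> z s) - f (\<Phi> y s) - Dat f (\<Phi> y s) (V y (z - y) s))
        (at s within closed_segment 0 t)"
      by (intro has_vector_derivative_diff V_deriv_segment \<Phi>_deriv_segment y z t s)
    have "norm (f (\<Phi> z s) - f (\<Phi> y s) - Dat f (\<Phi> y s) (\<Phi> z s - \<Phi> y s)) \<le> K * (norm (\<Phi> z s - \<Phi> y s))\<^sup>2"
      using C11 B K by (intro C11_on_taylor) auto
    also have "\<dots> \<le> K * (2 * norm (z - y))\<^sup>2"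
      using \<Phi>_lipschitz[OF z y sI] K by (intro mult_left_mono power_mono) auto
    finally have 1: "norm (f (\<Phi> z s) - f (\<Phi> y s) - Dat f (\<Phi> y s) (\<Phi> z s - \<Phi> y s)) \<le> ?A"
      by (simp add: power_mult_distrib)
    have eq: "f (\<Phi> z s) - f (\<Phi> y s) - Dat f (\<Phi> y s) (V y (z - y) s) =
        (f (\<Phi> z s) - f (\<Phi> y s) - Dat f (\<Phi> y s) (\<Phi> z s - \<Phi> y s)) + Dat f (\<Phi> y s) (?e s)"
      by (simp add: linear_diff[OF lin])
    show "norm (f (\<Phi> z s) - f (\<Phi> y s) - Dat f (\<Phi> y s) (V y (z - y) s)) \<le> ?A + K * norm (?e s)"
      unfolding eq by (rule norm_triangle_mono[OF 1 Df_bound[OF B(1)]])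
  qed (use K time_small[OF t] in auto)
  also have "\<dots> = 8 * (K * \<bar>t - 0\<bar>) * (norm (z - y))\<^sup>2"
    by (simp add: V_0[OF y] \<Phi>_0[OF y] \<Phi>_0[OF z])
  also have "\<dots> \<le> 8 * (1 / 2) * (norm (z - y))\<^sup>2"
    by (intro mult_right_mono mult_left_mono time_small[OF t]) auto
  finally show ?thesis by simp
qed

lemma \<Phi>_has_derivative:
  assumes y: "y \<in> ball x0 r" and t: "t \<in> I"
  shows "((\<lambda>z. \<Phi> z t) has_derivative (\<lambda>v. V y v t)) (at y)"
  unfolding has_derivative_at_alt
proof (intro conjI allI impI)
  have y': "y \<in> cball x0 r" using y by auto
  have "linear (\<lambda>v. V y v t)"
    using V_combination[OF y' t, of 1 _ 1] V_combination[OF y' t, of _ _ 0]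
    by (intro linearI) auto
  then show "bounded_linear (\<lambda>v. V y v t)" by (rule linear_conv_bounded_linear[THEN iffD1])
  fix e :: real assume e: "0 < e"
  obtain d where d: "0 < d" "ball y d \<subseteq> ball x0 r"
    using y open_contains_ball[of "ball x0 r"] by (meson open_ball)
  show "\<exists>d>0. \<forall>z. norm (z - y) < d \<longrightarrow> norm (\<Phi> z t - \<Phi> y t - V y (z - y) t) \<le> e * norm (z - y)"
  proof (intro exI[of _ "min d (e / 4)"] conjI allI impI)
    show "0 < min d (e / 4)" using d e by simp
    fix z assume z: "norm (z - y) < min d (e / 4)"
    then have "z \<in> ball y d" by (simp add: dist_norm norm_minus_commute)
    then have "z \<in> ball x0 r" using d by blast
    then have "z \<in> cball x0 r" by auto
    from \<Phi>_linearization[OF y' this t]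
    have "norm (\<Phi> z t - \<Phi> y t - V y (z - y) t) \<le> (4 * norm (z - y)) * norm (z - y)"
      by (simp add: power2_eq_square)
    also have "\<dots> \<le> e * norm (z - y)"
      using z by (intro mult_right_mono) auto
    finally show "norm (\<Phi> z t - \<Phi> y t - V y (z - y) t) \<le> e * norm (z - y)" .
  qed
qed

lemma Df_f_lip:
  assumes B: "x \<in> B" "y \<in> B"
  shows "norm (Dat f x (f x) - Dat f y (f y)) \<le> 2 * K\<^sup>2 * norm (x - y)"
proof -
  note lin = linear_Dat[OF f_diff[OF B(1)]]
  have "Dat f x (f x) - Dat f y (f y) = Dat f x (f x - f y) + (Dat f x (f y) - Dat f y (f y))"
    by (simp add: linear_diff[OF lin])
  also have "norm \<dots> \<le> K * (K * norm (x - y)) + K * norm (x - y) * K"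
  proof (rule norm_triangle_mono)
    have "norm (Dat f x (f x - f y)) \<le> K * norm (f x - f y)"
      by (rule Df_bound[OF B(1)])
    also have "\<dots> \<le> K * (K * norm (x - y))"
      using K by (intro mult_left_mono f_lip B) auto
    finally show "norm (Dat f x (f x - f y)) \<le> K * (K * norm (x - y))" .
    have "norm (Dat f x (f y) - Dat f y (f y)) \<le> K * norm (x - y) * norm (f y)"
      by (rule Df_lip[OF B])
    also have "\<dots> \<le> K * norm (x - y) * K"
      using K f_bound[OF B(2)] by (intro mult_left_mono) auto
    finally show "norm (Dat f x (f y) - Dat f y (f y)) \<le> K * norm (x - y) * K" .
  qed
  finally show ?thesis by (simp add: power2_eq_square mult_ac)
qed

text \<open>The second derivative of a solution is \<open>Df f\<close> along it, which is Lipschitz; two integrations of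
  this give the remainder. The constant is the same for all initial points, because in a composition
  of flows each map is applied to a point that itself depends on the step size.\<close>

lemma \<Phi>_taylor:
  assumes y: "y \<in> cball x0 r" and t: "t \<in> I"
  shows "norm (\<Phi> y t - y - t *\<^sub>R f y - (t\<^sup>2 / 2) *\<^sub>R Dat f y (f y)) \<le> 2 * K ^ 3 * \<bar>t\<bar> ^ 3"
proof -
  let ?S = "closed_segment 0 t"
  let ?f2 = "\<lambda>z. Dat f z (f z)"
  have f2: "norm (?f2 (\<Phi> y s) - ?f2 y) \<le> 2 * K ^ 3 * \<bar>t\<bar>" if s: "s \<in> ?S" for s
  proof -
    have sI: "s \<in> I" by (rule segment_in_I[OF t s])
    have B: "\<Phi> y s \<in> B" "y \<in> B" using \<Phi>_in_B[OF y sI] in_B[OF y] .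
    have st: "\<bar>s\<bar> \<le> \<bar>t\<bar>" using segment_bound(1)[OF s] by simp
    have near: "norm (\<Phi> y s - y) \<le> K * \<bar>t\<bar>"
      using \<Phi>_near[OF y sI] mult_left_mono[OF st, of K] K by linarith
    have "norm (?f2 (\<Phi> y s) - ?f2 y) \<le> 2 * K\<^sup>2 * norm (\<Phi> y s - y)"
      by (rule Df_f_lip[OF B])
    also have "\<dots> \<le> 2 * K\<^sup>2 * (K * \<bar>t\<bar>)"
      using near by (intro mult_left_mono) auto
    finally show ?thesis by (simp add: power2_eq_square power3_eq_cube mult_ac)
  qed
  let ?q = "\<lambda>s. f (\<Phi> y s) - f y - s *\<^sub>R ?f2 y"
  have dq: "(?q has_vector_derivative ?f2 (\<Phi> y s) - ?f2 y) (at s within ?S)" if s: "s \<in> ?S" for s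
  proof -
    have B: "\<Phi> y s \<in> B" by (rule \<Phi>_in_B[OF y segment_in_I[OF t s]])
    have "((f \<circ> \<Phi> y) has_vector_derivative ?f2 (\<Phi> y s)) (at s within ?S)"
      by (rule vector_derivative_diff_chain_within[OF \<Phi>_deriv_segment[OF y t s]
            has_derivative_at_withinI[OF has_derivative_Dat[OF f_diff[OF B]]]])
    then show ?thesis
      unfolding o_def by (auto intro!: derivative_eq_intros)
  qed
  have q: "norm (?q s) \<le> 2 * K ^ 3 * \<bar>t\<bar> ^ 2" if s: "s \<in> ?S" for s
  proof -
    have "norm (?q s - ?q 0) \<le> 2 * K ^ 3 * \<bar>t\<bar> * \<bar>s - 0\<bar>"
      by (rule norm_diff_le_of_vector_derivative[OF _ dq f2 s]) auto
    also have "\<dots> \<le> 2 * K ^ 3 * \<bar>t\<bar> * \<bar>t\<bar>"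
      using segment_bound(1)[OF s] K by (intro mult_left_mono) auto
    finally show ?thesis by (simp add: \<Phi>_0[OF y] power2_eq_square mult_ac)
  qed
  let ?p = "\<lambda>s. \<Phi> y s - y - s *\<^sub>R f y - (s\<^sup>2 / 2) *\<^sub>R ?f2 y"
  have dp: "(?p has_vector_derivative ?q s) (at s within ?S)" if s: "s \<in> ?S" for s
    using \<Phi>_deriv_segment[OF y t s] by (auto intro!: derivative_eq_intros)
  have "norm (?p t - ?p 0) \<le> 2 * K ^ 3 * \<bar>t\<bar> ^ 2 * \<bar>t - 0\<bar>"
    by (rule norm_diff_le_of_vector_derivative[OF _ dp q]) auto
  then show ?thesis
    by (simp add: \<Phi>_0[OF y] power3_eq_cube power2_eq_square mult_ac)
qed

end


section \<open>Flows on manifolds\<close>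

locale atlas =
  fixes A :: "('m::t2_space, 'e::euclidean_space) chart set"
  assumes atlas: "smooth_atlas A"
begin

context
  fixes c assumes c: "c \<in> A"
begin

lemma chart_homeo: "homeomorphism (chart_dom c) (chart_img c) (coord c) (chart_inv c)"
  and open_chart_dom: "open (chart_dom c)"
  and open_chart_img: "open (chart_img c)"
  using atlas c by (auto simp: smooth_atlas_def is_chart_def)

lemma inv_coord: "x \<in> chart_dom c \<Longrightarrow> chart_inv c (coord c x) = x"
  and coord_inv: "u \<in> chart_img c \<Longrightarrow> coord c (chart_inv c u) = u"
  and inv_in_dom: "u \<in> chart_img c \<Longrightarrow> chart_inv c u \<in> chart_dom c"
  and coord_in_img: "x \<in> chart_dom c \<Longrightarrow> coord c x \<in> chart_img c"
  and coord_cont: "continuous_on (chart_dom c) (coord c)"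
  and inv_cont: "continuous_on (chart_img c) (chart_inv c)"
  using chart_homeo by (auto simp: homeomorphism_def)

lemma open_coord_preimage:
  assumes "open W"
  shows "open {x \<in> chart_dom c. coord c x \<in> W}"
proof -
  have "open (chart_dom c \<inter> coord c -` W)"
    using coord_cont open_chart_dom assms by (rule continuous_open_preimage)
  moreover have "chart_dom c \<inter> coord c -` W = {x \<in> chart_dom c. coord c x \<in> W}"
    by auto
  ultimately show ?thesis by simp
qed

lemma open_inv_preimage:
  assumes "open U"
  shows "open {u \<in> chart_img c. chart_inv c u \<in> U}"
proof -
  have "open (chart_img c \<inter> chart_inv c -` U)"
    using inv_cont open_chart_img assms by (rule continuous_open_preimage)
  moreover have "chart_img c \<inter> chart_inv c -` U = {u \<in> chart_img c. chart_inv c u \<in> U}"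
    by auto
  ultimately show ?thesis by simp
qed

lemma dom_subset_manifold: "x \<in> chart_dom c \<Longrightarrow> x \<in> manifold A"
  using c by (auto simp: manifold_def)

lemma overlap_iff: "u \<in> overlap c d \<longleftrightarrow> u \<in> chart_img c \<and> chart_inv c u \<in> chart_dom d"
  using inv_coord coord_inv inv_in_dom coord_in_img unfolding overlap_def
  by (metis (no_types, lifting) IntE IntI image_iff)

lemma open_overlap: "d \<in> A \<Longrightarrow> open (overlap c d)"
  using open_inv_preimage[of "chart_dom d"] atlas
  by (auto simp: overlap_iff smooth_atlas_def is_chart_def Collect_conj_eq[symmetric] cong: conj_cong)
    (metis (no_types, lifting) Collect_cong Collect_mem_eq overlap_iff)

lemma transition_has_derivative:
  assumes "d \<in> A" "u \<in> overlap c d"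
  shows "(transition c d has_derivative Dat (transition c d) u) (at u)"
proof (rule has_derivative_Dat)
  have "Ck_on 1 (transition c d) (overlap c d)"
    using atlas c assms(1) unfolding smooth_atlas_def smooth_on_def by blast
  then show "transition c d differentiable (at u)"
    using assms(2) by simp
qed

end

lemma in_some_chart: "x \<in> manifold A \<Longrightarrow> \<exists>c\<in>A. x \<in> chart_dom c"
  by (auto simp: manifold_def)

end

locale chart_flow = atlas A + short_flow "X c" u0 r K h
  for A :: "('m::t2_space, 'e::euclidean_space) chart set" and X :: "('m, 'e) vfield" and c u0 r K h +
  assumes c_in_A: "c \<in> A" and X_field: "vector_field A X" and B_img: "cball u0 (2 * r) \<subseteq> chart_img c"
begin

lemma \<Phi>_img: "y \<in> cball u0 r \<Longrightarrow> t \<in> I \<Longrightarrow> \<Phi> y t \<in> chart_img c"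
  using \<Phi>_in_B B_img by blast

text \<open>A solution of the equation in one chart is an integral curve, that is, a solution in every chart,
  by the transformation law of the field.\<close>

lemma flows_to_\<Phi>:
  assumes y: "y \<in> cball u0 r" and t: "t \<in> I"
  shows "flows_to A X t (chart_inv c y) (chart_inv c (\<Phi> y t))"
proof -
  let ?S = "closed_segment 0 t"
  have img: "\<Phi> y s \<in> chart_img c" if "s \<in> ?S" for s
    using \<Phi>_img[OF y segment_in_I[OF t that]] .
  have "integral_curve A X ?S (\<lambda>s. chart_inv c (\<Phi> y s))"
    unfolding integral_curve_def
  proof (intro conjI ballI impI)
    have "continuous_on ?S (\<Phi> y)"
      by (rule continuous_on_of_vector_derivative[OF \<Phi>_deriv_segment[OF y t]])
    then show "continuous_on ?S (\<lambda>s. chart_inv c (\<Phi> y s))"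
      by (rule continuous_on_compose2[OF inv_cont[OF c_in_A]]) (use img in auto)
    show "(\<lambda>s. chart_inv c (\<Phi> y s)) ` ?S \<subseteq> manifold A"
      using img inv_in_dom[OF c_in_A] dom_subset_manifold[OF c_in_A] by blast
    fix s d assume s: "s \<in> ?S" and d: "d \<in> A" and sd: "chart_inv c (\<Phi> y s) \<in> chart_dom d"
    have ov: "\<Phi> y s \<in> overlap c d"
      using overlap_iff[OF c_in_A] img[OF s] sd by blast
    have "((transition c d \<circ> \<Phi> y) has_vector_derivative Dat (transition c d) (\<Phi> y s) (X c (\<Phi> y s)))
        (at s within ?S)"
      by (rule vector_derivative_diff_chain_within[OF \<Phi>_deriv_segment[OF y t s]
            has_derivative_at_withinI[OF transition_has_derivative[OF c_in_A d ov]]])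
    moreover have "Dat (transition c d) (\<Phi> y s) (X c (\<Phi> y s)) = X d (transition c d (\<Phi> y s))"
      using X_field c_in_A d ov by (simp add: vector_field_def)
    ultimately show "((\<lambda>s. coord d (chart_inv c (\<Phi> y s))) has_vector_derivative
        X d (coord d (chart_inv c (\<Phi> y s)))) (at s within ?S)"
      by (simp add: transition_def o_def)
  qed
  then show ?thesis
    unfolding flows_to_def by (intro exI conjI) (auto simp: \<Phi>_0[OF y])
qed

end

context atlas
begin

lemma chart_flow_exists:
  assumes X: "vector_field A X" and c: "c \<in> A"
    and W: "open W" "u0 \<in> W" "W \<subseteq> chart_img c"
  obtains r K h where "chart_flow A X c u0 r K h" "cball u0 (2 * r) \<subseteq> W"
proof -
  have Ck: "Ck_on 2 (X c) (chart_img c)"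
    using X c by (auto simp: vector_field_def smooth_on_def)
  have CkW: "Ck_on 2 (X c) W"
    using Ck W(3) unfolding numeral_2_eq_2 Ck_on.simps by (blast intro: continuous_on_subset)
  obtain r0 K where r0: "0 < r0" "0 < K" "cball u0 r0 \<subseteq> W" "C11_on (X c) (cball u0 r0) K"
    by (rule C11_on_cball_exists[OF CkW W(1,2)])
  \<comment> \<open>The radius is halved because the constants of a short-time flow refer to the ball of
    radius \<open>2 r\<close>; the two bounds on \<open>h\<close> are the smallness conditions on \<open>K h\<close>.\<close>
  define r where "r = r0 / 2"
  define h where "h = min (1 / (2 * K)) (r / K)"
  have hK: "K * h \<le> K * (1 / (2 * K))" "K * h \<le> K * (r / K)"
    using r0(2) unfolding h_def by (intro mult_left_mono; simp)+
  have "chart_flow A X c u0 r K h"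
  proof
    show "C11_on (X c) (cball u0 (2 * r)) K" "0 < r" "0 < K" "0 < h" "K * h \<le> 1 / 2" "K * h \<le> r"
      using r0 hK by (auto simp: r_def h_def)
    show "c \<in> A" "vector_field A X" by (fact c, fact X)
    show "cball u0 (2 * r) \<subseteq> chart_img c"
      using r0 W by (auto simp: r_def)
  qed
  moreover have "cball u0 (2 * r) \<subseteq> W"
    using r0 by (simp add: r_def)
  ultimately show thesis by (rule that)
qed

lemma integral_curves_agree:
  assumes X: "vector_field A X"
    and g1: "integral_curve A X (closed_segment 0 T) g1"
    and g2: "integral_curve A X (closed_segment 0 T) g2"
    and eq0: "g1 0 = g2 0"
  shows "g1 T = g2 T"
proof -
  let ?I = "closed_segment 0 T"
  have cont: "continuous_on ?I g1" "continuous_on ?I g2"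
    using g1 g2 by (auto simp: integral_curve_def)
  \<comment> \<open>Both the set where the curves agree and the set where they differ are open in the time
    interval: the first by the uniqueness of solutions in a chart, the second because the manifold
    is Hausdorff.\<close>
  have nbhd: "openin (top_of_set ?I) (?I \<inter> (g1 -` U \<inter> g2 -` V))" if "open U" "open V" for U V
    using openin_Int[OF continuous_openin_preimage_gen[OF cont(1) that(1)]
        continuous_openin_preimage_gen[OF cont(2) that(2)]]
    by (simp add: Int_assoc Int_left_commute)
  show ?thesis
  proof (rule connected_induction_simple[of ?I 0 T "\<lambda>s. g1 s = g2 s"])
    fix a assume a: "a \<in> ?I"
    show "\<exists>T. openin (top_of_set ?I) T \<and> a \<in> T \<and> (\<forall>x\<in>T. \<forall>y\<in>T. g1 x = g2 x \<longrightarrow> g1 y = g2 y)"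
    proof (cases "g1 a = g2 a")
      case False
      then obtain U V where "open U" "open V" "g1 a \<in> U" "g2 a \<in> V" "U \<inter> V = {}"
        by (meson hausdorff)
      then show ?thesis
        using nbhd[of U V] a by (intro exI[of _ "?I \<inter> (g1 -` U \<inter> g2 -` V)"]) auto
    next
      case True
      have "g1 a \<in> manifold A"
        using g1 a by (auto simp: integral_curve_def)
      then obtain c where c: "c \<in> A" "g1 a \<in> chart_dom c"
        using in_some_chart by blast
      obtain r K h where fl: "chart_flow A X c (coord c (g1 a)) r K h"
        using chart_flow_exists[OF X c(1) open_chart_img[OF c(1)] coord_in_img[OF c] subset_refl] .
      interpret chart_flow A X c "coord c (g1 a)" r K h by (rule fl)
      define U where "U = {x \<in> chart_dom c. coord c x \<in> ball (coord c (g1 a)) (2 * r)}"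
      have U: "open U" "g1 a \<in> U"
        using open_coord_preimage[OF c(1) open_ball] c(2) r unfolding U_def by simp_all
      have "openin (top_of_set ?I) (?I \<inter> (g1 -` U \<inter> g2 -` U))"
        using nbhd U by blast
      then obtain d where d: "0 < d"
        "\<And>s. s \<in> ?I \<Longrightarrow> dist s a < d \<Longrightarrow> g1 s \<in> U \<and> g2 s \<in> U"
        using a U True unfolding openin_euclidean_subtopology_iff by (force simp: dist_commute)
      let ?d = "min d h"
      have "g1 y = g2 y" if y: "y \<in> ?I" "dist y a < ?d" for y
      proof -
        let ?S = "closed_segment a y"
        have S: "?S \<subseteq> ?I" using a y by (simp add: closed_segment_subset)
        have near: "dist s a < d" if "s \<in> ?S" for s
          using segment_bound(1)[OF that] y by (simp add: dist_norm norm_minus_commute)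
        have inU: "g1 s \<in> U" "g2 s \<in> U" if "s \<in> ?S" for s
          using d near that S by blast+
        have d1: "((\<lambda>s. coord c (g1 s)) has_vector_derivative X c (coord c (g1 s))) (at s within ?S)"
          and d2: "((\<lambda>s. coord c (g2 s)) has_vector_derivative X c (coord c (g2 s))) (at s within ?S)"
          if s: "s \<in> ?S" for s
        proof -
          have sI: "s \<in> ?I" and dom: "g1 s \<in> chart_dom c" "g2 s \<in> chart_dom c"
            using s S inU[OF s] by (auto simp: U_def)
          show "((\<lambda>s. coord c (g1 s)) has_vector_derivative X c (coord c (g1 s))) (at s within ?S)"
            using g1 sI dom(1) c(1) unfolding integral_curve_def
            by (intro has_vector_derivative_within_subset[OF _ S]) simp
          show "((\<lambda>s. coord c (g2 s)) has_vector_derivative X c (coord c (g2 s))) (at s within ?S)"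
            using g2 sI dom(2) c(1) unfolding integral_curve_def
            by (intro has_vector_derivative_within_subset[OF _ S]) simp
        qed
        let ?e = "\<lambda>s. coord c (g1 s) - coord c (g2 s)"
        have "norm (?e y) \<le> 2 * (norm (?e a) + \<bar>y - a\<bar> * 0)"
        proof (rule gronwall_short[where e = ?e and K = K
              and e' = "\<lambda>s. X c (coord c (g1 s)) - X c (coord c (g2 s))"])
          fix s assume s: "s \<in> ?S"
          show "(?e has_vector_derivative X c (coord c (g1 s)) - X c (coord c (g2 s))) (at s within ?S)"
            by (intro has_vector_derivative_diff d1 d2 s)
          show "norm (X c (coord c (g1 s)) - X c (coord c (g2 s))) \<le> 0 + K * norm (?e s)"
            using f_lip[of "coord c (g1 s)" "coord c (g2 s)"] inU[OF s] by (auto simp: U_def)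
        next
          have "K * \<bar>y - a\<bar> \<le> K * h"
            using K y by (intro mult_left_mono) (auto simp: dist_norm)
          then show "K * \<bar>y - a\<bar> \<le> 1 / 2" using Kh by simp
        qed (use K in auto)
        then have "coord c (g1 y) = coord c (g2 y)" using True by simp
        moreover have "g1 y \<in> chart_dom c" "g2 y \<in> chart_dom c"
          using inU[of y] by (auto simp: U_def)
        ultimately show ?thesis
          using inv_coord[OF c(1)] by metis
      qed
      moreover have "openin (top_of_set ?I) (?I \<inter> ball a ?d)" by blast
      ultimately show ?thesis
        using a d h by (intro exI[of _ "?I \<inter> ball a ?d"]) (auto simp: dist_commute)
    qed
  qed (use eq0 in auto)
qed

text \<open>By uniqueness, the definite description in \<open>flow\<close> denotes the endpoint of any integral curve.\<close>

lemma flow_eq_Some_iff: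
  assumes "vector_field A X"
  shows "flow A X t x = Some y \<longleftrightarrow> flows_to A X t x y"
proof -
  have "y = z" if "flows_to A X t x y" "flows_to A X t x z" for y z
    using that integral_curves_agree[OF assms] unfolding flows_to_def by metis
  then have "flows_to A X t x y \<Longrightarrow> (THE y. flows_to A X t x y) = y" for y
    by (intro the_equality) auto
  then show ?thesis
    unfolding flow_def by auto
qed

lemma flows_to_0: "flows_to A X 0 x y \<Longrightarrow> x = y"
  by (auto simp: flows_to_def)

text \<open>For times of equal sign the two curves can be joined to one over the segment from \<open>0\<close> to \<open>s + t\<close>.
  For opposite signs the time intervals would overlap.\<close>

lemma flows_to_add:
  assumes 1: "flows_to A X s x y" and 2: "flows_to A X t y z" and st: "0 \<le> s * t"
  shows "flows_to A X (s + t) x z"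
proof (cases "s = 0 \<or> t = 0")
  case True
  then show ?thesis using 1 2 by (auto dest: flows_to_0)
next
  case False
  let ?S = "closed_segment 0 s" and ?T = "closed_segment s (s + t)"
  have ST: "?S \<union> ?T = closed_segment 0 (s + t)" "?S \<inter> ?T = {s}"
    using st False by (auto simp: closed_segment_eq_real_ivl zero_le_mult_iff split: if_splits)
  have cl: "closure ?S \<inter> closure ?T = {s}"
    using ST(2) by simp
  obtain g1 where g1: "integral_curve A X ?S g1" "g1 0 = x" "g1 s = y"
    using 1 by (auto simp: flows_to_def)
  obtain g2 where g2: "integral_curve A X (closed_segment 0 t) g2" "g2 0 = y" "g2 t = z"
    using 2 by (auto simp: flows_to_def)
  have shift: "(\<lambda>r. r - s) ` ?T = closed_segment 0 t"
    by (auto simp: closed_segment_eq_real_ivl image_iff algebra_simps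
        intro!: bexI[of _ "_ + s"] split: if_splits)
  have shift': "r \<in> ?T \<Longrightarrow> r - s \<in> closed_segment 0 t" for r
    using shift by blast
  define g where "g r = (if r \<in> ?S then g1 r else g2 (r - s))" for r
  have gS: "g r = g1 r" if "r \<in> ?S" for r using that by (simp add: g_def)
  have gT: "g r = g2 (r - s)" if "r \<in> ?T" for r
  proof (cases "r \<in> ?S")
    case True
    then have "r = s" using that ST(2) by blast
    then show ?thesis using g1 g2 by (simp add: g_def)
  qed (simp add: g_def)
  have join: "g1 r = g2 (r - s)" if "r \<in> ?S" "r \<in> ?T" for r
    using gS[OF that(1)] gT[OF that(2)] by simp
  have "integral_curve A X (?S \<union> ?T) g"
    unfolding integral_curve_def
  proof (intro conjI ballI impI)
    have "continuous_on ?T (\<lambda>r. g2 (r - s))"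
      by (rule continuous_on_compose2[of "closed_segment 0 t" g2])
        (use g2 shift' in \<open>auto simp: integral_curve_def intro!: continuous_intros\<close>)
    then show "continuous_on (?S \<union> ?T) g"
      unfolding g_def using g1(1) by (intro continuous_on_cases) (auto simp: integral_curve_def join)
    show "g ` (?S \<union> ?T) \<subseteq> manifold A"
      using g1 g2 gS gT shift' by (auto simp: integral_curve_def image_subset_iff)
    fix r c assume r: "r \<in> ?S \<union> ?T" and c: "c \<in> A" and rc: "g r \<in> chart_dom c"
    have d1: "((\<lambda>r. coord c (g1 r)) has_vector_derivative X c (coord c (g1 r))) (at r within ?S)"
      if "r \<in> ?S"
      using that g1 c rc gS[OF that] by (simp add: integral_curve_def)
    have d2: "((\<lambda>r. coord c (g2 (r - s))) has_vector_derivative X c (coord c (g2 (r - s)))) (at r within ?T)"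
      if "r \<in> ?T"
    proof -
      have "((\<lambda>r. coord c (g2 r)) has_vector_derivative X c (coord c (g2 (r - s))))
          (at (r - s) within closed_segment 0 t)"
        using shift'[OF that] g2 c rc gT[OF that] by (simp add: integral_curve_def)
      moreover have "((\<lambda>r. r - s) has_vector_derivative 1) (at r within ?T)"
        by (auto intro!: derivative_eq_intros)
      ultimately show ?thesis
        using vector_diff_chain_within[of "\<lambda>r. r - s" 1 r ?T "\<lambda>r. coord c (g2 r)"] shift
        by (simp add: o_def)
    qed
    have "((\<lambda>r. if r \<in> ?S then coord c (g1 r) else coord c (g2 (r - s))) has_vector_derivative
        (if r \<in> ?S then X c (coord c (g1 r)) else X c (coord c (g2 (r - s))))) (at r within ?S \<union> ?T)"
      by (rule has_vector_derivative_If_within_closures[OF r refl])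
        (use cl d1 d2 join in \<open>auto simp: insert_absorb join simp del: closure_closed\<close>)
    then show "((\<lambda>r. coord c (g r)) has_vector_derivative X c (coord c (g r))) (at r within ?S \<union> ?T)"
      by (simp add: g_def if_distrib cong: if_cong)
  qed
  moreover have "g 0 = x" "g (s + t) = z"
    using gS[of 0] gT[of "s + t"] g1 g2 by auto
  ultimately show ?thesis
    unfolding flows_to_def ST by blast
qed

end


section \<open>Forms along curves and local nature of contact maps\<close>

lemma form_eq_sum_Basis:
  fixes a :: "'e::euclidean_space \<Rightarrow> real"
  assumes "linear a"
  shows "a v = (\<Sum>b\<in>Basis. (v \<bullet> b) * a b)"
proof -
  have "a v = a (\<Sum>b\<in>Basis. (v \<bullet> b) *\<^sub>R b)"
    by (simp add: euclidean_representation)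
  also have "\<dots> = (\<Sum>b\<in>Basis. (v \<bullet> b) * a b)"
    using assms by (simp add: linear_sum linear_cmul)
  finally show ?thesis .
qed

locale smooth_form =
  fixes W :: "'e::euclidean_space set" and \<alpha> :: "'e \<Rightarrow> 'e \<Rightarrow> real"
  assumes open_W: "open W" and lin: "\<And>u. u \<in> W \<Longrightarrow> linear (\<alpha> u)"
    and smooth: "\<And>v. smooth_on (\<lambda>u. \<alpha> u v) W"
begin

lemma form_diff: "u \<in> W \<Longrightarrow> (\<lambda>u. \<alpha> u v) differentiable (at u)"
  and form_cont: "continuous_on W (\<lambda>u. \<alpha> u v)"
  and Dform_cont: "continuous_on W (\<lambda>u. Dat (\<lambda>u. \<alpha> u v) u w)"
proof -
  have "Ck_on 1 (\<lambda>u. \<alpha> u v) W" "Ck_on 0 (\<lambda>u. \<alpha> u v) W"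
    using smooth unfolding smooth_on_def by blast+
  then show "u \<in> W \<Longrightarrow> (\<lambda>u. \<alpha> u v) differentiable (at u)"
    "continuous_on W (\<lambda>u. \<alpha> u v)" "continuous_on W (\<lambda>u. Dat (\<lambda>u. \<alpha> u v) u w)"
    by simp_all
qed

lemma Dform_eq_sum_Basis:
  assumes u: "u \<in> W"
  shows "Dat (\<lambda>u. \<alpha> u v) u x = (\<Sum>b\<in>Basis. (v \<bullet> b) * Dat (\<lambda>u. \<alpha> u b) u x)"
proof -
  have "((\<lambda>u. \<Sum>b\<in>Basis. (v \<bullet> b) * \<alpha> u b) has_derivative
      (\<lambda>x. \<Sum>b\<in>Basis. (v \<bullet> b) * Dat (\<lambda>u. \<alpha> u b) u x)) (at u)"
    by (intro has_derivative_sum has_derivative_mult_right has_derivative_Dat form_diff u)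
  then have "((\<lambda>u. \<alpha> u v) has_derivative
      (\<lambda>x. \<Sum>b\<in>Basis. (v \<bullet> b) * Dat (\<lambda>u. \<alpha> u b) u x)) (at u)"
    by (rule has_derivative_transform_within_open[OF _ open_W u])
      (simp add: form_eq_sum_Basis[OF lin, symmetric])
  from frechet_derivative_at[OF this] show ?thesis by metis
qed

text \<open>In a basis \<open>\<alpha> (\<gamma> s) (w s)\<close> is a finite sum of products of scalar functions. When \<open>\<gamma>\<close> is a solution
  and \<open>w\<close> a variation of it, the right-hand side is the Lie derivative of \<open>\<alpha>\<close>.\<close>

lemma form_along_curve:
  assumes \<gamma>: "(\<gamma> has_vector_derivative \<gamma>') (at s within I)" "\<And>s. s \<in> I \<Longrightarrow> \<gamma> s \<in> W"
    and w: "(w has_vector_derivative w') (at s within I)" and s: "s \<in> I"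
  shows "((\<lambda>s. \<alpha> (\<gamma> s) (w s)) has_vector_derivative
    Dat (\<lambda>u. \<alpha> u (w s)) (\<gamma> s) \<gamma>' + \<alpha> (\<gamma> s) w') (at s within I)"
proof -
  have W: "\<gamma> s \<in> W" using \<gamma>(2) s .
  have "((\<lambda>s. \<Sum>b\<in>Basis. (w s \<bullet> b) * \<alpha> (\<gamma> s) b) has_vector_derivative
      (\<Sum>b\<in>Basis. (w s \<bullet> b) * Dat (\<lambda>u. \<alpha> u b) (\<gamma> s) \<gamma>' + (w' \<bullet> b) * \<alpha> (\<gamma> s) b)) (at s within I)"
  proof (intro has_vector_derivative_sum has_vector_derivative_mult)
    fix b :: 'e
    show "((\<lambda>s. w s \<bullet> b) has_vector_derivative w' \<bullet> b) (at s within I)"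
      by (rule bounded_linear.has_vector_derivative[OF bounded_linear_inner_left w])
    show "((\<lambda>s. \<alpha> (\<gamma> s) b) has_vector_derivative Dat (\<lambda>u. \<alpha> u b) (\<gamma> s) \<gamma>') (at s within I)"
      using vector_derivative_diff_chain_within[OF \<gamma>(1)
          has_derivative_at_withinI[OF has_derivative_Dat[OF form_diff[OF W, of b]]]]
      by (simp add: o_def)
  qed
  moreover have "(\<Sum>b\<in>Basis. (w s \<bullet> b) * Dat (\<lambda>u. \<alpha> u b) (\<gamma> s) \<gamma>' + (w' \<bullet> b) * \<alpha> (\<gamma> s) b) =
      Dat (\<lambda>u. \<alpha> u (w s)) (\<gamma> s) \<gamma>' + \<alpha> (\<gamma> s) w'"
    by (simp add: sum.distrib Dform_eq_sum_Basis[OF W, of "w s"] form_eq_sum_Basis[OF lin[OF W], of w'])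
  ultimately have "((\<lambda>s. \<Sum>b\<in>Basis. (w s \<bullet> b) * \<alpha> (\<gamma> s) b) has_vector_derivative
      Dat (\<lambda>u. \<alpha> u (w s)) (\<gamma> s) \<gamma>' + \<alpha> (\<gamma> s) w') (at s within I)"
    by simp
  then show ?thesis
    by (rule has_vector_derivative_transform[OF s, rotated])
      (rule form_eq_sum_Basis[OF lin[OF \<gamma>(2)]])
qed

lemma lie_deriv_cont:
  assumes S: "S \<subseteq> W" and Y: "continuous_on S Y" "continuous_on S (\<lambda>x. Dat Y x v)"
  shows "continuous_on S (\<lambda>u. lie_deriv Y \<alpha> u v)"
  unfolding lie_deriv_def
proof (rule continuous_on_add)
  show "continuous_on S (\<lambda>u. Dat (\<lambda>y. \<alpha> y v) u (Y u))"
  proof (rule continuous_on_linear_family[OF _ _ Y(1)])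
    show "linear (Dat (\<lambda>y. \<alpha> y v) u)" if "u \<in> S" for u
      using that S by (intro linear_Dat form_diff) auto
    show "continuous_on S (\<lambda>u. Dat (\<lambda>y. \<alpha> y v) u b)" for b
      using Dform_cont S by (rule continuous_on_subset)
  qed
  show "continuous_on S (\<lambda>u. \<alpha> u (Dat Y u v))"
  proof (rule continuous_on_linear_family[OF _ _ Y(2)])
    show "linear (\<alpha> u)" if "u \<in> S" for u
      using that S by (intro lin) auto
    show "continuous_on S (\<lambda>u. \<alpha> u b)" for b
      using form_cont S by (rule continuous_on_subset)
  qed
qed

end

text \<open>The factor is the exponential of the integral of \<open>k\<close>. It does not depend on the solution \<open>g\<close>, and
  so will be the same for all tangent vectors.\<close>

lemma scalar_linear_ode:
  fixes g k :: "real \<Rightarrow> real"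
  assumes k: "continuous_on {- h..h} k" and t: "t \<in> {- h..h}" "0 < h"
  obtains R where "R \<noteq> 0"
    "\<And>g. (\<And>s. s \<in> {- h..h} \<Longrightarrow> (g has_vector_derivative k s * g s) (at s within {- h..h})) \<Longrightarrow>
       g t = R * g 0"
proof -
  define P where "P s = integral {- h..s} k" for s
  have P: "(P has_vector_derivative k s) (at s within {- h..h})" if "s \<in> {- h..h}" for s
    unfolding P_def using k that by (rule integral_has_vector_derivative)
  show thesis
  proof (rule that[of "exp (P t - P 0)"])
    fix g :: "real \<Rightarrow> real"
    assume g: "\<And>s. s \<in> {- h..h} \<Longrightarrow> (g has_vector_derivative k s * g s) (at s within {- h..h})"
    let ?q = "\<lambda>s. exp (- P s) * g s"
    have "(?q has_vector_derivative 0) (at s within {- h..h})" if s: "s \<in> {- h..h}" for s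
      using g[OF s] P[OF s]
      unfolding has_real_derivative_iff_has_vector_derivative[symmetric]
      by (auto intro!: derivative_eq_intros)
    then have "norm (?q t - ?q 0) \<le> 0 * \<bar>t - 0\<bar>"
      using t by (intro norm_diff_le_of_vector_derivative[of "{- h..h}" ?q "\<lambda>_. 0"]) auto
    then have "exp (P t) * (exp (- P t) * g t) = exp (P t) * (exp (- P 0) * g 0)" by simp
    then show "g t = exp (P t - P 0) * g 0"
      by (simp add: exp_minus exp_diff field_simps)
  qed simp
qed

locale atlas_form = atlas A
  for A :: "('m::t2_space, 'e::euclidean_space) chart set" +
  fixes \<eta> :: "('m, 'e) form1"
  assumes one_form: "one_form A \<eta>"
begin

lemma smooth_form: "c \<in> A \<Longrightarrow> smooth_form (chart_img c) (\<eta> c)"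
  using one_form open_chart_img by (intro smooth_form.intro) (auto simp: one_form_def)

lemma form_transition:
  "c \<in> A \<Longrightarrow> d \<in> A \<Longrightarrow> u \<in> overlap c d \<Longrightarrow>
    \<eta> d (transition c d u) (Dat (transition c d) u v) = \<eta> c u v"
  using one_form by (auto simp: one_form_def)

text \<open>Near \<open>coord c x\<close> the map \<open>f\<close> is represented by its expression in the charts \<open>c\<close> and \<open>d\<close>. Elsewhere
  that expression has arbitrary values, so \<open>N\<close> is where derivatives may be computed from it.\<close>

lemma coordinate_nbhd:
  assumes f: "open (dom f)" "continuous_on (dom f) (\<lambda>x. the (f x))" "x \<in> dom f"
    and c: "c \<in> A" "x \<in> chart_dom c" and d: "d \<in> A" "the (f x) \<in> chart_dom d"
  obtains N where "open N" "coord c x \<in> N"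
    "\<And>u. u \<in> N \<Longrightarrow> u \<in> chart_img c \<and> chart_inv c u \<in> dom f \<and> the (f (chart_inv c u)) \<in> chart_dom d"
proof -
  have "open (dom f \<inter> (\<lambda>x. the (f x)) -` chart_dom d)"
    using f(2,1) open_chart_dom[OF d(1)] by (rule continuous_open_preimage)
  then have "open {u \<in> chart_img c. chart_inv c u \<in> dom f \<inter> (\<lambda>x. the (f x)) -` chart_dom d}"
    by (rule open_inv_preimage[OF c(1)])
  then show thesis
    by (rule that) (use f c d coord_in_img[OF c] inv_coord[OF c] in auto)
qed

definition conformal_at :: "('m \<rightharpoonup> 'm) \<Rightarrow> 'm \<Rightarrow> real \<Rightarrow> bool" where
  "conformal_at f x \<rho> \<longleftrightarrow>
     (\<forall>c\<in>A. \<forall>d\<in>A. x \<in> chart_dom c \<longrightarrow> the (f x) \<in> chart_dom d \<longrightarrow>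
        (\<exists>D. ((\<lambda>u. coord d (the (f (chart_inv c u)))) has_derivative D) (at (coord c x)) \<and>
             (\<forall>v. \<eta> d (coord d (the (f x))) (D v) = \<rho> * \<eta> c (coord c x) v)))"

lemma contact_map_iff:
  "contact_map A \<eta> f \<longleftrightarrow>
     open (dom f) \<and> dom f \<subseteq> manifold A \<and> ran f \<subseteq> manifold A \<and>
     continuous_on (dom f) (\<lambda>x. the (f x)) \<and> (\<forall>x\<in>dom f. \<exists>\<rho>. \<rho> \<noteq> 0 \<and> conformal_at f x \<rho>)"
  unfolding contact_map_def conformal_at_def bchoice_iff[symmetric] by (subst bchoice_iff) rule

text \<open>Changes of charts preserve the form, so one chart around the point and one around its image are
  enough.\<close>

lemma conformal_at_if_in_charts:
  assumes f: "open (dom f)" "continuous_on (dom f) (\<lambda>x. the (f x))" "x \<in> dom f"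
    and c: "c \<in> A" "x \<in> chart_dom c" and d: "d \<in> A" "the (f x) \<in> chart_dom d"
    and D: "((\<lambda>u. coord d (the (f (chart_inv c u)))) has_derivative D) (at (coord c x))"
    and \<eta>D: "\<And>v. \<eta> d (coord d (the (f x))) (D v) = \<rho> * \<eta> c (coord c x) v"
  shows "conformal_at f x \<rho>"
  unfolding conformal_at_def
proof (intro ballI impI)
  fix c' d' assume c': "c' \<in> A" "x \<in> chart_dom c'" and d': "d' \<in> A" "the (f x) \<in> chart_dom d'"
  let ?u = "coord c' x"
  let ?G = "\<lambda>u. coord d (the (f (chart_inv c u)))"
  obtain N where N: "open N" "?u \<in> N"
    "\<And>u. u \<in> N \<Longrightarrow> u \<in> chart_img c' \<and> chart_inv c' u \<in> dom f \<and> the (f (chart_inv c' u)) \<in> chart_dom d"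
    using coordinate_nbhd[OF f c' d] by blast
  let ?N = "N \<inter> overlap c' c"
  have ov: "?u \<in> overlap c' c"
    using overlap_iff[OF c'(1)] c c' coord_in_img inv_coord by metis
  have ov': "?G (coord c x) \<in> overlap d d'"
    using overlap_iff[OF d(1)] d d' coord_in_img inv_coord c by metis
  have tr: "transition c' c ?u = coord c x"
    using inv_coord[OF c'] by (simp add: transition_def)
  have tr': "transition d d' (?G (coord c x)) = coord d' (the (f x))"
    using inv_coord[OF c] inv_coord[OF d] by (simp add: transition_def)
  let ?D' = "Dat (transition d d') (?G (coord c x)) \<circ> (D \<circ> Dat (transition c' c) ?u)"
  have D1: "((?G \<circ> transition c' c) has_derivative (D \<circ> Dat (transition c' c) ?u)) (at ?u)"
    by (rule diff_chain_at[OF transition_has_derivative[OF c'(1) c(1) ov]]) (simp add: tr D)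
  have "((transition d d' \<circ> (?G \<circ> transition c' c)) has_derivative ?D') (at ?u)"
    by (rule diff_chain_at[OF D1])
      (use transition_has_derivative[OF d(1) d'(1) ov'] in \<open>simp add: tr\<close>)
  then have "((\<lambda>u. coord d' (the (f (chart_inv c' u)))) has_derivative ?D') (at ?u)"
  proof (rule has_derivative_transform_within_open)
    show "open ?N" using N open_overlap[OF c'(1) c(1)] by auto
    show "?u \<in> ?N" using N ov by auto
    fix u assume u: "u \<in> ?N"
    then have "chart_inv c' u \<in> chart_dom c"
      using overlap_iff[OF c'(1)] by auto
    then show "(transition d d' \<circ> (?G \<circ> transition c' c)) u = coord d' (the (f (chart_inv c' u)))"
      using u N inv_coord[OF c(1)] inv_coord[OF d(1)] by (simp add: transition_def)
  qed
  moreover have "\<eta> d' (coord d' (the (f x))) (?D' v) = \<rho> * \<eta> c' ?u v" for v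
  proof -
    have "\<eta> d' (coord d' (the (f x))) (?D' v) = \<eta> d (?G (coord c x)) (D (Dat (transition c' c) ?u v))"
      using form_transition[OF d(1) d'(1) ov'] by (simp add: tr' o_def)
    also have "\<dots> = \<rho> * \<eta> c (transition c' c ?u) (Dat (transition c' c) ?u v)"
      using \<eta>D by (simp add: tr inv_coord[OF c])
    also have "\<dots> = \<rho> * \<eta> c' ?u v"
      using form_transition[OF c'(1) c(1) ov] by simp
    finally show ?thesis .
  qed
  ultimately show "\<exists>D. ((\<lambda>u. coord d' (the (f (chart_inv c' u)))) has_derivative D) (at ?u) \<and>
      (\<forall>v. \<eta> d' (coord d' (the (f x))) (D v) = \<rho> * \<eta> c' ?u v)"
    by blast
qed

lemma contact_map_comp:
  assumes f: "contact_map A \<eta> f" and g: "contact_map A \<eta> g"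
  shows "contact_map A \<eta> (g \<circ>\<^sub>m f)"
proof -
  have f': "open (dom f)" "dom f \<subseteq> manifold A" "ran f \<subseteq> manifold A"
      "continuous_on (dom f) (\<lambda>x. the (f x))" "\<And>x. x \<in> dom f \<Longrightarrow> \<exists>\<rho>. \<rho> \<noteq> 0 \<and> conformal_at f x \<rho>"
    and g': "open (dom g)" "ran g \<subseteq> manifold A"
      "continuous_on (dom g) (\<lambda>x. the (g x))" "\<And>x. x \<in> dom g \<Longrightarrow> \<exists>\<rho>. \<rho> \<noteq> 0 \<and> conformal_at g x \<rho>"
    using f g by (auto simp: contact_map_iff)
  have dom: "dom (g \<circ>\<^sub>m f) = dom f \<inter> (\<lambda>x. the (f x)) -` dom g"
    by (auto simp: map_comp_def split: option.splits)
  have val: "the ((g \<circ>\<^sub>m f) x) = the (g (the (f x)))" if "x \<in> dom f" for x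
    using that by (auto simp: map_comp_def)
  have o: "open (dom (g \<circ>\<^sub>m f))"
    unfolding dom using f'(4,1) g'(1) by (rule continuous_open_preimage)
  have "continuous_on (dom (g \<circ>\<^sub>m f)) (\<lambda>x. the (g (the (f x))))"
    by (rule continuous_on_compose2[OF g'(3) continuous_on_subset[OF f'(4)]]) (auto simp: dom)
  then have cont: "continuous_on (dom (g \<circ>\<^sub>m f)) (\<lambda>x. the ((g \<circ>\<^sub>m f) x))"
    by (rule continuous_on_eq) (auto simp: dom val)
  have "\<exists>\<rho>. \<rho> \<noteq> 0 \<and> conformal_at (g \<circ>\<^sub>m f) x \<rho>" if x: "x \<in> dom (g \<circ>\<^sub>m f)" for x
  proof -
    define y where "y = the (f x)"
    have xf: "x \<in> dom f" and yg: "y \<in> dom g" using x by (auto simp: dom y_def)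
    have fgx: "the ((g \<circ>\<^sub>m f) x) = the (g y)" using val[OF xf] by (simp add: y_def)
    have "y \<in> manifold A" "x \<in> manifold A" "the (g y) \<in> manifold A"
      using xf yg f' g' by (auto simp: y_def ran_def)
    then obtain c d e where c: "c \<in> A" "x \<in> chart_dom c" and d: "d \<in> A" "y \<in> chart_dom d"
      and e: "e \<in> A" "the (g y) \<in> chart_dom e"
      using in_some_chart by meson
    obtain \<rho>1 \<rho>2 where \<rho>: "\<rho>1 \<noteq> 0" "conformal_at f x \<rho>1" "\<rho>2 \<noteq> 0" "conformal_at g y \<rho>2"
      using f'(5)[OF xf] g'(4)[OF yg] by blast
    let ?F = "\<lambda>u. coord d (the (f (chart_inv c u)))"
    let ?G = "\<lambda>u. coord e (the (g (chart_inv d u)))"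
    obtain D1 where D1: "(?F has_derivative D1) (at (coord c x))"
      "\<And>v. \<eta> d (coord d y) (D1 v) = \<rho>1 * \<eta> c (coord c x) v"
      using \<rho>(2) c d unfolding conformal_at_def y_def by blast
    obtain D2 where D2: "(?G has_derivative D2) (at (coord d y))"
      "\<And>v. \<eta> e (coord e (the (g y))) (D2 v) = \<rho>2 * \<eta> d (coord d y) v"
      using \<rho>(4) d e unfolding conformal_at_def by blast
    obtain N where N: "open N" "coord c x \<in> N"
      "\<And>u. u \<in> N \<Longrightarrow> u \<in> chart_img c \<and> chart_inv c u \<in> dom f \<and> the (f (chart_inv c u)) \<in> chart_dom d"
      using coordinate_nbhd[OF f'(1,4) xf c d(1)] d(2) unfolding y_def by blast
    have Fx: "?F (coord c x) = coord d y" using inv_coord[OF c] by (simp add: y_def)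
    have "((?G \<circ> ?F) has_derivative (D2 \<circ> D1)) (at (coord c x))"
      by (rule diff_chain_at[OF D1(1)]) (simp only: Fx D2)
    then have D: "((\<lambda>u. coord e (the ((g \<circ>\<^sub>m f) (chart_inv c u)))) has_derivative (D2 \<circ> D1)) (at (coord c x))"
      by (rule has_derivative_transform_within_open[OF _ N(1,2)])
        (use N(3) val inv_coord[OF d(1)] in simp)
    have "conformal_at (g \<circ>\<^sub>m f) x (\<rho>2 * \<rho>1)"
      by (rule conformal_at_if_in_charts[OF o cont x c e(1) _ D]) (use e fgx D1 D2 in auto)
    with \<rho> show ?thesis by (intro exI[of _ "\<rho>2 * \<rho>1"]) simp
  qed
  moreover have "ran (g \<circ>\<^sub>m f) \<subseteq> manifold A"
    using g'(2) by (auto simp: ran_def map_comp_def split: option.splits)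
  ultimately show ?thesis
    unfolding contact_map_iff using o cont f'(2) by (auto simp: dom)
qed

text \<open>Every requirement on a contact map is local. Thus a flow map may be treated near each point of its
  domain separately, where it extends a composition of short-time flows.\<close>

lemma contact_map_if_locally:
  assumes loc: "\<And>x. x \<in> dom f \<Longrightarrow> \<exists>g. contact_map A \<eta> g \<and> x \<in> dom g \<and> g \<subseteq>\<^sub>m f"
  shows "contact_map A \<eta> f"
proof -
  obtain G where G: "\<And>x. x \<in> dom f \<Longrightarrow> contact_map A \<eta> (G x)" "\<And>x. x \<in> dom f \<Longrightarrow> x \<in> dom (G x)"
    "\<And>x. x \<in> dom f \<Longrightarrow> G x \<subseteq>\<^sub>m f"
    using loc by metis
  have G': "\<And>x. x \<in> dom f \<Longrightarrow> open (dom (G x))" "\<And>x. x \<in> dom f \<Longrightarrow> dom (G x) \<subseteq> manifold A"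
    "\<And>x. x \<in> dom f \<Longrightarrow> ran (G x) \<subseteq> manifold A"
    "\<And>x. x \<in> dom f \<Longrightarrow> continuous_on (dom (G x)) (\<lambda>y. the (G x y))"
    "\<And>x. x \<in> dom f \<Longrightarrow> \<exists>\<rho>. \<rho> \<noteq> 0 \<and> conformal_at (G x) x \<rho>"
    using G(1,2) by (auto simp: contact_map_iff)
  have le: "G x y = f y" if "x \<in> dom f" "y \<in> dom (G x)" for x y
    using G(3)[OF that(1)] that(2) by (auto simp: map_le_def)
  have sub: "dom (G x) \<subseteq> dom f" if "x \<in> dom f" for x
    using G(3)[OF that] by (rule map_le_implies_dom_le)
  have dom: "dom f = (\<Union>x\<in>dom f. dom (G x))"
    using G(2) sub by blast
  have o: "open (dom f)"
    by (subst dom) (use G'(1) in blast)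
  have cont: "continuous_on (dom f) (\<lambda>x. the (f x))"
  proof (subst dom, rule continuous_on_open_UN)
    fix x assume x: "x \<in> dom f"
    show "open (dom (G x))" using G'(1) x .
    show "continuous_on (dom (G x)) (\<lambda>x. the (f x))"
      using G'(4)[OF x] by (rule continuous_on_eq) (simp add: le[OF x])
  qed
  have "\<exists>\<rho>. \<rho> \<noteq> 0 \<and> conformal_at f x \<rho>" if x: "x \<in> dom f" for x
  proof -
    have fx: "f x = G x x" using le x G(2) by simp
    have "the (f x) \<in> manifold A"
      using G(2)[OF x] G'(3)[OF x] fx by (auto simp: ran_def)
    moreover have "x \<in> manifold A" using G(2) G'(2) x by blast
    ultimately obtain c d where c: "c \<in> A" "x \<in> chart_dom c" and d: "d \<in> A" "the (f x) \<in> chart_dom d"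
      using in_some_chart by meson
    obtain \<rho> where \<rho>: "\<rho> \<noteq> 0" "conformal_at (G x) x \<rho>" using G'(5)[OF x] by blast
    obtain D where D: "((\<lambda>u. coord d (the (G x (chart_inv c u)))) has_derivative D) (at (coord c x))"
      "\<And>v. \<eta> d (coord d (the (f x))) (D v) = \<rho> * \<eta> c (coord c x) v"
      using \<rho>(2) c d fx unfolding conformal_at_def by metis
    obtain N where N: "open N" "coord c x \<in> N" "\<And>u. u \<in> N \<Longrightarrow> chart_inv c u \<in> dom (G x)"
      using coordinate_nbhd[OF G'(1)[OF x] G'(4)[OF x] G(2)[OF x] c d(1)] d(2) fx by metis
    have "((\<lambda>u. coord d (the (f (chart_inv c u)))) has_derivative D) (at (coord c x))"
      by (rule has_derivative_transform_within_open[OF D(1) N(1,2)]) (simp add: le[OF x N(3)])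
    then have "conformal_at f x \<rho>"
      by (rule conformal_at_if_in_charts[OF o cont x c d]) (rule D(2))
    with \<rho> show ?thesis by blast
  qed
  moreover have "dom f \<subseteq> manifold A" using G(2) G'(2) by blast
  moreover have "ran f \<subseteq> manifold A"
  proof
    fix y assume "y \<in> ran f"
    then obtain x where x: "x \<in> dom f" "f x = Some y" by (auto simp: ran_def)
    then have "G x x = Some y" using le G(2) by simp
    then show "y \<in> manifold A" using G'(3)[OF x(1)] by (auto simp: ran_def)
  qed
  ultimately show ?thesis
    unfolding contact_map_iff using o cont by blast
qed

end


section \<open>Flows of contact Hamiltonian fields are contact maps\<close>

text \<open>The vector \<open>w0\<close> is transversal to the contact distribution on the whole ball. It serves to recover
  the factor \<open>\<rho>\<close> of the Lie derivative as a quotient of continuous functions.\<close>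

locale contact_flow = atlas_form A \<eta> + chart_flow A X c u0 r K h
  for A :: "('m::t2_space, 'e::euclidean_space) chart set" and \<eta> :: "('m, 'e) form1"
    and X :: "('m, 'e) vfield" and c u0 r K h +
  fixes \<rho> :: "'m \<Rightarrow> real" and w0 :: 'e
  assumes lie: "\<And>u v. u \<in> chart_img c \<Longrightarrow>
      lie_deriv (X c) (\<eta> c) u v = \<rho> (chart_inv c u) * \<eta> c u v"
    and w0: "\<And>u. u \<in> cball u0 (2 * r) \<Longrightarrow> \<eta> c u w0 \<noteq> 0"
begin

sublocale form: smooth_form "chart_img c" "\<eta> c"
  by (rule smooth_form[OF c_in_A])

text \<open>For a fixed initial point, \<open>\<eta>\<close> evaluated on a variation \<open>V y v\<close> solves \<open>g' = k g\<close> by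
  \<open>\<L>\<^sub>X \<eta> = \<rho> \<eta>\<close>, with \<open>k\<close> the value of \<open>\<rho>\<close> along the trajectory, which does not depend on \<open>v\<close>.\<close>

lemma \<Phi>_conformal:
  assumes y: "y \<in> cball u0 r" and t: "t \<in> I"
  obtains R where "R \<noteq> 0" "\<And>v. \<eta> c (\<Phi> y t) (V y v t) = R * \<eta> c y v"
proof -
  define k where "k s = lie_deriv (X c) (\<eta> c) (\<Phi> y s) w0 / \<eta> c (\<Phi> y s) w0" for s
  have k: "lie_deriv (X c) (\<eta> c) (\<Phi> y s) v = k s * \<eta> c (\<Phi> y s) v" if "s \<in> I" for s v
    using w0[OF \<Phi>_in_B[OF y that]] by (simp add: k_def lie[OF \<Phi>_img[OF y that]])
  have cont\<Phi>: "continuous_on I (\<Phi> y)"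
    using \<Phi>_deriv[OF y] by (rule continuous_on_of_vector_derivative)
  have "continuous_on I (\<lambda>s. lie_deriv (X c) (\<eta> c) (\<Phi> y s) w0)"
    by (rule continuous_on_compose2[OF form.lie_deriv_cont[OF B_img f_cont Df_cont] cont\<Phi>])
      (use \<Phi>_in_B[OF y] in auto)
  moreover have "continuous_on I (\<lambda>s. \<eta> c (\<Phi> y s) w0)"
    by (rule continuous_on_compose2[OF form.form_cont cont\<Phi>]) (use \<Phi>_img[OF y] in auto)
  ultimately have "continuous_on I k"
    unfolding k_def using w0 \<Phi>_in_B[OF y] by (intro continuous_on_divide) auto
  then obtain R where R: "R \<noteq> 0"
    "\<And>g. (\<And>s. s \<in> I \<Longrightarrow> (g has_vector_derivative k s * g s) (at s within I)) \<Longrightarrow> g t = R * g 0"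
    using scalar_linear_ode[OF _ t h] by metis
  have "\<eta> c (\<Phi> y t) (V y v t) = R * \<eta> c (\<Phi> y 0) (V y v 0)" for v
  proof (rule R(2))
    fix s assume s: "s \<in> I"
    have "((\<lambda>s. \<eta> c (\<Phi> y s) (V y v s)) has_vector_derivative
        lie_deriv (X c) (\<eta> c) (\<Phi> y s) (V y v s)) (at s within I)"
      unfolding lie_deriv_def
      by (rule form.form_along_curve[OF \<Phi>_deriv[OF y s] \<Phi>_img[OF y] V_deriv[OF y s] s])
    then show "((\<lambda>s. \<eta> c (\<Phi> y s) (V y v s)) has_vector_derivative
        k s * \<eta> c (\<Phi> y s) (V y v s)) (at s within I)"
      by (simp add: k[OF s])
  qed
  then show thesis
    using R(1) by (intro that[of R]) (simp_all add: \<Phi>_0[OF y] V_0[OF y])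
qed

lemma contact_map_local_flow:
  assumes t: "t \<in> I"
  defines "U \<equiv> {x \<in> chart_dom c. coord c x \<in> ball u0 r}"
  shows "U \<subseteq> dom (flow A X t) \<and> contact_map A \<eta> (flow A X t |` U)"
proof
  let ?f = "flow A X t |` U"
  have flow: "flow A X t x = Some (chart_inv c (\<Phi> (coord c x) t))" if "x \<in> U" for x
    using flows_to_\<Phi>[of "coord c x" t] t that inv_coord[OF c_in_A]
    by (simp add: flow_eq_Some_iff[OF X_field] U_def)
  then show sub: "U \<subseteq> dom (flow A X t)" by auto
  have dom: "dom ?f = U" using sub by (auto simp: dom_restrict)
  have val: "the (?f x) = chart_inv c (\<Phi> (coord c x) t)" if "x \<in> U" for x
    using flow that by simp
  have U: "open U" "U \<subseteq> chart_dom c"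
    using open_coord_preimage[OF c_in_A open_ball] by (auto simp: U_def)
  have img: "\<Phi> (coord c x) t \<in> chart_img c" if "x \<in> U" for x
    using \<Phi>_img t that by (auto simp: U_def)
  have "continuous_on (ball u0 r) (\<lambda>z. \<Phi> z t)"
    by (rule continuous_at_imp_continuous_on) (use has_derivative_continuous[OF \<Phi>_has_derivative[OF _ t]] in blast)
  then have "continuous_on U (\<lambda>x. \<Phi> (coord c x) t)"
    by (rule continuous_on_compose2[OF _ continuous_on_subset[OF coord_cont[OF c_in_A] U(2)]])
      (auto simp: U_def)
  then have "continuous_on U (\<lambda>x. chart_inv c (\<Phi> (coord c x) t))"
    by (rule continuous_on_compose2[OF inv_cont[OF c_in_A]]) (use img in auto)
  then have cont: "continuous_on (dom ?f) (\<lambda>x. the (?f x))"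
    unfolding dom by (rule continuous_on_eq) (simp add: flow)
  have o: "open (dom ?f)" using U dom by simp
  show "contact_map A \<eta> ?f"
    unfolding contact_map_iff
  proof (intro conjI ballI o cont)
    show "dom ?f \<subseteq> manifold A"
      using U(2) dom_subset_manifold[OF c_in_A] unfolding dom by blast
    show "ran ?f \<subseteq> manifold A"
    proof
      fix z assume "z \<in> ran ?f"
      then obtain x where x: "?f x = Some z" by (auto simp: ran_def)
      then have "x \<in> dom ?f" "the (?f x) = z" by (rule domI, simp)
      then show "z \<in> manifold A"
        unfolding dom using val img inv_in_dom[OF c_in_A] dom_subset_manifold[OF c_in_A] by metis
    qed
    fix x assume "x \<in> dom ?f"
    then have x: "x \<in> U" by (simp add: dom)
    have xc: "x \<in> chart_dom c" using x U by blast
    let ?y = "coord c x"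
    have y: "?y \<in> ball u0 r" using x by (simp add: U_def)
    then have y': "?y \<in> cball u0 r" by simp
    have fx: "coord c (the (?f x)) = \<Phi> ?y t"
      using val[OF x] coord_inv[OF c_in_A img[OF x]] by simp
    obtain R where R: "R \<noteq> 0" "\<And>v. \<eta> c (\<Phi> ?y t) (V ?y v t) = R * \<eta> c ?y v"
      by (rule \<Phi>_conformal[OF y' t]) (rule that)
    have D: "((\<lambda>u. coord c (the (?f (chart_inv c u)))) has_derivative (\<lambda>v. V ?y v t)) (at ?y)"
    proof (rule has_derivative_transform_within_open[OF \<Phi>_has_derivative[OF y t] open_ball y])
      fix u assume u: "u \<in> ball u0 r"
      then have "u \<in> cball u0 r" by simp
      then have ui: "u \<in> chart_img c" using in_B B_img by blast
      then have "chart_inv c u \<in> U"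
        using u inv_in_dom[OF c_in_A] coord_inv[OF c_in_A] by (simp add: U_def)
      then show "\<Phi> u t = coord c (the (?f (chart_inv c u)))"
        using val img[of "chart_inv c u"] coord_inv[OF c_in_A] ui by simp
    qed
    have "the (?f x) \<in> chart_dom c"
      using val[OF x] inv_in_dom[OF c_in_A img[OF x]] by simp
    then have "conformal_at ?f x R"
      by (intro conformal_at_if_in_charts[OF o cont _ c_in_A xc c_in_A _ D]) (use x dom fx R in auto)
    then show "\<exists>\<rho>. \<rho> \<noteq> 0 \<and> conformal_at ?f x \<rho>" using R by blast
  qed
qed

end

locale contact_manifold = atlas_form A \<eta>
  for A :: "('m::t2_space, 'e::euclidean_space) chart set" and \<eta> :: "('m, 'e) form1" +
  assumes form_nonzero: "\<And>c u. c \<in> A \<Longrightarrow> u \<in> chart_img c \<Longrightarrow> \<exists>w. \<eta> c u w \<noteq> 0"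
begin

lemma contact_map_short_flow:
  assumes X: "contact_hamiltonian_field A \<eta> H X" and x: "x \<in> manifold A"
  obtains U e where "open U" "x \<in> U" "0 < e"
    "\<And>t. \<bar>t\<bar> \<le> e \<Longrightarrow> U \<subseteq> dom (flow A X t) \<and> contact_map A \<eta> (flow A X t |` U)"
proof -
  obtain c where c: "c \<in> A" "x \<in> chart_dom c" using in_some_chart[OF x] by blast
  let ?u0 = "coord c x"
  interpret form: smooth_form "chart_img c" "\<eta> c" by (rule smooth_form[OF c(1)])
  obtain \<rho> where field: "vector_field A X"
    and \<rho>: "\<And>u v. u \<in> chart_img c \<Longrightarrow> lie_deriv (X c) (\<eta> c) u v = \<rho> (chart_inv c u) * \<eta> c u v"
    using X c(1) unfolding contact_hamiltonian_field_def by blast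
  obtain w0 where w0: "\<eta> c ?u0 w0 \<noteq> 0"
    using form_nonzero[OF c(1) coord_in_img[OF c]] by blast
  define W where "W = {u \<in> chart_img c. \<eta> c u w0 \<noteq> 0}"
  have "W = chart_img c \<inter> (\<lambda>u. \<eta> c u w0) -` (- {0})" by (auto simp: W_def)
  then have "open W"
    using continuous_open_preimage[OF form.form_cont form.open_W open_Compl[OF closed_singleton]] by simp
  then obtain r K h where fl: "chart_flow A X c ?u0 r K h" and rW: "cball ?u0 (2 * r) \<subseteq> W"
    using chart_flow_exists[OF field c(1), of W ?u0] coord_in_img[OF c] w0
    by (auto simp: W_def)
  interpret chart_flow A X c ?u0 r K h by (rule fl)
  interpret contact_flow A \<eta> X c ?u0 r K h \<rho> w0
    by unfold_locales (use \<rho> rW in \<open>auto simp: W_def\<close>)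
  let ?U = "{x \<in> chart_dom c. coord c x \<in> ball ?u0 r}"
  show thesis
  proof (rule that[of ?U h])
    show "open ?U" by (rule open_coord_preimage[OF c(1) open_ball])
    show "x \<in> ?U" using c r by simp
    show "0 < h" by (rule h)
    show "?U \<subseteq> dom (flow A X t) \<and> contact_map A \<eta> (flow A X t |` ?U)" if "\<bar>t\<bar> \<le> h" for t
      by (rule contact_map_local_flow) (use that in auto)
  qed
qed

lemma flows_to_restrict:
  assumes "integral_curve A X (closed_segment 0 t) g" "s \<in> closed_segment 0 t"
  shows "flows_to A X s (g 0) (g s)"
proof -
  have sub: "closed_segment 0 s \<subseteq> closed_segment 0 t"
    using assms(2) by (simp add: closed_segment_subset)
  have "integral_curve A X (closed_segment 0 s) g"
    unfolding integral_curve_def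
  proof (intro conjI ballI impI)
    show "continuous_on (closed_segment 0 s) g" "g ` closed_segment 0 s \<subseteq> manifold A"
      using assms(1) sub by (auto simp: integral_curve_def intro: continuous_on_subset)
    fix r c assume "r \<in> closed_segment 0 s" "c \<in> A" "g r \<in> chart_dom c"
    then show "((\<lambda>s. coord c (g s)) has_vector_derivative X c (coord c (g r))) (at r within closed_segment 0 s)"
      using assms(1) sub unfolding integral_curve_def
      by (intro has_vector_derivative_within_subset[OF _ sub]) auto
  qed
  then show ?thesis by (auto simp: flows_to_def)
qed

text \<open>The integral curve from \<open>x\<close> is compact, so finitely many of the open sets on which short-time flows
  are contact maps cover it. With a time step below their common time span, the composition of the
  short-time flows along the curve is a contact map that is defined at \<open>x\<close> and is a restriction of
  the flow map.\<close>

lemma contact_map_flow: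
  assumes X: "contact_hamiltonian_field A \<eta> H X"
  shows "contact_map A \<eta> (flow A X t)"
proof (rule contact_map_if_locally)
  have field: "vector_field A X" using X by (simp add: contact_hamiltonian_field_def)
  note flow_iff = flow_eq_Some_iff[OF field]
  fix x assume "x \<in> dom (flow A X t)"
  then obtain \<gamma> where \<gamma>: "integral_curve A X (closed_segment 0 t) \<gamma>" "\<gamma> 0 = x"
    by (auto simp: flow_iff flows_to_def)
  let ?I = "closed_segment 0 t"
  have M: "\<gamma> s \<in> manifold A" if "s \<in> ?I" for s
    using \<gamma>(1) that by (auto simp: integral_curve_def)
  let ?good = "\<lambda>U e. open U \<and> 0 < e \<and>
      (\<forall>t. \<bar>t\<bar> \<le> e \<longrightarrow> U \<subseteq> dom (flow A X t) \<and> contact_map A \<eta> (flow A X t |` U))"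
  have "\<exists>U e. \<gamma> s \<in> U \<and> ?good U e" if "s \<in> ?I" for s
    using contact_map_short_flow[OF X M[OF that]] by metis
  then obtain U e where Ue: "\<And>s. s \<in> ?I \<Longrightarrow> \<gamma> s \<in> U s" "\<And>s. s \<in> ?I \<Longrightarrow> ?good (U s) (e s)"
    by metis
  have "compact (\<gamma> ` ?I)"
    using \<gamma>(1) by (intro compact_continuous_image) (auto simp: integral_curve_def)
  then obtain J where J: "J \<subseteq> ?I" "finite J" "\<gamma> ` ?I \<subseteq> (\<Union>s\<in>J. U s)"
    by (rule compactE_image[of _ ?I U]) (use Ue in auto)
  have "J \<noteq> {}" using J(3) by auto
  define e0 where "e0 = Min (e ` J)"
  have e0: "0 < e0" "\<And>s. s \<in> J \<Longrightarrow> e0 \<le> e s"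
    using J Ue(2) \<open>J \<noteq> {}\<close> by (auto simp: e0_def)
  obtain N :: nat where N: "\<bar>t\<bar> / e0 < real N" using reals_Archimedean2 by blast
  then have N0: "0 < N" using e0(1) by (intro gr0I) (auto simp: divide_less_0_iff)
  define \<delta> where "\<delta> = t / N"
  have \<delta>: "\<bar>\<delta>\<bar> \<le> e0" "real N * \<delta> = t"
    using N N0 e0(1) by (auto simp: \<delta>_def field_simps)
  have time: "real j * \<delta> \<in> ?I" if "j \<le> N" for j
  proof -
    have "real j * \<delta> = (real j / real N) * t" by (simp add: \<delta>_def)
    then show ?thesis
      using that N0 unfolding closed_segment_def by (auto intro!: exI[of _ "real j / real N"])
  qed
  \<comment> \<open>The curve point at each time step lies in one of the finitely many sets.\<close>
  have step: "\<exists>s\<in>J. \<gamma> (real j * \<delta>) \<in> U s" if "j \<le> N" for j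
    using J(3) time[OF that] by blast
  have "\<exists>g. contact_map A \<eta> g \<and> g x = Some (\<gamma> (real j * \<delta>)) \<and> g \<subseteq>\<^sub>m flow A X (real j * \<delta>)"
    if "j \<le> N" for j
    using that
  proof (induction j)
    case 0
    obtain s where s: "s \<in> J" "x \<in> U s" using step[of 0] \<gamma>(2) by auto
    have "s \<in> ?I" using J s by blast
    then have "contact_map A \<eta> (flow A X 0 |` U s)" using Ue(2)[of s] by auto
    moreover have "flow A X 0 x = Some x"
      using flows_to_restrict[OF \<gamma>(1), of 0] \<gamma>(2) by (simp add: flow_iff)
    ultimately show ?case
      using s \<gamma>(2) by (intro exI[of _ "flow A X 0 |` U s"]) (auto simp: map_le_def)
  next
    case (Suc j)
    then obtain g where g: "contact_map A \<eta> g" "g x = Some (\<gamma> (real j * \<delta>))"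
      "g \<subseteq>\<^sub>m flow A X (real j * \<delta>)" by auto
    obtain s where s: "s \<in> J" "\<gamma> (real j * \<delta>) \<in> U s" using step[of j] Suc by auto
    have "s \<in> ?I" using J s by blast
    then have f: "U s \<subseteq> dom (flow A X \<delta>)" "contact_map A \<eta> (flow A X \<delta> |` U s)"
      using Ue(2)[of s] \<delta>(1) e0(2)[OF s(1)] by auto
    have add: "flow A X (real (Suc j) * \<delta>) a = Some c"
      if "flow A X (real j * \<delta>) a = Some b" "flow A X \<delta> b = Some c" for a b c
    proof -
      have "0 \<le> real j * \<delta> * \<delta>" by (simp add: mult.assoc)
      from flows_to_add[OF _ _ this] that show ?thesis
        by (simp add: flow_iff algebra_simps)
    qed
    let ?g = "(flow A X \<delta> |` U s) \<circ>\<^sub>m g"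
    have le: "?g \<subseteq>\<^sub>m flow A X (real (Suc j) * \<delta>)"
      unfolding map_le_def
    proof
      fix a assume a: "a \<in> dom ?g"
      then obtain b c where "g a = Some b" "b \<in> U s" "flow A X \<delta> b = Some c" "?g a = Some c"
        by (auto simp: map_comp_def restrict_map_def split: option.splits if_splits)
      moreover from this have "flow A X (real j * \<delta>) a = Some b"
        using g(3) by (auto simp: map_le_def dom_def)
      ultimately show "?g a = flow A X (real (Suc j) * \<delta>) a"
        using add by simp
    qed
    obtain z where z: "flow A X \<delta> (\<gamma> (real j * \<delta>)) = Some z" using f(1) s(2) by blast
    then have gx: "?g x = Some z" using g(2) s(2) by (simp add: map_comp_def)
    then have "flow A X (real (Suc j) * \<delta>) x = Some z" using le by (auto simp: map_le_def dom_def)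
    moreover have "flow A X (real (Suc j) * \<delta>) x = Some (\<gamma> (real (Suc j) * \<delta>))"
      using flows_to_restrict[OF \<gamma>(1) time[OF Suc.prems]] \<gamma>(2) by (simp add: flow_iff)
    ultimately have "z = \<gamma> (real (Suc j) * \<delta>)" by simp
    then show ?case
      using contact_map_comp[OF g(1) f(2)] gx le by blast
  qed
  from this[of N] show "\<exists>g. contact_map A \<eta> g \<and> x \<in> dom g \<and> g \<subseteq>\<^sub>m flow A X t"
    by (auto simp: \<delta>(2))
qed

text \<open>The list has to be nonempty, since \<open>Some\<close> is defined on the whole type of points and not only on
  the manifold.\<close>

lemma contact_map_foldr:
  assumes "fs \<noteq> []" "\<And>f. f \<in> set fs \<Longrightarrow> contact_map A \<eta> f"
  shows "contact_map A \<eta> (foldr (\<circ>\<^sub>m) fs Some)"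
  using assms
proof (induction fs)
  case (Cons f fs)
  show ?case
  proof (cases "fs = []")
    case True
    then show ?thesis using Cons.prems by (simp add: map_comp_def)
  next
    case False
    then show ?thesis using Cons by (simp add: contact_map_comp)
  qed
qed simp

end


section \<open>Second order expansions of compositions of flows\<close>

lemma map_comp_assoc: "(f \<circ>\<^sub>m g) \<circ>\<^sub>m h = f \<circ>\<^sub>m (g \<circ>\<^sub>m h)"
  by (auto simp: map_comp_def fun_eq_iff split: option.splits)

lemma map_comp_Some: "f \<circ>\<^sub>m Some = f" "Some \<circ>\<^sub>m f = f"
  by (auto simp: map_comp_def fun_eq_iff split: option.splits)

lemma foldr_map_comp_snoc: "foldr (\<circ>\<^sub>m) (fs @ [f]) Some = foldr (\<circ>\<^sub>m) fs Some \<circ>\<^sub>m f"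
  by (induction fs) (simp_all add: map_comp_assoc map_comp_Some)

text \<open>Curves \<open>x + \<tau> a + \<tau>\<^sup>2 b + O(\<tau>\<^sup>3)\<close> in the coordinates of \<open>c\<close>. They are partial because flows are, and
  they need only be defined for small nonzero \<open>\<tau>\<close>.\<close>

definition jet_curve ::
  "('m, 'e::euclidean_space) chart \<Rightarrow> 'm \<Rightarrow> 'e \<Rightarrow> 'e \<Rightarrow> (real \<Rightarrow> 'm option) \<Rightarrow> bool" where
  "jet_curve c x a b p \<longleftrightarrow>
     (\<exists>C. \<forall>\<^sub>F \<tau> in at 0. \<exists>y. p \<tau> = Some y \<and> y \<in> chart_dom c \<and>
        norm (coord c y - (coord c x + \<tau> *\<^sub>R a + \<tau>\<^sup>2 *\<^sub>R b)) \<le> C * \<bar>\<tau>\<bar> ^ 3)"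

text \<open>The expansion to second order of a family of maps near \<open>x\<close>, given by its action on curves: it adds
  \<open>\<tau> f + \<tau>\<^sup>2 g\<close>, and moving its argument by \<open>\<tau> a\<close> contributes \<open>\<tau>\<^sup>2 L a\<close> to the result. Expansions in
  this sense can be composed without any regularity in \<open>\<tau>\<close>.\<close>

definition jet_map ::
  "('m, 'e::euclidean_space) chart \<Rightarrow> 'm \<Rightarrow> 'e \<Rightarrow> ('e \<Rightarrow> 'e) \<Rightarrow> 'e \<Rightarrow> (real \<Rightarrow> 'm \<rightharpoonup> 'm) \<Rightarrow> bool" where
  "jet_map c x f L g G \<longleftrightarrow> linear L \<and>
     (\<forall>p a b. jet_curve c x a b p \<longrightarrow>
        jet_curve c x (a + f) (b + L a + g) (\<lambda>\<tau>. Option.bind (p \<tau>) (G \<tau>)))"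

lemma jet_map_at_base_point:
  assumes G: "jet_map c x f L g G" and x: "x \<in> chart_dom c"
  shows "jet_curve c x f g (\<lambda>\<tau>. G \<tau> x)"
proof -
  have "jet_curve c x 0 0 (\<lambda>_. Some x)"
    unfolding jet_curve_def by (rule exI[of _ 0]) (simp add: x)
  then have "jet_curve c x (0 + f) (0 + L 0 + g) (\<lambda>\<tau>. Option.bind (Some x) (G \<tau>))"
    using G unfolding jet_map_def by blast
  moreover have "L 0 = 0"
    using G unfolding jet_map_def by (blast intro: linear_0)
  ultimately show ?thesis by simp
qed

lemma jet_map_comp:
  assumes "jet_map c x f1 L1 g1 G1" "jet_map c x f2 L2 g2 G2"
  shows "jet_map c x (f1 + f2) (\<lambda>v. L1 v + L2 v) (g1 + g2 + L2 f1) (\<lambda>\<tau>. G2 \<tau> \<circ>\<^sub>m G1 \<tau>)"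
  unfolding jet_map_def
proof (intro conjI allI impI)
  have L: "linear L1" "linear L2" using assms by (auto simp: jet_map_def)
  then show "linear (\<lambda>v. L1 v + L2 v)" by (rule linear_compose_add)
  fix p a b assume "jet_curve c x a b p"
  then have "jet_curve c x (a + f1 + f2) (b + L1 a + g1 + L2 (a + f1) + g2)
      (\<lambda>\<tau>. Option.bind (Option.bind (p \<tau>) (G1 \<tau>)) (G2 \<tau>))"
    using assms unfolding jet_map_def by blast
  moreover have "Option.bind (Option.bind (p \<tau>) (G1 \<tau>)) (G2 \<tau>) = Option.bind (p \<tau>) (G2 \<tau> \<circ>\<^sub>m G1 \<tau>)" for \<tau>
    by (auto simp: map_comp_def Option.bind_eq_None_conv split: Option.bind_splits option.splits)
  ultimately show "jet_curve c x (a + (f1 + f2)) (b + (L1 a + L2 a) + (g1 + g2 + L2 f1))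
      (\<lambda>\<tau>. Option.bind (p \<tau>) (G2 \<tau> \<circ>\<^sub>m G1 \<tau>))"
    by (simp add: linear_add[OF L(2)] algebra_simps)
qed

text \<open>The heart of the order computation. The flow of a field with value \<open>f\<close> and derivative \<open>D\<close> at \<open>x\<close>
  has the quadratic coefficient \<open>1/2 D f\<close>, and \<open>1/8 D f\<close> for half the time. In the symmetric
  composition the quadratic coefficient again has the form \<open>1/2 (D + L) (f + F)\<close>, as though the
  composition were the flow of the sum of the fields. The mixed terms \<open>D F\<close> and \<open>L f\<close> both get the
  coefficient \<open>1/2\<close>: \<open>D F\<close> from the half step taken last and \<open>L f\<close> from the one taken first. A composition
  that is not symmetric would favour one of them.\<close>

lemma jet_map_sandwich:
  assumes E: "jet_map c x ((1/2) *\<^sub>R f) (\<lambda>v. (1/2) *\<^sub>R D v) ((1/8) *\<^sub>R D f) E"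
    and G: "jet_map c x F L ((1/2) *\<^sub>R L F) G" and D: "linear D"
  shows "jet_map c x (f + F) (\<lambda>v. D v + L v) ((1/2) *\<^sub>R (D (f + F) + L (f + F)))
    (\<lambda>\<tau>. E \<tau> \<circ>\<^sub>m (G \<tau> \<circ>\<^sub>m E \<tau>))"
proof -
  have L: "linear L" using G by (simp add: jet_map_def)
  have half: "(1/2) *\<^sub>R y + (1/2) *\<^sub>R y = y" for y :: 'b
    by (simp add: scaleR_add_left[symmetric])
  have f: "(1/2) *\<^sub>R f + F + (1/2) *\<^sub>R f = f + F"
    using half[of f] by (simp add: algebra_simps)
  have lin: "(1/2) *\<^sub>R D v + L v + (1/2) *\<^sub>R D v = D v + L v" for v
    using half[of "D v"] by (simp add: algebra_simps)
  have eighth: "(1/8) *\<^sub>R D f + (1/8) *\<^sub>R D f + (1/4) *\<^sub>R D f = (1/2) *\<^sub>R D f"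
    by (simp add: scaleR_add_left[symmetric])
  have "(1/8) *\<^sub>R D f + (1/2) *\<^sub>R L F + L ((1/2) *\<^sub>R f) + (1/8) *\<^sub>R D f +
      (1/2) *\<^sub>R D ((1/2) *\<^sub>R f + F) =
    ((1/8) *\<^sub>R D f + (1/8) *\<^sub>R D f + (1/4) *\<^sub>R D f) + (1/2) *\<^sub>R D F + (1/2) *\<^sub>R L f + (1/2) *\<^sub>R L F"
    by (simp add: linear_add[OF D] linear_cmul[OF D] linear_cmul[OF L] scaleR_add_right)
  also have "\<dots> = (1/2) *\<^sub>R (D (f + F) + L (f + F))"
    unfolding eighth by (simp add: linear_add[OF D] linear_add[OF L] scaleR_add_right)
  finally show ?thesis
    using jet_map_comp[OF jet_map_comp[OF E G] E] by (simp add: f lin)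
qed

text \<open>Induction from the middle of the palindrome outwards, with \<open>jet_map_sandwich\<close> as the step.\<close>

lemma jet_map_palindrome:
  assumes E: "\<And>j. j \<in> set js \<Longrightarrow> jet_map c x ((1/2) *\<^sub>R f j) (\<lambda>v. (1/2) *\<^sub>R D j v) ((1/8) *\<^sub>R D j (f j)) (E j)"
    and D: "\<And>j. j \<in> set js \<Longrightarrow> linear (D j)"
    and G: "jet_map c x F L ((1/2) *\<^sub>R L F) G"
  defines "F' \<equiv> \<lambda>js. (\<Sum>j\<leftarrow>js. f j) + F"
    and "L' \<equiv> \<lambda>js v. (\<Sum>j\<leftarrow>js. D j v) + L v"
  shows "jet_map c x (F' js) (L' js) ((1/2) *\<^sub>R L' js (F' js))
    (\<lambda>\<tau>. foldr (\<circ>\<^sub>m) (map (\<lambda>j. E j \<tau>) js @ [G \<tau>] @ map (\<lambda>j. E j \<tau>) (rev js)) Some)"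
  using E D
proof (induction js)
  case Nil
  then show ?case using G by (simp add: F'_def L'_def map_comp_Some)
next
  case (Cons j js)
  let ?M = "\<lambda>\<tau>. foldr (\<circ>\<^sub>m) (map (\<lambda>j. E j \<tau>) js @ [G \<tau>] @ map (\<lambda>j. E j \<tau>) (rev js)) Some"
  have "jet_map c x (f j + F' js) (\<lambda>v. D j v + L' js v)
      ((1/2) *\<^sub>R (D j (f j + F' js) + L' js (f j + F' js))) (\<lambda>\<tau>. E j \<tau> \<circ>\<^sub>m (?M \<tau> \<circ>\<^sub>m E j \<tau>))"
    by (rule jet_map_sandwich[OF _ Cons.IH]) (use Cons.prems in auto)
  moreover have "f j + F' js = F' (j # js)" "D j v + L' js v = L' (j # js) v" for v
    by (simp_all add: F'_def L'_def algebra_simps)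
  moreover have "E j \<tau> \<circ>\<^sub>m (?M \<tau> \<circ>\<^sub>m E j \<tau>) =
      foldr (\<circ>\<^sub>m) (map (\<lambda>j. E j \<tau>) (j # js) @ [G \<tau>] @ map (\<lambda>j. E j \<tau>) (rev (j # js))) Some" for \<tau>
    using foldr_map_comp_snoc[of "map (\<lambda>j. E j \<tau>) js @ [G \<tau>] @ map (\<lambda>j. E j \<tau>) (rev js)" "E j \<tau>"]
    by simp
  ultimately show ?case by simp
qed

lemma jet_curves_agree:
  assumes "jet_curve c x a b p" "jet_curve c x a b q"
  shows "\<forall>\<^sub>F \<tau> in at 0. \<exists>y\<in>chart_dom c. \<exists>z\<in>chart_dom c. p \<tau> = Some y \<and> q \<tau> = Some z"
    and "(\<lambda>\<tau>. norm (coord c (the (p \<tau>)) - coord c (the (q \<tau>)))) \<in> O[at 0](\<lambda>\<tau>. \<tau> ^ 3)"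
proof -
  let ?T = "\<lambda>\<tau>. coord c x + \<tau> *\<^sub>R a + \<tau>\<^sup>2 *\<^sub>R b"
  obtain C C' where
    p: "\<forall>\<^sub>F \<tau> in at 0. \<exists>y. p \<tau> = Some y \<and> y \<in> chart_dom c \<and> norm (coord c y - ?T \<tau>) \<le> C * \<bar>\<tau>\<bar> ^ 3"
    and q: "\<forall>\<^sub>F \<tau> in at 0. \<exists>y. q \<tau> = Some y \<and> y \<in> chart_dom c \<and> norm (coord c y - ?T \<tau>) \<le> C' * \<bar>\<tau>\<bar> ^ 3"
    using assms unfolding jet_curve_def by blast
  show "\<forall>\<^sub>F \<tau> in at 0. \<exists>y\<in>chart_dom c. \<exists>z\<in>chart_dom c. p \<tau> = Some y \<and> q \<tau> = Some z"
    using p q by eventually_elim blast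
  show "(\<lambda>\<tau>. norm (coord c (the (p \<tau>)) - coord c (the (q \<tau>)))) \<in> O[at 0](\<lambda>\<tau>. \<tau> ^ 3)"
  proof (rule bigoI[of _ "C + C'"])
    show "\<forall>\<^sub>F \<tau> in at 0. norm (norm (coord c (the (p \<tau>)) - coord c (the (q \<tau>)))) \<le> (C + C') * norm (\<tau> ^ 3)"
      using p q
    proof eventually_elim
      case (elim \<tau>)
      then obtain y z where y: "p \<tau> = Some y" "norm (coord c y - ?T \<tau>) \<le> C * \<bar>\<tau>\<bar> ^ 3"
        and z: "q \<tau> = Some z" "norm (coord c z - ?T \<tau>) \<le> C' * \<bar>\<tau>\<bar> ^ 3"
        by blast
      have "norm (coord c y - coord c z) \<le> norm (coord c y - ?T \<tau>) + norm (coord c z - ?T \<tau>)"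
        using norm_triangle_ineq4[of "coord c y - ?T \<tau>" "coord c z - ?T \<tau>"] by simp
      also have "\<dots> \<le> (C + C') * \<bar>\<tau>\<bar> ^ 3"
        using y z by (simp add: distrib_right)
      finally show ?case using y z by (simp add: power_abs)
    qed
  qed
qed

context atlas
begin

text \<open>This combines the Taylor formula in time with that of the field in space. The family runs at the
  speed \<open>\<kappa>\<close>, since the factors of the integrator are flows for the times \<open>\<tau>/2\<close> and \<open>\<tau>\<close>.\<close>

lemma jet_map_flow:
  assumes X: "vector_field A X" and c: "c \<in> A" "x \<in> chart_dom c"
  defines "f \<equiv> X c (coord c x)" and "L \<equiv> Dat (X c) (coord c x)"
  shows "jet_map c x (\<kappa> *\<^sub>R f) (\<lambda>v. \<kappa> *\<^sub>R L v) ((\<kappa>\<^sup>2 / 2) *\<^sub>R L f) (\<lambda>\<tau>. flow A X (\<kappa> * \<tau>))"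
  unfolding jet_map_def
proof (intro conjI allI impI)
  let ?u = "coord c x"
  obtain r K h where fl: "chart_flow A X c ?u r K h"
    using chart_flow_exists[OF X c(1) open_chart_img[OF c(1)] coord_in_img[OF c] subset_refl] .
  interpret chart_flow A X c ?u r K h by (rule fl)
  have u: "?u \<in> cball ?u (2 * r)" using r by simp
  have lin: "linear L" unfolding L_def by (rule linear_Dat[OF f_diff[OF u]])
  then show "linear (\<lambda>v. \<kappa> *\<^sub>R L v)" by (rule linear_compose_scale_right)
  fix p a b assume "jet_curve c x a b p"
  then obtain C0 where
    C0: "\<forall>\<^sub>F \<tau> in at 0. \<exists>y. p \<tau> = Some y \<and> y \<in> chart_dom c \<and>
        norm (coord c y - (?u + \<tau> *\<^sub>R a + \<tau>\<^sup>2 *\<^sub>R b)) \<le> C0 * \<bar>\<tau>\<bar> ^ 3"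
    unfolding jet_curve_def by blast
  \<comment> \<open>\<open>M\<close> bounds the displacement of the curve divided by \<open>\<tau>\<close>, and \<open>C'\<close> collects the constants of the
    five remainders \<open>?R1, \<dots>, ?R5\<close> below.\<close>
  define C where "C = max 0 C0"
  define M where "M = norm a + norm b + C"
  define C' where "C' = 2 * K ^ 3 * \<bar>\<kappa>\<bar> ^ 3 + C + \<bar>\<kappa>\<bar> * K * M\<^sup>2 + \<bar>\<kappa>\<bar> * K * M + \<kappa>\<^sup>2 * K\<^sup>2 * M"
  have C: "0 \<le> C" "C0 \<le> C" by (auto simp: C_def)
  have M: "0 \<le> M" using C by (simp add: M_def)
  have Mpos: "0 < M + 1" and \<kappa>pos: "0 < \<bar>\<kappa>\<bar> + 1" using M by auto
  have small: "\<forall>\<^sub>F \<tau> in at (0::real). \<bar>\<tau>\<bar> < e" if "0 < e" for e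
    using that by (auto simp: eventually_at dist_norm)
  have "\<forall>\<^sub>F \<tau> in at 0. \<exists>z. Option.bind (p \<tau>) (flow A X (\<kappa> * \<tau>)) = Some z \<and> z \<in> chart_dom c \<and>
      norm (coord c z - (?u + \<tau> *\<^sub>R (a + \<kappa> *\<^sub>R f) + \<tau>\<^sup>2 *\<^sub>R (b + \<kappa> *\<^sub>R L a + (\<kappa>\<^sup>2 / 2) *\<^sub>R L f)))
        \<le> C' * \<bar>\<tau>\<bar> ^ 3"
    using C0 small[OF zero_less_one] small[OF divide_pos_pos[OF r Mpos]] small[OF divide_pos_pos[OF h \<kappa>pos]]
  proof eventually_elim
    case (elim \<tau>)
    then obtain x' where x': "p \<tau> = Some x'" "x' \<in> chart_dom c"
      and le0: "norm (coord c x' - (?u + \<tau> *\<^sub>R a + \<tau>\<^sup>2 *\<^sub>R b)) \<le> C0 * \<bar>\<tau>\<bar> ^ 3"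
      by blast
    have \<tau>: "\<bar>\<tau>\<bar> < 1" "\<bar>\<tau>\<bar> < r / (M + 1)" "\<bar>\<tau>\<bar> < h / (\<bar>\<kappa>\<bar> + 1)" using elim by auto
    let ?t = "\<kappa> * \<tau>"
    define y where "y = coord c x'"
    have "C0 * \<bar>\<tau>\<bar> ^ 3 \<le> C * \<bar>\<tau>\<bar> ^ 3" using C by (intro mult_right_mono) auto
    then have e2: "norm (y - (?u + \<tau> *\<^sub>R a + \<tau>\<^sup>2 *\<^sub>R b)) \<le> C * \<bar>\<tau>\<bar> ^ 3"
      using le0 unfolding y_def by linarith
    have \<tau>p: "\<bar>\<tau>\<bar> ^ 3 \<le> \<bar>\<tau>\<bar>\<^sup>2" "\<bar>\<tau>\<bar>\<^sup>2 \<le> \<bar>\<tau>\<bar>"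
      using \<tau>(1) power_decreasing[of 2 3 "\<bar>\<tau>\<bar>"] power_decreasing[of 1 2 "\<bar>\<tau>\<bar>"] by auto
    have y1: "norm (y - ?u - \<tau> *\<^sub>R a) \<le> (norm b + C) * \<bar>\<tau>\<bar>\<^sup>2"
    proof -
      have "y - ?u - \<tau> *\<^sub>R a = \<tau>\<^sup>2 *\<^sub>R b + (y - (?u + \<tau> *\<^sub>R a + \<tau>\<^sup>2 *\<^sub>R b))" by simp
      also have "norm \<dots> \<le> \<bar>\<tau>\<bar>\<^sup>2 * norm b + C * \<bar>\<tau>\<bar>\<^sup>2"
        using e2 mult_left_mono[OF \<tau>p(1) C(1)] by (intro norm_triangle_mono) auto
      finally show ?thesis by (simp add: algebra_simps)
    qed
    also have "\<dots> \<le> M * \<bar>\<tau>\<bar>\<^sup>2"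
      by (intro mult_right_mono) (auto simp: M_def)
    finally have y2: "norm (y - ?u - \<tau> *\<^sub>R a) \<le> M * \<bar>\<tau>\<bar>\<^sup>2" .
    have y3: "norm (y - ?u) \<le> M * \<bar>\<tau>\<bar>"
    proof -
      have "y - ?u = \<tau> *\<^sub>R a + (y - ?u - \<tau> *\<^sub>R a)" by simp
      also have "norm \<dots> \<le> \<bar>\<tau>\<bar> * norm a + (norm b + C) * \<bar>\<tau>\<bar>"
        using y1 mult_left_mono[OF \<tau>p(2), of "norm b + C"] C by (intro norm_triangle_mono) auto
      finally show ?thesis by (simp add: M_def algebra_simps)
    qed
    also have "\<dots> \<le> (M + 1) * \<bar>\<tau>\<bar>" by (simp add: algebra_simps)
    also have "\<dots> < r" using \<tau>(2) M by (simp add: field_simps)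
    finally have y: "y \<in> cball ?u r" by (simp add: dist_norm norm_minus_commute)
    have "\<bar>?t\<bar> \<le> (\<bar>\<kappa>\<bar> + 1) * \<bar>\<tau>\<bar>" by (simp add: abs_mult algebra_simps)
    also have "\<dots> < h" using \<tau>(3) by (simp add: field_simps)
    finally have t: "?t \<in> I" by auto
    have B: "y \<in> B" by (rule in_B[OF y])
    let ?z = "chart_inv c (\<Phi> y ?t)"
    have flow: "Option.bind (p \<tau>) (flow A X ?t) = Some ?z"
      using flows_to_\<Phi>[OF y t] inv_coord[OF c(1) x'(2)] x'(1)
      by (simp add: flow_eq_Some_iff[OF X] y_def)
    have z: "?z \<in> chart_dom c" "coord c ?z = \<Phi> y ?t"
      using \<Phi>_img[OF y t] inv_in_dom[OF c(1)] coord_inv[OF c(1)] by auto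
    \<comment> \<open>The deviation from the claimed expansion is the sum of the remainders of the flow in time, of
      the given curve, of the field around \<open>x\<close>, of the curve inside \<open>L\<close>, and of the acceleration.\<close>
    let ?R1 = "\<Phi> y ?t - y - ?t *\<^sub>R X c y - (?t\<^sup>2 / 2) *\<^sub>R Dat (X c) y (X c y)"
    let ?R2 = "y - (?u + \<tau> *\<^sub>R a + \<tau>\<^sup>2 *\<^sub>R b)"
    let ?R3 = "?t *\<^sub>R (X c y - f - L (y - ?u))"
    let ?R4 = "?t *\<^sub>R L (y - ?u - \<tau> *\<^sub>R a)"
    let ?R5 = "(?t\<^sup>2 / 2) *\<^sub>R (Dat (X c) y (X c y) - L f)"
    have R1: "norm ?R1 \<le> 2 * K ^ 3 * \<bar>\<kappa>\<bar> ^ 3 * \<bar>\<tau>\<bar> ^ 3"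
      using \<Phi>_taylor[OF y t] by (simp add: abs_mult power_mult_distrib mult_ac)
    have "norm (X c y - f - L (y - ?u)) \<le> K * (norm (y - ?u))\<^sup>2"
      unfolding f_def L_def using C11 B u K by (intro C11_on_taylor) auto
    also have "\<dots> \<le> K * (M * \<bar>\<tau>\<bar>)\<^sup>2"
      using K y3 by (intro mult_left_mono power_mono) auto
    finally have "norm ?R3 \<le> \<bar>?t\<bar> * (K * (M * \<bar>\<tau>\<bar>)\<^sup>2)"
      unfolding norm_scaleR by (intro mult_left_mono) auto
    then have R3: "norm ?R3 \<le> \<bar>\<kappa>\<bar> * K * M\<^sup>2 * \<bar>\<tau>\<bar> ^ 3"
      by (simp add: abs_mult power_mult_distrib power2_eq_square power3_eq_cube mult_ac)
    have "norm (L (y - ?u - \<tau> *\<^sub>R a)) \<le> K * norm (y - ?u - \<tau> *\<^sub>R a)"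
      unfolding L_def by (rule Df_bound[OF u])
    also have "\<dots> \<le> K * (M * \<bar>\<tau>\<bar>\<^sup>2)"
      using K y2 by (intro mult_left_mono) auto
    finally have "norm ?R4 \<le> \<bar>?t\<bar> * (K * (M * \<bar>\<tau>\<bar>\<^sup>2))"
      unfolding norm_scaleR by (intro mult_left_mono) auto
    then have R4: "norm ?R4 \<le> \<bar>\<kappa>\<bar> * K * M * \<bar>\<tau>\<bar> ^ 3"
      by (simp add: abs_mult power2_eq_square power3_eq_cube mult_ac)
    have "norm (Dat (X c) y (X c y) - L f) \<le> 2 * K\<^sup>2 * norm (y - ?u)"
      unfolding L_def f_def by (rule Df_f_lip[OF B u])
    also have "\<dots> \<le> 2 * K\<^sup>2 * (M * \<bar>\<tau>\<bar>)"
      using y3 by (intro mult_left_mono) auto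
    finally have "norm ?R5 \<le> \<bar>?t\<^sup>2 / 2\<bar> * (2 * K\<^sup>2 * (M * \<bar>\<tau>\<bar>))"
      unfolding norm_scaleR by (intro mult_left_mono) auto
    also have "\<dots> = \<kappa>\<^sup>2 * K\<^sup>2 * M * \<bar>\<tau>\<bar> ^ 3"
    proof -
      have "\<bar>?t\<^sup>2 / 2\<bar> = \<kappa>\<^sup>2 * \<bar>\<tau>\<bar>\<^sup>2 / 2"
        by (simp add: power_mult_distrib)
      moreover have "(k * m\<^sup>2 / 2) * (2 * l * (M * m)) = k * l * M * m ^ 3" for k l m :: real
        by (simp add: power3_eq_cube power2_eq_square)
      ultimately show ?thesis by (simp only:)
    qed
    finally have R5: "norm ?R5 \<le> \<kappa>\<^sup>2 * K\<^sup>2 * M * \<bar>\<tau>\<bar> ^ 3" .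
    have "coord c ?z - (?u + \<tau> *\<^sub>R (a + \<kappa> *\<^sub>R f) + \<tau>\<^sup>2 *\<^sub>R (b + \<kappa> *\<^sub>R L a + (\<kappa>\<^sup>2 / 2) *\<^sub>R L f)) =
        ?R1 + ?R2 + ?R3 + ?R4 + ?R5"
      by (simp add: z(2) linear_add[OF lin] linear_diff[OF lin] linear_cmul[OF lin] algebra_simps power_mult_distrib
          power2_eq_square)
    also have "norm \<dots> \<le> 2 * K ^ 3 * \<bar>\<kappa>\<bar> ^ 3 * \<bar>\<tau>\<bar> ^ 3 + C * \<bar>\<tau>\<bar> ^ 3 + \<bar>\<kappa>\<bar> * K * M\<^sup>2 * \<bar>\<tau>\<bar> ^ 3 +
        \<bar>\<kappa>\<bar> * K * M * \<bar>\<tau>\<bar> ^ 3 + \<kappa>\<^sup>2 * K\<^sup>2 * M * \<bar>\<tau>\<bar> ^ 3"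
      by (intro norm_triangle_mono R1 e2 R3 R4 R5)
    also have "\<dots> = C' * \<bar>\<tau>\<bar> ^ 3" by (simp add: C'_def algebra_simps)
    finally show ?case using flow z(1) by blast
  qed
  then show "jet_curve c x (a + \<kappa> *\<^sub>R f) (b + \<kappa> *\<^sub>R L a + (\<kappa>\<^sup>2 / 2) *\<^sub>R L f)
      (\<lambda>\<tau>. Option.bind (p \<tau>) (flow A X (\<kappa> * \<tau>)))"
    unfolding jet_curve_def by blast
qed

end


section \<open>The contact Hamiltonian field of a sum and the integrator\<close>

lemma (in smooth_form) linear_ext_deriv:
  assumes "u \<in> W"
  shows "linear (ext_deriv \<alpha> u v)"
proof -
  have "linear (\<lambda>w. \<Sum>b\<in>Basis. (w \<bullet> b) * Dat (\<lambda>y. \<alpha> y b) u v)"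
    by (rule linearI) (simp_all add: inner_add_left distrib_right sum.distrib sum_distrib_left mult.assoc)
  moreover have "(\<lambda>w. Dat (\<lambda>y. \<alpha> y w) u v) = (\<lambda>w. \<Sum>b\<in>Basis. (w \<bullet> b) * Dat (\<lambda>y. \<alpha> y b) u v)"
    by (rule ext) (rule Dform_eq_sum_Basis[OF assms])
  ultimately have "linear (\<lambda>w. Dat (\<lambda>y. \<alpha> y w) u v)"
    by (rule back_subst[of linear, OF _ sym])
  then have "linear (\<lambda>w. Dat (\<lambda>y. \<alpha> y w) u v - Dat (\<lambda>y. \<alpha> y v) u w)"
    using assms by (intro linear_compose_sub linear_Dat form_diff)
  moreover have "ext_deriv \<alpha> u v = (\<lambda>w. Dat (\<lambda>y. \<alpha> y w) u v - Dat (\<lambda>y. \<alpha> y v) u w)"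
    by (auto simp: ext_deriv_def)
  ultimately show ?thesis by simp
qed

text \<open>Cartan's formula \<open>\<L>\<^sub>Y \<alpha> = \<iota>\<^sub>Y d\<alpha> + d(\<alpha>(Y))\<close> for a field in the kernel of \<open>\<alpha>\<close>. Differentiating
  \<open>\<alpha>(Y) = 0\<close> along a line in the direction \<open>v\<close> yields the term by which the two sides differ.\<close>

lemma (in smooth_form) lie_deriv_eq_ext_deriv:
  assumes u: "u \<in> W" and Y: "Y differentiable (at u)" and zero: "\<And>y. y \<in> W \<Longrightarrow> \<alpha> y (Y y) = 0"
  shows "lie_deriv Y \<alpha> u v = ext_deriv \<alpha> u (Y u) v"
proof -
  let ?\<gamma> = "\<lambda>s. u + s *\<^sub>R v"
  let ?J = "{s. ?\<gamma> s \<in> W}"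
  have "open (?\<gamma> -` W)"
    by (rule open_vimage[OF open_W]) (intro continuous_intros)
  then have J: "open ?J" "0 \<in> ?J" using u by (auto simp: vimage_def)
  have \<gamma>: "(?\<gamma> has_vector_derivative v) (at 0)"
    by (auto intro!: derivative_eq_intros)
  have "((Y \<circ> ?\<gamma>) has_vector_derivative Dat Y u v) (at 0)"
    by (rule vector_derivative_diff_chain_within[OF \<gamma> has_derivative_at_withinI])
      (simp add: has_derivative_Dat[OF Y])
  then have "((\<lambda>s. \<alpha> (?\<gamma> s) ((Y \<circ> ?\<gamma>) s)) has_vector_derivative
      Dat (\<lambda>y. \<alpha> y ((Y \<circ> ?\<gamma>) 0)) (?\<gamma> 0) v + \<alpha> (?\<gamma> 0) (Dat Y u v)) (at 0 within ?J)"
    by (intro form_along_curve[OF has_vector_derivative_at_within[OF \<gamma>]]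
        has_vector_derivative_at_within[OF \<open>((Y \<circ> ?\<gamma>) has_vector_derivative Dat Y u v) (at 0)\<close>] J)
      auto
  then have "((\<lambda>s. \<alpha> (?\<gamma> s) (Y (?\<gamma> s))) has_vector_derivative
      Dat (\<lambda>y. \<alpha> y (Y u)) u v + \<alpha> u (Dat Y u v)) (at 0 within ?J)"
    by simp
  then have "((\<lambda>s. 0) has_vector_derivative
      Dat (\<lambda>y. \<alpha> y (Y u)) u v + \<alpha> u (Dat Y u v)) (at 0 within ?J)"
    by (rule has_vector_derivative_transform[OF J(2), rotated]) (simp add: zero)
  then have "((\<lambda>s. 0) has_vector_derivative Dat (\<lambda>y. \<alpha> y (Y u)) u v + \<alpha> u (Dat Y u v)) (at 0)"
    by (simp add: at_within_open[OF J(2,1)])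
  from vector_derivative_unique_at[OF this has_vector_derivative_const]
  show ?thesis by (simp add: lie_deriv_def ext_deriv_def)
qed

lemma (in smooth_form) lie_deriv_diff_sum:
  assumes u: "u \<in> W" and Z: "Z differentiable (at u)" and X: "\<And>j. j \<in> J \<Longrightarrow> X j differentiable (at u)"
  shows "lie_deriv (\<lambda>y. Z y - (\<Sum>j\<in>J. X j y)) \<alpha> u v = lie_deriv Z \<alpha> u v - (\<Sum>j\<in>J. lie_deriv (X j) \<alpha> u v)"
proof -
  have "((\<lambda>y. Z y - (\<Sum>j\<in>J. X j y)) has_derivative (\<lambda>v. Dat Z u v - (\<Sum>j\<in>J. Dat (X j) u v))) (at u)"
    using Z X by (intro has_derivative_diff has_derivative_sum has_derivative_Dat)
  then have "Dat (\<lambda>y. Z y - (\<Sum>j\<in>J. X j y)) u v = Dat Z u v - (\<Sum>j\<in>J. Dat (X j) u v)"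
    by (rule fun_cong[OF frechet_derivative_at, symmetric])
  then show ?thesis
    using linear_Dat[OF form_diff[OF u, of v]]
    by (simp add: lie_deriv_def linear_diff linear_sum linear_diff[OF lin[OF u]] linear_sum[OF lin[OF u]] sum.distrib)
qed

text \<open>A contact Hamiltonian field is determined by its Hamiltonian. The difference \<open>Y\<close> of the two sides
  satisfies \<open>\<eta>(Y) = 0\<close> and \<open>\<L>\<^sub>Y \<eta> = \<rho> \<eta>\<close>, hence \<open>d\<eta>(Y, \<cdot>) = \<rho> \<eta>\<close> by Cartan's formula, and the
  nondegeneracy of \<open>\<eta> \<and> (d\<eta>)\<^sup>n\<close> leaves only \<open>Y = 0\<close>.\<close>

lemma contact_hamiltonian_field_sum:
  fixes A :: "('m::{t2_space, second_countable_topology}, 'e::euclidean_space) chart set"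
  assumes M: "exact_contact_manifold n A \<eta>"
    and H: "\<And>x. x \<in> manifold A \<Longrightarrow> H x = (\<Sum>j\<in>J. \<phi> j x)"
    and Z: "contact_hamiltonian_field A \<eta> H Z"
    and X: "\<And>j. j \<in> J \<Longrightarrow> contact_hamiltonian_field A \<eta> (\<phi> j) (X j)"
    and c: "c \<in> A" and u: "u \<in> chart_img c"
  shows "Z c u = (\<Sum>j\<in>J. X j c u)"
proof -
  interpret atlas_form A \<eta>
    using M by unfold_locales (auto simp: exact_contact_manifold_def)
  interpret form: smooth_form "chart_img c" "\<eta> c" by (rule smooth_form[OF c])
  have diff: "Y c differentiable (at u)" if "vector_field A Y" for Y :: "('m, 'e) vfield"
  proof -
    have "Ck_on 1 (Y c) (chart_img c)"
      using that c unfolding vector_field_def smooth_on_def by blast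
    then show ?thesis using u by simp
  qed
  have Zd: "Z c differentiable (at u)"
    and Z\<eta>: "\<And>y. y \<in> chart_img c \<Longrightarrow> \<eta> c y (Z c y) = - H (chart_inv c y)"
    using Z c diff by (auto simp: contact_hamiltonian_field_def)
  have Xd: "\<And>j. j \<in> J \<Longrightarrow> X j c differentiable (at u)"
    and X\<eta>: "\<And>j y. j \<in> J \<Longrightarrow> y \<in> chart_img c \<Longrightarrow> \<eta> c y (X j c y) = - \<phi> j (chart_inv c y)"
    using X c diff by (auto simp: contact_hamiltonian_field_def)
  obtain \<rho> where \<rho>: "\<And>v. lie_deriv (Z c) (\<eta> c) u v = \<rho> * \<eta> c u v"
    using Z c u unfolding contact_hamiltonian_field_def by meson
  have "\<exists>\<rho>. \<forall>v. lie_deriv (X j c) (\<eta> c) u v = \<rho> * \<eta> c u v" if "j \<in> J" for j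
    using X[OF that] c u unfolding contact_hamiltonian_field_def by meson
  then obtain \<sigma> where \<sigma>: "\<And>j v. j \<in> J \<Longrightarrow> lie_deriv (X j c) (\<eta> c) u v = \<sigma> j * \<eta> c u v"
    by metis
  define Y where "Y y = Z c y - (\<Sum>j\<in>J. X j c y)" for y
  have zero: "\<eta> c y (Y y) = 0" if y: "y \<in> chart_img c" for y
  proof -
    have "H (chart_inv c y) = (\<Sum>j\<in>J. \<phi> j (chart_inv c y))"
      using H inv_in_dom[OF c y] dom_subset_manifold[OF c] by blast
    then show ?thesis
      by (simp add: Y_def linear_diff[OF form.lin[OF y]] linear_sum[OF form.lin[OF y]] Z\<eta>[OF y] X\<eta>[OF _ y]
          sum_negf)
  qed
  have "(Y has_derivative (\<lambda>v. Dat (Z c) u v - (\<Sum>j\<in>J. Dat (X j c) u v))) (at u)"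
    unfolding Y_def by (intro has_derivative_diff has_derivative_sum has_derivative_Dat Zd Xd)
  then have "Y differentiable (at u)"
    unfolding differentiable_def by blast
  then have "ext_deriv (\<eta> c) u (Y u) v = lie_deriv Y (\<eta> c) u v" for v
    by (simp add: form.lie_deriv_eq_ext_deriv[OF u _ zero])
  also have "lie_deriv Y (\<eta> c) u v = (\<rho> - (\<Sum>j\<in>J. \<sigma> j)) * \<eta> c u v" for v
  proof -
    have "lie_deriv Y (\<eta> c) u v = lie_deriv (Z c) (\<eta> c) u v - (\<Sum>j\<in>J. lie_deriv (X j c) (\<eta> c) u v)"
      unfolding Y_def by (rule form.lie_deriv_diff_sum[OF u Zd Xd])
    then show ?thesis
      by (simp add: \<rho> \<sigma> sum_distrib_right left_diff_distrib)
  qed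
  finally have ext: "ext_deriv (\<eta> c) u (Y u) v = (\<rho> - (\<Sum>j\<in>J. \<sigma> j)) * \<eta> c u v" for v .
  obtain v where "contact_volume n (\<eta> c) u v \<noteq> 0"
    using M c u unfolding exact_contact_manifold_def by blast
  then have vol: "alt_sum n (\<eta> c u) (ext_deriv (\<eta> c) u) v \<noteq> 0"
    by (simp add: contact_volume_alt_sum)
  have dim: "DIM('e) = 2 * n + 1"
    using M by (simp add: exact_contact_manifold_def)
  have anti: "ext_deriv (\<eta> c) u v w = - ext_deriv (\<eta> c) u w v" for v w
    by (simp add: ext_deriv_def)
  have "Y u = 0"
    by (rule nondegenerate_kernel[where a = "\<eta> c u" and w = "ext_deriv (\<eta> c) u",
          OF dim form.lin[OF u] form.linear_ext_deriv[OF u] anti vol zero[OF u] ext])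
  then show ?thesis by (simp add: Y_def)
qed

theorem proposition9:
  fixes A :: "('m::{t2_space, second_countable_topology}, 'e::euclidean_space) chart set"
    and \<eta> :: "('m, 'e) form1"
    and H :: "'m \<Rightarrow> real"
    and \<phi> :: "nat \<Rightarrow> 'm \<Rightarrow> real"
    and X\<^sub>H :: "('m, 'e) vfield"
    and X :: "nat \<Rightarrow> ('m, 'e) vfield"
    and closed_form :: "(real \<Rightarrow> 'm \<rightharpoonup> 'm) \<Rightarrow> bool"
    and n N :: nat
  assumes "exact_contact_manifold n A \<eta>"
    and "N \<ge> 1"
    and "smooth_function A H"
    and "\<And>j. j \<in> {1..N} \<Longrightarrow> smooth_function A (\<phi> j)"
    and "\<And>x. x \<in> manifold A \<Longrightarrow> H x = (\<Sum>j=1..N. \<phi> j x)"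
    and "contact_hamiltonian_field A \<eta> H X\<^sub>H"
    and "\<And>j. j \<in> {1..N} \<Longrightarrow> contact_hamiltonian_field A \<eta> (\<phi> j) (X j)"
    and "\<And>j. j \<in> {1..N} \<Longrightarrow> exactly_integrable closed_form A (X j)"
  shows "contact_integrator_of_order 2 A \<eta> X\<^sub>H (S2 A X N)"
proof -
  interpret atlas_form A \<eta>
    using assms(1) by unfold_locales (auto simp: exact_contact_manifold_def)
  interpret contact_manifold A \<eta>
  proof
    fix c u assume "c \<in> A" "u \<in> chart_img c"
    then obtain v where "contact_volume n (\<eta> c) u v \<noteq> 0"
      using assms(1) unfolding exact_contact_manifold_def by blast
    then show "\<exists>w. \<eta> c u w \<noteq> 0"
      by (rule_tac ccontr) (simp add: contact_volume_def)
  qed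
  have field: "vector_field A (X j)" if "j \<in> {1..N}" for j
    using assms(7)[OF that] by (simp add: contact_hamiltonian_field_def)
  have fieldH: "vector_field A X\<^sub>H"
    using assms(6) by (simp add: contact_hamiltonian_field_def)
  have "contact_map A \<eta> (S2 A X N \<tau>)" for \<tau>
    unfolding S2_def using assms(2)
    by (intro contact_map_foldr) (auto intro!: contact_map_flow[OF assms(7)])
  moreover have "integrator_of_order 2 A X\<^sub>H (S2 A X N)"
    unfolding integrator_of_order_def
  proof (intro ballI)
    fix c x assume c: "c \<in> A" "x \<in> chart_dom c"
    let ?u = "coord c x"
    define f where "f j = X j c ?u" for j
    define D where "D j = Dat (X j c) ?u" for j
    define F where "F = X\<^sub>H c ?u"
    define L where "L = Dat (X\<^sub>H c) ?u"
    have u: "?u \<in> chart_img c" by (rule coord_in_img[OF c])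
    have diff: "X j c differentiable (at ?u)" if "j \<in> {1..N}" for j
    proof -
      have "Ck_on 1 (X j c) (chart_img c)"
        using field[OF that] c(1) unfolding vector_field_def smooth_on_def by blast
      then show ?thesis using u by simp
    qed
    have sum: "X\<^sub>H c y = (\<Sum>j=1..N. X j c y)" if "y \<in> chart_img c" for y
      by (rule contact_hamiltonian_field_sum[OF assms(1,5,6,7) c(1) that])
    have last: "{1..N} = insert N {1..<N}" using assms(2) by auto
    have F: "F = (\<Sum>j\<leftarrow>[1..<N]. f j) + f N"
      unfolding F_def f_def sum[OF u] last by (simp add: sum_list_distinct_conv_sum_set add.commute)
    have "((\<lambda>y. \<Sum>j=1..N. X j c y) has_derivative (\<lambda>v. \<Sum>j=1..N. D j v)) (at ?u)"
      unfolding D_def using diff by (intro has_derivative_sum has_derivative_Dat)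
    then have "(X\<^sub>H c has_derivative (\<lambda>v. \<Sum>j=1..N. D j v)) (at ?u)"
      by (rule has_derivative_transform_within_open[OF _ open_chart_img[OF c(1)] u]) (simp add: sum)
    then have "L = (\<lambda>v. \<Sum>j=1..N. D j v)"
      unfolding L_def by (rule frechet_derivative_at[symmetric])
    then have L: "L = (\<lambda>v. (\<Sum>j\<leftarrow>[1..<N]. D j v) + D N v)"
      unfolding last by (simp add: sum_list_distinct_conv_sum_set add.commute)
    have E: "jet_map c x ((1/2) *\<^sub>R f j) (\<lambda>v. (1/2) *\<^sub>R D j v) ((1/8) *\<^sub>R D j (f j)) (\<lambda>\<tau>. flow A (X j) (\<tau> / 2))"
      if "j \<in> set [1..<N]" for j
      using jet_map_flow[OF field c, of j "1/2"] that by (simp add: f_def D_def power2_eq_square)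
    have G: "jet_map c x (f N) (D N) ((1/2) *\<^sub>R D N (f N)) (flow A (X N))"
      using jet_map_flow[OF field c, of N 1] assms(2) by (simp add: f_def D_def)
    have "jet_map c x F L ((1/2) *\<^sub>R L F) (S2 A X N)"
      unfolding F L S2_def[abs_def]
      by (rule jet_map_palindrome[where E = "\<lambda>j \<tau>. flow A (X j) (\<tau> / 2)", OF E _ G])
        (use diff in \<open>auto simp: D_def intro!: linear_Dat\<close>)
    moreover have "jet_map c x F L ((1/2) *\<^sub>R L F) (flow A X\<^sub>H)"
      using jet_map_flow[OF fieldH c, of 1] by (simp add: F_def L_def)
    ultimately have "jet_curve c x F ((1/2) *\<^sub>R L F) (\<lambda>\<tau>. S2 A X N \<tau> x)"
      "jet_curve c x F ((1/2) *\<^sub>R L F) (\<lambda>\<tau>. flow A X\<^sub>H \<tau> x)"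
      using jet_map_at_base_point[OF _ c(2)] by blast+
    from jet_curves_agree[OF this]
    show "(\<forall>\<^sub>F \<tau> in at 0. \<exists>y\<in>chart_dom c. \<exists>z\<in>chart_dom c.
           S2 A X N \<tau> x = Some y \<and> flow A X\<^sub>H \<tau> x = Some z) \<and>
        (\<lambda>\<tau>. norm (coord c (the (S2 A X N \<tau> x)) - coord c (the (flow A X\<^sub>H \<tau> x))))
          \<in> O[at 0](\<lambda>\<tau>. \<tau> ^ (2 + 1))"
      by simp
  qed
  ultimately show ?thesis
    by (simp add: contact_integrator_of_order_def)
qed

end
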